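(* Let $X$ be a closed smooth manifold equipped with a smooth density $|dx|$, and let $P$ be a symmetric differential operator of degree $1$ with smooth coefficients on $X$, acting on complex-valued functions. Then $P$, with domain $C^\infty(X)$, is essentially self-adjoint on $L^2(X,|dx|)$.
   Context: Closed means compact without boundary. $P$ is symmetric if $\int_X Pf\,\bar g\,|dx|=\int_X f\,\overline{Pg}\,|dx|$ for all smooth complex-valued $f,g$ on $X$. The adjoint $P^\star$ has as domain the set of $f\in L^2=L^2(X,|dx|)$ such that $Pf$ (in the sense of distributions) belongs to $L^2$, and $P^\star f=Pf$. $P$ is essentially self-adjoint if the graph of $P^\star$ is the closure in $L^2\times L^2$ of the graph of $P$ with domain $C^\infty(X)$; i.e. for all $u,v\in L^2$ with $v=Pu$ there are smooth $u_n$ with $(u_n,Pu_n)\to(u,v)$ in $L^2\times L^2$. *)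

theory Defs
  imports "HOL-Analysis.Analysis"
begin

section \<open>Smooth maps between Euclidean spaces\<close>

text \<open>
  Only used for open \<open>S\<close>, where \<open>at x within S\<close> coincides with \<open>at x\<close>, and for
  \<open>S \<subseteq> {0}\<close>, where every function is smooth.
\<close>

primrec times_differentiable_on ::
    "nat \<Rightarrow> 'e::euclidean_space set \<Rightarrow> ('e \<Rightarrow> 'b::real_normed_vector) \<Rightarrow> bool"
where
  "times_differentiable_on 0 S f \<longleftrightarrow> continuous_on S f"
| "times_differentiable_on (Suc k) S f \<longleftrightarrow>
     (\<forall>x\<in>S. f differentiable (at x within S)) \<and>
     (\<forall>v. times_differentiable_on k S (\<lambda>x. frechet_derivative f (at x within S) v))"

definition smooth_on :: "'e::euclidean_space set \<Rightarrow> ('e \<Rightarrow> 'b::real_normed_vector) \<Rightarrow> bool"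
  where "smooth_on S f \<longleftrightarrow> (\<forall>k. times_differentiable_on k S f)"


section \<open>Closed manifolds, smooth functions, smooth densities\<close>

text \<open>
  A closed manifold is a compact Hausdorff type with a smooth atlas of pairs \<open>(U, \<phi>)\<close>, where
  \<open>\<phi>\<close> maps \<open>U\<close> homeomorphically onto an open subset of the model space \<open>E\<close>. Second
  countability follows from compactness. The type class \<open>euclidean_space\<close> only provides positive
  dimensions, so \<open>E\<close> is either the whole type (dimension \<open>DIM('e)\<close>) or the point \<open>{0}\<close>
  (dimension 0); in both cases \<open>Basis \<inter> E\<close> is an orthonormal basis of \<open>E\<close>.
\<close>

type_synonym ('a, 'e) chart = "'a set \<times> ('a \<Rightarrow> 'e)"

definition smooth_atlas ::
    "'e::euclidean_space set \<Rightarrow> ('a::t2_space, 'e) chart set \<Rightarrow> bool"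
  where "smooth_atlas E A \<longleftrightarrow>
    (\<Union>(U, \<phi>)\<in>A. U) = UNIV \<and>
    (\<forall>(U, \<phi>)\<in>A. open U \<and> openin (top_of_set E) (\<phi> ` U) \<and>
                 homeomorphism U (\<phi> ` U) \<phi> (inv_into U \<phi>)) \<and>
    (\<forall>(U, \<phi>)\<in>A. \<forall>(V, \<psi>)\<in>A. smooth_on (\<phi> ` (U \<inter> V)) (\<psi> \<circ> inv_into U \<phi>))"

definition closed_manifold ::
    "'e::euclidean_space set \<Rightarrow> ('a::t2_space, 'e) chart set \<Rightarrow> bool"
  where "closed_manifold E A \<longleftrightarrow>
    (E = UNIV \<or> E = {0}) \<and> compact (UNIV :: 'a set) \<and> smooth_atlas E A"

definition smooth_functions ::
    "('a::t2_space, 'e::euclidean_space) chart set \<Rightarrow> ('a \<Rightarrow> complex) set"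
  where "smooth_functions A = {f. \<forall>(U, \<phi>)\<in>A. smooth_on (\<phi> ` U) (f \<circ> inv_into U \<phi>)}"

definition model_measure :: "'e::euclidean_space set \<Rightarrow> 'e measure"
  where "model_measure E =
    (if E = UNIV then lborel else distr (count_space {0}) borel (\<lambda>x. x))"

text \<open>
  The density \<open>|dx|\<close> is given as the measure it defines: in every chart it is a smooth positive
  function times Lebesgue measure (times counting measure in dimension 0).
\<close>

definition smooth_density ::
    "'e::euclidean_space set \<Rightarrow> ('a::t2_space, 'e) chart set \<Rightarrow> 'a measure \<Rightarrow> bool"
  where "smooth_density E A M \<longleftrightarrow>
    sets M = sets borel \<and>
    (\<forall>(U, \<phi>)\<in>A. \<exists>w :: 'e \<Rightarrow> real.
       smooth_on (\<phi> ` U) w \<and> (\<forall>y\<in>\<phi> ` U. w y > 0) \<and>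
       distr (restrict_space M U) borel \<phi> =
         density (model_measure E) (\<lambda>y. ennreal (w y) * indicator (\<phi> ` U) y))"


section \<open>Differential operators of degree 1\<close>

text \<open>
  Operators are total functions whose values matter on smooth functions only. In a chart,
  \<open>P = \<Sum>\<^sub>i a\<^sub>i \<partial>\<^sub>i + b\<close> with smooth complex coefficients.
\<close>

definition differential_operator1 ::
    "'e::euclidean_space set \<Rightarrow> ('a::t2_space, 'e) chart set \<Rightarrow>
     (('a \<Rightarrow> complex) \<Rightarrow> 'a \<Rightarrow> complex) \<Rightarrow> bool"
  where "differential_operator1 E A P \<longleftrightarrow>
    (\<forall>(U, \<phi>)\<in>A. \<exists>(a :: 'e \<Rightarrow> 'e \<Rightarrow> complex) (b :: 'e \<Rightarrow> complex).
       (\<forall>i\<in>Basis \<inter> E. smooth_on (\<phi> ` U) (a i)) \<and> smooth_on (\<phi> ` U) b \<and>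
       (\<forall>f\<in>smooth_functions A. \<forall>x\<in>U.
          P f x =
            (\<Sum>i\<in>Basis \<inter> E. a i (\<phi> x) *
               frechet_derivative (f \<circ> inv_into U \<phi>) (at (\<phi> x) within \<phi> ` U) i)
            + b (\<phi> x) * f x))"

definition symmetric_operator ::
    "('a::t2_space, 'e::euclidean_space) chart set \<Rightarrow> 'a measure \<Rightarrow>
     (('a \<Rightarrow> complex) \<Rightarrow> 'a \<Rightarrow> complex) \<Rightarrow> bool"
  where "symmetric_operator A M P \<longleftrightarrow>
    (\<forall>f\<in>smooth_functions A. \<forall>g\<in>smooth_functions A.
       (\<integral>x. P f x * cnj (g x) \<partial>M) = (\<integral>x. f x * cnj (P g x) \<partial>M))"


section \<open>Essential self-adjointness\<close>

text \<open>
  Elements of \<open>L\<^sup>2\<close> are represented by functions; all sets of pairs compared below are closed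
  under changing representatives.
\<close>

definition L2 :: "'a measure \<Rightarrow> ('a \<Rightarrow> complex) set"
  where "L2 M = {f \<in> borel_measurable M. integrable M (\<lambda>x. (cmod (f x))\<^sup>2)}"

definition L2_norm :: "'a measure \<Rightarrow> ('a \<Rightarrow> complex) \<Rightarrow> real"
  where "L2_norm M f = sqrt (\<integral>x. (cmod (f x))\<^sup>2 \<partial>M)"

definition L2_closure ::
    "'a measure \<Rightarrow> (('a \<Rightarrow> complex) \<times> ('a \<Rightarrow> complex)) set \<Rightarrow>
     (('a \<Rightarrow> complex) \<times> ('a \<Rightarrow> complex)) set"
  where "L2_closure M G = {(u, v). u \<in> L2 M \<and> v \<in> L2 M \<and>
    (\<exists>us vs. (\<forall>n::nat. (us n, vs n) \<in> G \<inter> L2 M \<times> L2 M) \<and>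
       (\<lambda>n. L2_norm M (\<lambda>x. us n x - u x)) \<longlonglongrightarrow> 0 \<and>
       (\<lambda>n. L2_norm M (\<lambda>x. vs n x - v x)) \<longlonglongrightarrow> 0)}"

text \<open>
  A function \<open>u\<close> in \<open>L\<^sup>2\<close> is the distribution mapping \<open>g\<close> to the integral of \<open>u g\<close>, and \<open>P\<close> acts
  on distributions by duality through its formal transpose \<open>Q\<close>, which is unique on smooth functions.
\<close>

definition formal_transpose ::
    "('a::t2_space, 'e::euclidean_space) chart set \<Rightarrow> 'a measure \<Rightarrow>
     (('a \<Rightarrow> complex) \<Rightarrow> 'a \<Rightarrow> complex) \<Rightarrow> (('a \<Rightarrow> complex) \<Rightarrow> 'a \<Rightarrow> complex) \<Rightarrow> bool"
  where "formal_transpose A M P Q \<longleftrightarrow>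
    (\<forall>g\<in>smooth_functions A. Q g \<in> smooth_functions A) \<and>
    (\<forall>f\<in>smooth_functions A. \<forall>g\<in>smooth_functions A.
       (\<integral>x. P f x * g x \<partial>M) = (\<integral>x. f x * Q g x \<partial>M))"

definition distributional_image ::
    "('a::t2_space, 'e::euclidean_space) chart set \<Rightarrow> 'a measure \<Rightarrow>
     (('a \<Rightarrow> complex) \<Rightarrow> 'a \<Rightarrow> complex) \<Rightarrow> ('a \<Rightarrow> complex) \<Rightarrow> ('a \<Rightarrow> complex) \<Rightarrow> bool"
  where "distributional_image A M P u v \<longleftrightarrow>
    (\<exists>Q. formal_transpose A M P Q \<and>
       (\<forall>g\<in>smooth_functions A. (\<integral>x. v x * g x \<partial>M) = (\<integral>x. u x * Q g x \<partial>M)))"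

definition operator_graph ::
    "('a::t2_space, 'e::euclidean_space) chart set \<Rightarrow>
     (('a \<Rightarrow> complex) \<Rightarrow> 'a \<Rightarrow> complex) \<Rightarrow> (('a \<Rightarrow> complex) \<times> ('a \<Rightarrow> complex)) set"
  where "operator_graph A P = {(f, P f) | f. f \<in> smooth_functions A}"

definition adjoint_graph ::
    "('a::t2_space, 'e::euclidean_space) chart set \<Rightarrow> 'a measure \<Rightarrow>
     (('a \<Rightarrow> complex) \<Rightarrow> 'a \<Rightarrow> complex) \<Rightarrow> (('a \<Rightarrow> complex) \<times> ('a \<Rightarrow> complex)) set"
  where "adjoint_graph A M P =
    {(u, v). u \<in> L2 M \<and> v \<in> L2 M \<and> distributional_image A M P u v}"

text \<open>
  For symmetric \<open>P\<close>: the adjoint acts as \<open>P\<close> itself in the sense of distributions.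
\<close>

definition essentially_self_adjoint ::
    "('a::t2_space, 'e::euclidean_space) chart set \<Rightarrow> 'a measure \<Rightarrow>
     (('a \<Rightarrow> complex) \<Rightarrow> 'a \<Rightarrow> complex) \<Rightarrow> bool"
  where "essentially_self_adjoint A M P \<longleftrightarrow>
    adjoint_graph A M P = L2_closure M (operator_graph A P)"

end

theory Submission
  imports Defs
begin

text \<open>
  A solution \<open>v = P u\<close> in the sense of distributions is cut off to a chart and mollified. By Friedrichs'
  commutator estimate, which for an operator of degree 1 is Schur's test for a kernel of size
  \<open>\<epsilon>\<^sup>-\<^sup>n\<close> supported at distance \<open>O(\<epsilon>)\<close> from the diagonal, the mollified functions \<open>u\<^sub>\<epsilon>\<close> and \<open>P u\<^sub>\<epsilon>\<close>
  stay bounded in \<open>L\<^sup>2\<close>; symmetry enters this bound only through the vanishing of the real part of the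
  principal coefficients. Boundedness and weak convergence of \<open>(u\<^sub>\<epsilon>, P u\<^sub>\<epsilon>)\<close> to \<open>(u, v)\<close> put the
  limit into the strong closure of the graph, so the commutators need not tend to zero.
\<close>

section \<open>Calculus of smooth maps on open sets\<close>

text \<open>Symmetry supplies the transpose of \<open>P\<close> in closed form: it is
  \<open>P\<close> conjugated by complex conjugation. So no integration by parts is carried out in
  charts; whenever a derivative moves from one factor to another, it does so through this identity.
  Skewness of the coefficients matters at one point. Applying \<open>P\<close> to the mollified
  \<open>u\<close> puts the coefficient at the outer point x in front of the kernel derivative,
  while pairing \<open>v\<close> with the kernel puts the conjugated coefficient at the integration
  point y there. The two combine to a difference a(x) - a(y), of the size of the scale, because
  conjugation changes the sign of the coefficient; this pays for the inverse scale lost in the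
  derivative. The kernel is normalized by the integral of the bump, which is never computed. Volumes
  of balls are compared with it instead, so the power of the scale cancels in Schur's test without
  being written down.\<close>

lemma times_differentiable_on_cong:
  assumes "\<And>x. x \<in> S \<Longrightarrow> f x = g x"
  shows "times_differentiable_on k S f \<longleftrightarrow> times_differentiable_on k S g"
  using assms
proof (induction k arbitrary: f g)
  case 0
  then show ?case by (simp cong: continuous_on_cong)
next
  case (Suc k)
  have iff: "(f has_derivative f') (at x within S) \<longleftrightarrow> (g has_derivative f') (at x within S)"
    if "x \<in> S" for x f'
    using that Suc.prems has_derivative_transform by metis
  \<comment> \<open>\<open>frechet_derivative\<close> is a choice among all derivatives, so two
    functions with the same set of derivatives get the same value, even at points where the
    derivative relative to \<open>S\<close> is not unique.\<close>
  have 1: "frechet_derivative f (at x within S) v = frechet_derivative g (at x within S) v"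
    if "x \<in> S" for x v
    using iff[OF that] by (simp add: frechet_derivative_def)
  have 2: "f differentiable (at x within S) \<longleftrightarrow> g differentiable (at x within S)" if "x \<in> S" for x
    using iff[OF that] by (simp add: differentiable_def)
  have 3: "times_differentiable_on k S (\<lambda>x. frechet_derivative f (at x within S) v) \<longleftrightarrow>
      times_differentiable_on k S (\<lambda>x. frechet_derivative g (at x within S) v)" for v
    by (rule Suc.IH) (rule 1)
  show ?case
    unfolding times_differentiable_on.simps using 2 3 by blast
qed

lemma smooth_on_cong:
  assumes "\<And>x. x \<in> S \<Longrightarrow> f x = g x"
  shows "smooth_on S f \<longleftrightarrow> smooth_on S g"
proof -
  have "times_differentiable_on k S f \<longleftrightarrow> times_differentiable_on k S g" for k
    by (rule times_differentiable_on_cong) (rule assms)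
  then show ?thesis by (simp add: smooth_on_def)
qed

text \<open>On an open set the derivative is unique, so any explicit candidate \<open>D\<close> may
  replace the chosen \<open>frechet_derivative\<close>. Most inductions on the order of
  differentiability go through this rule.\<close>

lemma times_differentiable_on_SucI:
  assumes "open S" "\<And>x. x \<in> S \<Longrightarrow> (f has_derivative D x) (at x)"
    and "\<And>v. times_differentiable_on k S (\<lambda>x. D x v)"
  shows "times_differentiable_on (Suc k) S f"
proof -
  have "frechet_derivative f (at x within S) = D x" if "x \<in> S" for x
    using assms(1,2) that at_within_open frechet_derivative_at by metis
  then have "times_differentiable_on k S (\<lambda>x. frechet_derivative f (at x within S) v)" for v
    by (intro times_differentiable_on_cong[THEN iffD1, OF _ assms(3)[of v]]) simp
  moreover have "f differentiable (at x within S)" if "x \<in> S" for x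
    using assms(1,2) that at_within_open differentiable_def by metis
  ultimately show ?thesis by simp
qed

lemma times_differentiable_on_SucD:
  assumes "times_differentiable_on (Suc k) S f" "open S"
  shows "x \<in> S \<Longrightarrow> (f has_derivative frechet_derivative f (at x)) (at x)"
    and "times_differentiable_on k S (\<lambda>x. frechet_derivative f (at x) v)"
proof -
  show "(f has_derivative frechet_derivative f (at x)) (at x)" if "x \<in> S"
    using assms that at_within_open[OF that \<open>open S\<close>] frechet_derivative_works
    by fastforce
  have "times_differentiable_on k S (\<lambda>x. frechet_derivative f (at x within S) v)"
    using assms by simp
  then show "times_differentiable_on k S (\<lambda>x. frechet_derivative f (at x) v)"
    by (rule times_differentiable_on_cong[THEN iffD1, rotated])
       (simp add: at_within_open[OF _ \<open>open S\<close>])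
qed

lemma times_differentiable_on_Suc_imp:
  "times_differentiable_on (Suc k) S f \<Longrightarrow> times_differentiable_on k S f"
proof (induction k arbitrary: f)
  case 0
  then show ?case
    by (auto simp: continuous_on_eq_continuous_within differentiable_imp_continuous_within)
next
  case (Suc k)
  then show ?case by (metis times_differentiable_on.simps(2))
qed

lemma times_differentiable_on_const: "open S \<Longrightarrow> times_differentiable_on k S (\<lambda>x. c)"
proof (induction k arbitrary: c)
  case (Suc k)
  show ?case
    by (rule times_differentiable_on_SucI[where D = "\<lambda>x v. 0"]) (use Suc in auto)
qed simp

lemma times_differentiable_on_linear:
  assumes "bounded_linear f" "open S"
  shows "times_differentiable_on k S f"
proof (cases k)
  case 0
  then show ?thesis by (simp add: assms linear_continuous_on)
next
  case (Suc l)
  show ?thesis unfolding Suc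
    by (rule times_differentiable_on_SucI[where D = "\<lambda>x v. f v"])
       (use assms times_differentiable_on_const bounded_linear_imp_has_derivative in auto)
qed

lemma times_differentiable_on_bounded_linear:
  assumes "bounded_linear L" "open S" "times_differentiable_on k S f"
  shows "times_differentiable_on k S (\<lambda>x. L (f x))"
  using assms(3)
proof (induction k arbitrary: f)
  case 0
  then show ?case
    using bounded_linear.continuous_on[OF assms(1)] by auto
next
  case (Suc k)
  show ?case
    by (rule times_differentiable_on_SucI[where D = "\<lambda>x v. L (frechet_derivative f (at x) v)"])
       (use Suc times_differentiable_on_SucD[OF Suc.prems assms(2)] assms
        in \<open>auto intro: bounded_linear.has_derivative\<close>)
qed

lemma times_differentiable_on_add:
  assumes "open S" "times_differentiable_on k S f" "times_differentiable_on k S g"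
  shows "times_differentiable_on k S (\<lambda>x. f x + g x)"
  using assms(2-)
proof (induction k arbitrary: f g)
  case 0
  then show ?case by (auto intro: continuous_intros)
next
  case (Suc k)
  note f = times_differentiable_on_SucD[OF Suc.prems(1) assms(1)]
  note g = times_differentiable_on_SucD[OF Suc.prems(2) assms(1)]
  show ?case
    by (rule times_differentiable_on_SucI[where
          D = "\<lambda>x v. frechet_derivative f (at x) v + frechet_derivative g (at x) v"])
       (use f g Suc.IH assms in \<open>auto intro: has_derivative_add\<close>)
qed

lemma times_differentiable_on_sum:
  assumes "open S" "\<And>i. i \<in> I \<Longrightarrow> times_differentiable_on k S (f i)"
  shows "times_differentiable_on k S (\<lambda>x. \<Sum>i\<in>I. f i x)"
  using assms(2)
  by (induction I rule: infinite_finite_induct)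
     (auto intro: times_differentiable_on_const times_differentiable_on_add assms(1))

lemma times_differentiable_on_bilinear:
  assumes "bounded_bilinear pr" "open S"
    "times_differentiable_on k S f" "times_differentiable_on k S g"
  shows "times_differentiable_on k S (\<lambda>x. pr (f x) (g x))"
  using assms(3-)
proof (induction k arbitrary: f g)
  case 0
  then show ?case by (simp add: bounded_bilinear.continuous_on[OF assms(1)])
next
  case (Suc k)
  note f = times_differentiable_on_SucD[OF Suc.prems(1) assms(2)]
  note g = times_differentiable_on_SucD[OF Suc.prems(2) assms(2)]
  have "times_differentiable_on k S f" "times_differentiable_on k S g"
    using Suc.prems times_differentiable_on_Suc_imp by blast+
  then show ?case
    by (intro times_differentiable_on_SucI[where
          D = "\<lambda>x v. pr (f x) (frechet_derivative g (at x) v)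
                   + pr (frechet_derivative f (at x) v) (g x)"]
        times_differentiable_on_add Suc.IH f g assms
        bounded_bilinear.FDERIV[OF assms(1)])
qed

lemma times_differentiable_on_compose:
  fixes f :: "'e::euclidean_space \<Rightarrow> 'f::euclidean_space"
  assumes "open S" "open T" "f ` S \<subseteq> T"
    "times_differentiable_on k S f" "times_differentiable_on k T g"
  shows "times_differentiable_on k S (\<lambda>x. g (f x))"
  using assms(4-)
proof (induction k arbitrary: g)
  case 0
  then show ?case
    using assms(3) continuous_on_compose2 by auto
next
  case (Suc k)
  note f = times_differentiable_on_SucD[OF Suc.prems(1) assms(1)]
  note g = times_differentiable_on_SucD[OF Suc.prems(2) assms(2)]
  have fk: "times_differentiable_on k S f"
    using Suc.prems times_differentiable_on_Suc_imp by blast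
  show ?case
  \<comment> \<open>The chain rule feeds the outer derivative the moving vector
    \<open>frechet_derivative f (at x) v\<close>, whereas the induction hypothesis covers only fixed
    directions. Expanding that vector in the basis leaves products with fixed-direction
    derivatives.\<close>
  proof (rule times_differentiable_on_SucI[where D = "\<lambda>x v. \<Sum>i\<in>Basis.
      (frechet_derivative f (at x) v \<bullet> i) *\<^sub>R frechet_derivative g (at (f x)) i"])
    show "open S" by fact
    fix x assume x: "x \<in> S"
    then have fx: "f x \<in> T" using assms(3) by auto
    have chain: "((\<lambda>x. g (f x)) has_derivative
        (\<lambda>v. frechet_derivative g (at (f x)) (frechet_derivative f (at x) v))) (at x)"
      using diff_chain_at[OF f(1)[OF x] g(1)[OF fx]] by (simp add: o_def)
    have expand: "frechet_derivative g (at (f x)) w =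
        (\<Sum>i\<in>Basis. (w \<bullet> i) *\<^sub>R frechet_derivative g (at (f x)) i)" for w
    proof -
      have lin: "linear (frechet_derivative g (at (f x)))"
        using g(1)[OF fx] has_derivative_linear by blast
      have "frechet_derivative g (at (f x)) (\<Sum>i\<in>Basis. (w \<bullet> i) *\<^sub>R i) =
          (\<Sum>i\<in>Basis. (w \<bullet> i) *\<^sub>R frechet_derivative g (at (f x)) i)"
        by (simp add: linear_sum[OF lin] linear_scale[OF lin])
      then show ?thesis by (simp add: euclidean_representation)
    qed
    show "((\<lambda>x. g (f x)) has_derivative (\<lambda>v. \<Sum>i\<in>Basis.
        (frechet_derivative f (at x) v \<bullet> i) *\<^sub>R frechet_derivative g (at (f x)) i)) (at x)"
      using chain unfolding expand[of "frechet_derivative f (at x) v" for v] .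
  next
    fix v
    show "times_differentiable_on k S (\<lambda>x. \<Sum>i\<in>Basis.
        (frechet_derivative f (at x) v \<bullet> i) *\<^sub>R frechet_derivative g (at (f x)) i)"
      by (rule times_differentiable_on_sum[OF assms(1)],
          rule times_differentiable_on_bilinear[OF bounded_bilinear_scaleR assms(1)],
          rule times_differentiable_on_bounded_linear[OF bounded_linear_inner_left assms(1) f(2)],
          rule Suc.IH[OF fk g(2)])
  qed
qed

text \<open>On open sets differentiability depends on neighbourhoods only. This lets a function on
  the manifold be smooth by different formulas near different points.\<close>

lemma times_differentiable_on_local:
  assumes "open S" "\<And>x. x \<in> S \<Longrightarrow> \<exists>T. open T \<and> x \<in> T \<and> times_differentiable_on k T f"
  shows "times_differentiable_on k S f"
  using assms(2)
proof (induction k arbitrary: f)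
  case 0
  show ?case
    unfolding times_differentiable_on.simps
  proof (rule continuous_at_imp_continuous_on, rule ballI)
    fix x assume "x \<in> S"
    then show "isCont f x"
      using 0[of x] by (auto simp: continuous_on_eq_continuous_at)
  qed
next
  case (Suc k)
  show ?case
  proof (rule times_differentiable_on_SucI[where D = "\<lambda>x. frechet_derivative f (at x)"])
    show "open S" by fact
    show "(f has_derivative frechet_derivative f (at x)) (at x)" if "x \<in> S" for x
      using Suc.prems[OF that] times_differentiable_on_SucD(1) by blast
    show "times_differentiable_on k S (\<lambda>x. frechet_derivative f (at x) v)" for v
    proof (rule Suc.IH)
      fix x assume "x \<in> S"
      then obtain T where "open T" "x \<in> T" "times_differentiable_on (Suc k) T f"
        using Suc.prems by blast
      then show "\<exists>T. open T \<and> x \<in> T \<and>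
          times_differentiable_on k T (\<lambda>x. frechet_derivative f (at x) v)"
        using times_differentiable_on_SucD(2)[of k T f v] by blast
    qed
  qed
qed

lemma smooth_on_local:
  assumes "open S" "\<And>x. x \<in> S \<Longrightarrow> \<exists>T. open T \<and> x \<in> T \<and> smooth_on T f"
  shows "smooth_on S f"
  unfolding smooth_on_def
proof
  fix k
  show "times_differentiable_on k S f"
    by (rule times_differentiable_on_local[OF assms(1)]) (use assms(2) in \<open>auto simp: smooth_on_def\<close>)
qed

text \<open>Derivatives are taken within the set, so restriction is not immediate from the
  definition; openness of both sets makes it a local matter.\<close>

lemma smooth_on_subset:
  assumes "smooth_on T f" "open S" "open T" "S \<subseteq> T"
  shows "smooth_on S f"
proof (rule smooth_on_local[OF assms(2)])
  show "\<exists>U. open U \<and> x \<in> U \<and> smooth_on U f" if "x \<in> S" for x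
    using that assms by blast
qed

lemma smooth_on_imp_continuous_on: "smooth_on S f \<Longrightarrow> continuous_on S f"
  unfolding smooth_on_def using times_differentiable_on.simps(1) by blast

lemma smooth_on_has_derivative:
  "smooth_on S f \<Longrightarrow> open S \<Longrightarrow> x \<in> S \<Longrightarrow> (f has_derivative frechet_derivative f (at x)) (at x)"
  unfolding smooth_on_def by (rule times_differentiable_on_SucD(1)[where k = 0 and S = S]) auto

lemma smooth_on_frechet_derivative:
  "smooth_on S f \<Longrightarrow> open S \<Longrightarrow> smooth_on S (\<lambda>x. frechet_derivative f (at x) v)"
  unfolding smooth_on_def by (intro allI times_differentiable_on_SucD(2)) blast

lemma smooth_on_const [intro]: "open S \<Longrightarrow> smooth_on S (\<lambda>x. c)"
  by (simp add: smooth_on_def times_differentiable_on_const)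

lemma smooth_on_linear: "bounded_linear f \<Longrightarrow> open S \<Longrightarrow> smooth_on S f"
  by (simp add: smooth_on_def times_differentiable_on_linear)

lemma smooth_on_bounded_linear:
  "bounded_linear L \<Longrightarrow> open S \<Longrightarrow> smooth_on S f \<Longrightarrow> smooth_on S (\<lambda>x. L (f x))"
  by (simp add: smooth_on_def times_differentiable_on_bounded_linear)

lemma smooth_on_add:
  "open S \<Longrightarrow> smooth_on S f \<Longrightarrow> smooth_on S g \<Longrightarrow> smooth_on S (\<lambda>x. f x + g x)"
  by (simp add: smooth_on_def times_differentiable_on_add)

lemma smooth_on_sum:
  "open S \<Longrightarrow> (\<And>i. i \<in> I \<Longrightarrow> smooth_on S (f i)) \<Longrightarrow> smooth_on S (\<lambda>x. \<Sum>i\<in>I. f i x)"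
  by (simp add: smooth_on_def times_differentiable_on_sum)

lemma smooth_on_bilinear:
  "bounded_bilinear pr \<Longrightarrow> open S \<Longrightarrow> smooth_on S f \<Longrightarrow> smooth_on S g
    \<Longrightarrow> smooth_on S (\<lambda>x. pr (f x) (g x))"
  by (simp add: smooth_on_def times_differentiable_on_bilinear)

lemmas smooth_on_mult = smooth_on_bilinear[OF bounded_bilinear_mult]
  and smooth_on_scaleR = smooth_on_bilinear[OF bounded_bilinear_scaleR]
  and smooth_on_of_real = smooth_on_bounded_linear[OF bounded_linear_of_real]
  and smooth_on_cnj = smooth_on_bounded_linear[OF bounded_linear_cnj]

lemma smooth_on_compose:
  fixes f :: "'e::euclidean_space \<Rightarrow> 'f::euclidean_space"
  assumes "open S" "open T" "f ` S \<subseteq> T" "smooth_on S f" "smooth_on T g"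
  shows "smooth_on S (\<lambda>x. g (f x))"
  using assms by (simp add: smooth_on_def times_differentiable_on_compose)

text \<open>Up to a constant the derivative is a product of two copies of the function itself, so
  the induction feeds on its own hypothesis. The reciprocal is later taken of the positive
  density.\<close>

lemma smooth_on_inverse_pos: "smooth_on {0<..} (inverse :: real \<Rightarrow> real)"
  unfolding smooth_on_def
proof
  fix k :: nat
  have op: "open {0::real<..}" by simp
  show "times_differentiable_on k {0<..} (inverse :: real \<Rightarrow> real)"
  proof (induction k)
    case 0
    show ?case by (auto intro!: continuous_intros)
  next
    case (Suc k)
    show ?case
    proof (rule times_differentiable_on_SucI[where D = "\<lambda>x v. - (inverse x * v * inverse x)"])
      fix x :: real assume "x \<in> {0<..}"
      then show "(inverse has_derivative (\<lambda>v. - (inverse x * v * inverse x))) (at x)"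
        by (intro has_derivative_inverse') auto
    next
      fix v :: real
      have "times_differentiable_on k {0<..} (\<lambda>x::real. - v * (inverse x * inverse x))"
        by (intro times_differentiable_on_bilinear[OF bounded_bilinear_mult]
            times_differentiable_on_const Suc op)
      then show "times_differentiable_on k {0<..} (\<lambda>x::real. - (inverse x * v * inverse x))"
        by (simp add: mult_ac)
    qed (rule op)
  qed
qed

section \<open>Bump functions\<close>

text \<open>The functions t^(-j) e^(-1/t), extended by 0 to the left. The extra power makes the
  family stable under differentiation up to linear combinations, so smoothness is one induction over
  all \<open>j\<close> at once.\<close>

definition flat_exp :: "nat \<Rightarrow> real \<Rightarrow> real"
  where "flat_exp j t = (if t > 0 then (1 / t) ^ j * exp (- (1 / t)) else 0)"

text \<open>A single term of the exponential series at \<open>1 / t\<close>, the one of order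
  \<open>j + 2\<close>, bounds \<open>exp (1 / t)\<close> from below. The two surplus powers of
  \<open>t\<close> make the derivative at 0 vanish.\<close>

lemma flat_exp_quadratic_bound:
  "\<bar>flat_exp j t\<bar> \<le> fact (j + 2) * t\<^sup>2"
proof (cases "t > 0")
  case True
  have "(1 / t) ^ (j + 2) / fact (j + 2) \<le> exp (1 / t)"
  proof -
    have s: "(\<lambda>n. (1 / t) ^ n /\<^sub>R fact n) sums exp (1 / t)"
      by (rule exp_converges)
    have "(\<Sum>n\<in>{j + 2}. (1 / t) ^ n /\<^sub>R fact n) \<le> (\<Sum>n. (1 / t) ^ n /\<^sub>R fact n)"
      using s True by (intro sum_le_suminf) (auto simp: sums_iff)
    then show ?thesis using s by (simp add: sums_iff divide_inverse mult.commute)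
  qed
  then have "(1 / t) ^ (j + 2) \<le> exp (1 / t) * fact (j + 2)"
    by (rule pos_divide_le_eq[THEN iffD1, OF fact_gt_zero])
  then have "(1 / t) ^ (j + 2) * exp (- (1 / t)) \<le> (exp (1 / t) * fact (j + 2)) * exp (- (1 / t))"
    by (rule mult_right_mono) simp
  also have "\<dots> = fact (j + 2)"
    by (simp only: exp_minus) simp
  finally have "(1 / t) ^ (j + 2) * exp (- (1 / t)) * t\<^sup>2 \<le> fact (j + 2) * t\<^sup>2"
    by (rule mult_right_mono) simp
  moreover have "(1 / t) ^ (j + 2) * exp (- (1 / t)) * t\<^sup>2 = flat_exp j t"
    using True by (simp add: flat_exp_def power_add field_simps power2_eq_square)
  ultimately show ?thesis using True by (simp add: flat_exp_def)
qed (simp add: flat_exp_def)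

lemma flat_exp_has_derivative:
  "(flat_exp j has_derivative (\<lambda>v. v * (flat_exp (j + 2) t - real j * flat_exp (j + 1) t))) (at t)"
proof -
  consider "t > 0" | "t < 0" | "t = 0" by linarith
  then show ?thesis
  proof cases
    case 1
    have "((\<lambda>t. (1 / t) ^ j * exp (- (1 / t))) has_real_derivative
       ((1 / t) ^ (j + 2) * exp (- (1 / t)) - real j * ((1 / t) ^ (j + 1) * exp (- (1 / t))))) (at t)"
    proof (cases j)
      case 0
      then show ?thesis using 1
        by (auto intro!: derivative_eq_intros simp: field_simps power2_eq_square)
    next
      case (Suc i)
      show ?thesis unfolding Suc using 1
        by (auto intro!: derivative_eq_intros simp: field_simps power2_eq_square)
           (cases i; simp)
    qed
    then have "(flat_exp j has_real_derivative
       ((1 / t) ^ (j + 2) * exp (- (1 / t)) - real j * ((1 / t) ^ (j + 1) * exp (- (1 / t))))) (at t)"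
      by (rule DERIV_cong_ev[THEN iffD1, rotated 3])
         (use 1 eventually_gt_at_top[of 0] in
          \<open>auto simp: flat_exp_def intro!: eventually_mono[OF eventually_nhds_in_open[of "{0<..}" t]]\<close>)
    then show ?thesis using 1
      by (simp add: has_field_derivative_def flat_exp_def mult_commute_abs)
  next
    case 2
    have "((\<lambda>t. 0) has_real_derivative 0) (at t)" by simp
    then have "(flat_exp j has_real_derivative 0) (at t)"
      by (rule DERIV_cong_ev[THEN iffD1, rotated 3])
         (use 2 in
          \<open>auto simp: flat_exp_def intro!: eventually_mono[OF eventually_nhds_in_open[of "{..<0}" t]]\<close>)
    then show ?thesis using 2
      by (simp add: has_field_derivative_def flat_exp_def lambda_zero)
  next
    case 3
    have "(flat_exp j has_derivative (\<lambda>v. 0)) (at 0)"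
      unfolding has_derivative_at
    proof (intro conjI)
      show "(\<lambda>h. norm (flat_exp j (0 + h) - flat_exp j 0 - 0) / norm h) \<midarrow>0\<rightarrow> 0"
      proof (rule Lim_null_comparison)
        show "\<forall>\<^sub>F h in at 0. norm (norm (flat_exp j (0 + h) - flat_exp j 0 - 0) / norm h)
            \<le> fact (j + 2) * \<bar>h\<bar>"
        proof (rule always_eventually, rule allI)
          fix h :: real
          have "\<bar>flat_exp j h\<bar> / \<bar>h\<bar> \<le> fact (j + 2) * \<bar>h\<bar>"
            using flat_exp_quadratic_bound[of j h]
            by (cases "h = 0") (auto simp: divide_simps power2_eq_square abs_if)
          then show "norm (norm (flat_exp j (0 + h) - flat_exp j 0 - 0) / norm h)
              \<le> fact (j + 2) * \<bar>h\<bar>"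
            by (simp add: flat_exp_def)
        qed
        show "((\<lambda>h. fact (j + 2) * \<bar>h\<bar>) \<longlongrightarrow> 0) (at (0::real))"
          by (auto intro!: tendsto_eq_intros)
      qed
    qed simp
    then show ?thesis using 3 by (simp add: flat_exp_def)
  qed
qed

lemma smooth_on_flat_exp: "smooth_on UNIV (flat_exp j)"
  unfolding smooth_on_def
proof
  fix k :: nat
  show "times_differentiable_on k UNIV (flat_exp j)"
  proof (induction k arbitrary: j)
    case 0
    show ?case
      by (auto intro!: continuous_at_imp_continuous_on
          has_derivative_continuous[OF flat_exp_has_derivative])
  next
    case (Suc k)
    show ?case
    proof (rule times_differentiable_on_SucI)
      show "(flat_exp j has_derivative
          (\<lambda>v. v * (flat_exp (j + 2) t - real j * flat_exp (j + 1) t))) (at t)" for t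
        by (rule flat_exp_has_derivative)
      show "times_differentiable_on k UNIV
          (\<lambda>t. v * (flat_exp (j + 2) t - real j * flat_exp (j + 1) t))" for v
      proof -
        have "times_differentiable_on k UNIV
          (\<lambda>t. v * (flat_exp (j + 2) t + (- real j) * flat_exp (j + 1) t))"
          by (intro times_differentiable_on_bilinear[OF bounded_bilinear_mult]
              times_differentiable_on_const times_differentiable_on_add Suc open_UNIV)
        then show ?thesis by simp
      qed
    qed simp
  qed
qed

text \<open>Nesting \<open>flat_exp 0\<close> replaces the usual quotient of two functions by one
  with a constant denominator. For \<open>t \<le> 0\<close> the outer argument is its maximum
  \<open>flat_exp 0 1\<close>; for \<open>t \<ge> 1\<close> it is not positive and the outer
  function vanishes.\<close>

definition smooth_step :: "real \<Rightarrow> real"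
  where "smooth_step t = flat_exp 0 (flat_exp 0 1 - flat_exp 0 t) / flat_exp 0 (flat_exp 0 1)"

lemma flat_exp_mono: "s \<le> t \<Longrightarrow> flat_exp 0 s \<le> flat_exp 0 t"
  by (auto simp: flat_exp_def frac_le)

lemma flat_exp_pos: "0 < t \<Longrightarrow> 0 < flat_exp 0 t"
  by (simp add: flat_exp_def)

lemma flat_exp_nonneg: "0 \<le> flat_exp j t"
  by (simp add: flat_exp_def)

lemma smooth_step_eq_1: "t \<le> 0 \<Longrightarrow> smooth_step t = 1"
  using flat_exp_pos[OF flat_exp_pos[of 1]] by (simp add: smooth_step_def flat_exp_def[of 0 t])

lemma smooth_step_eq_0: "1 \<le> t \<Longrightarrow> smooth_step t = 0"
  using flat_exp_mono[of 1 t] by (simp add: smooth_step_def flat_exp_def[of 0 "flat_exp 0 1 - flat_exp 0 t"])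

lemma smooth_step_bounds: "0 \<le> smooth_step t" "smooth_step t \<le> 1"
proof -
  have "flat_exp 0 (flat_exp 0 1 - flat_exp 0 t) \<le> flat_exp 0 (flat_exp 0 1)"
    by (rule flat_exp_mono) (simp add: flat_exp_nonneg)
  moreover have "0 < flat_exp 0 (flat_exp 0 1)" by (intro flat_exp_pos) simp
  ultimately show "0 \<le> smooth_step t" "smooth_step t \<le> 1"
    by (simp_all add: smooth_step_def flat_exp_nonneg)
qed

lemma smooth_on_smooth_step: "smooth_on UNIV smooth_step"
proof -
  have "smooth_on UNIV (\<lambda>t. flat_exp 0 (flat_exp 0 1 + (- 1) * flat_exp 0 t)
      * (1 / flat_exp 0 (flat_exp 0 1)))"
    by (intro smooth_on_mult smooth_on_const smooth_on_add smooth_on_flat_exp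
        smooth_on_compose[where T = UNIV and g = "flat_exp 0"]) auto
  then show ?thesis by (simp add: smooth_step_def[abs_def])
qed

definition smooth_step_deriv :: "real \<Rightarrow> real"
  where "smooth_step_deriv t = frechet_derivative smooth_step (at t) 1"

lemma smooth_step_has_derivative:
  "(smooth_step has_derivative (\<lambda>v. v * smooth_step_deriv t)) (at t)"
proof -
  have D: "(smooth_step has_derivative frechet_derivative smooth_step (at t)) (at t)"
    using smooth_on_has_derivative[OF smooth_on_smooth_step] by simp
  then have "frechet_derivative smooth_step (at t) v = v * smooth_step_deriv t" for v
    using linear_scale[OF has_derivative_linear[OF D], of v 1] by (simp add: smooth_step_deriv_def)
  with D show ?thesis by (metis (no_types, lifting) ext)
qed

text \<open>The step is constant in a neighbourhood of each such point. At 0 and 1 constancy is only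
  one-sided, which is why the inequalities are strict.\<close>

lemma smooth_step_deriv_eq_0: "t < 0 \<or> 1 < t \<Longrightarrow> smooth_step_deriv t = 0"
proof -
  assume t: "t < 0 \<or> 1 < t"
  define c where "c = smooth_step t"
  have "eventually (\<lambda>s. smooth_step s = c) (nhds t)"
    using t
  proof
    assume "t < 0"
    then show ?thesis
      by (auto intro!: eventually_mono[OF eventually_nhds_in_open[of "{..<0}" t]]
          simp: c_def smooth_step_eq_1)
  next
    assume "1 < t"
    then show ?thesis
      by (auto intro!: eventually_mono[OF eventually_nhds_in_open[of "{1<..}" t]]
          simp: c_def smooth_step_eq_0)
  qed
  then have "(smooth_step has_real_derivative 0) (at t)"
    using DERIV_cong_ev[of t t smooth_step "\<lambda>_. c" 0 0] by simp
  moreover have "(smooth_step has_real_derivative smooth_step_deriv t) (at t)"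
    using smooth_step_has_derivative by (simp add: has_field_derivative_def mult_commute_abs)
  ultimately show ?thesis using DERIV_unique by blast
qed

lemma smooth_step_deriv_bounded: obtains C where "C > 0" "\<And>t. \<bar>smooth_step_deriv t\<bar> \<le> C"
proof -
  have "continuous_on UNIV smooth_step_deriv"
    unfolding smooth_step_deriv_def[abs_def]
    by (intro smooth_on_imp_continuous_on smooth_on_frechet_derivative smooth_on_smooth_step) simp
  then have "compact (smooth_step_deriv ` {0..1})"
    by (intro compact_continuous_image[OF continuous_on_subset[OF _ subset_UNIV]] compact_Icc)
  then obtain C where C: "C > 0" "\<And>t. t \<in> {0..1} \<Longrightarrow> \<bar>smooth_step_deriv t\<bar> \<le> C"
    by (auto dest!: compact_imp_bounded simp: bounded_pos)
  have "\<bar>smooth_step_deriv t\<bar> \<le> C" for t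
    using C smooth_step_deriv_eq_0[of t] by (cases "t \<in> {0..1}") auto
  with C(1) that show thesis by blast
qed

text \<open>The argument of the step is 0 at norm \<open>r\<close> and 1 at norm
  \<open>2 * r\<close>, because (2r)^2 - r^2 = 3r^2. The squared norm keeps the function smooth at
  the origin.\<close>

definition bump :: "real \<Rightarrow> 'e::euclidean_space \<Rightarrow> real"
  where "bump r x = smooth_step ((x \<bullet> x - r\<^sup>2) / (3 * r\<^sup>2))"

lemma bump_bounds: "0 \<le> bump r x" "bump r x \<le> 1"
  by (simp_all add: bump_def smooth_step_bounds)

lemma bump_eq_1: "norm x \<le> r \<Longrightarrow> bump r x = 1"
proof -
  assume "norm x \<le> r"
  then have "x \<bullet> x \<le> r\<^sup>2" unfolding dot_square_norm by (intro power_mono) auto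
  then show ?thesis
    unfolding bump_def by (intro smooth_step_eq_1) (simp add: divide_nonpos_nonneg)
qed

lemma bump_eq_0: "r > 0 \<Longrightarrow> norm x \<ge> 2 * r \<Longrightarrow> bump r x = 0"
proof -
  assume "r > 0" "norm x \<ge> 2 * r"
  then have "(2 * r)\<^sup>2 \<le> x \<bullet> x" unfolding dot_square_norm by (intro power_mono) auto
  with \<open>r > 0\<close> show ?thesis
    unfolding bump_def by (intro smooth_step_eq_0) (auto simp: field_simps power2_eq_square)
qed

lemma bump_minus: "bump r (- x) = bump r x"
  by (simp add: bump_def)

definition bump_deriv :: "real \<Rightarrow> 'e::euclidean_space \<Rightarrow> 'e \<Rightarrow> real"
  where "bump_deriv r x v =
    (2 * (x \<bullet> v) / (3 * r\<^sup>2)) * smooth_step_deriv ((x \<bullet> x - r\<^sup>2) / (3 * r\<^sup>2))"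

lemma bump_has_derivative: "(bump r has_derivative bump_deriv r x) (at x)"
proof -
  have "((\<lambda>x. (x \<bullet> x - r\<^sup>2) * c) has_derivative (\<lambda>v. 2 * (x \<bullet> v) * c)) (at x)" for c
    by (auto intro!: derivative_eq_intros simp: inner_commute)
  from this[of "inverse (3 * r\<^sup>2)"]
  have "((\<lambda>x. (x \<bullet> x - r\<^sup>2) / (3 * r\<^sup>2)) has_derivative (\<lambda>v. 2 * (x \<bullet> v) / (3 * r\<^sup>2))) (at x)"
    by (simp only: divide_inverse)
  from diff_chain_at[OF this smooth_step_has_derivative]
  show ?thesis
    by (simp add: bump_def[abs_def] bump_deriv_def[abs_def] o_def)
qed

lemma smooth_on_bump: "smooth_on UNIV (bump r)"
proof -
  have id: "smooth_on UNIV (\<lambda>x::'a. x)"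
    by (rule smooth_on_linear) (simp_all add: bounded_linear_ident)
  have "smooth_on UNIV (\<lambda>x::'a. (x \<bullet> x + (- r\<^sup>2)) * (1 / (3 * r\<^sup>2)))"
    by (intro smooth_on_mult smooth_on_add smooth_on_const open_UNIV
        smooth_on_bilinear[OF bounded_bilinear_inner open_UNIV id id])
  then have "smooth_on UNIV (\<lambda>x::'a. smooth_step ((x \<bullet> x + (- r\<^sup>2)) * (1 / (3 * r\<^sup>2))))"
    by (rule smooth_on_compose[OF open_UNIV open_UNIV subset_UNIV _ smooth_on_smooth_step])
  then show ?thesis by (simp add: bump_def[abs_def])
qed

lemma bump_deriv_eq_frechet: "frechet_derivative (bump r) (at x) = bump_deriv r x"
  by (rule frechet_derivative_at[OF bump_has_derivative, symmetric])

lemma bump_deriv_eq_0: "r > 0 \<Longrightarrow> norm x > 2 * r \<Longrightarrow> bump_deriv r x v = 0"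
proof -
  assume "r > 0" "norm x > 2 * r"
  then have "(2 * r)\<^sup>2 < x \<bullet> x" unfolding dot_square_norm by (intro power_strict_mono) auto
  with \<open>r > 0\<close> show ?thesis
    unfolding bump_deriv_def using smooth_step_deriv_eq_0[of "(x \<bullet> x - r\<^sup>2) / (3 * r\<^sup>2)"]
    by (auto simp: field_simps power2_eq_square)
qed

text \<open>On the support the norm of \<open>x\<close> is at most \<open>2 * r\<close>, which
  cancels one of the two powers of \<open>r\<close> in the denominator. The constant must not depend
  on \<open>r\<close>: the remaining loss \<open>1 / r\<close> is compensated exactly in the
  commutator estimate.\<close>

lemma bump_deriv_bound:
  obtains C where "C > 0"
    "\<And>r (x::'e::euclidean_space) v. r > 0 \<Longrightarrow> \<bar>bump_deriv r x v\<bar> \<le> C / r * norm v"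
proof -
  obtain C where C: "C > 0" "\<And>t. \<bar>smooth_step_deriv t\<bar> \<le> C"
    using smooth_step_deriv_bounded by blast
  have "\<bar>bump_deriv r x v\<bar> \<le> (2 * C) / r * norm v" if "r > 0" for r and x v :: 'e
  proof (cases "norm x > 2 * r")
    case True
    then show ?thesis using bump_deriv_eq_0[OF that True] C that by simp
  next
    case False
    have "\<bar>x \<bullet> v\<bar> \<le> 2 * r * norm v"
      using Cauchy_Schwarz_ineq2[of x v] False mult_right_mono[of "norm x" "2 * r" "norm v"] by simp
    then have "2 * \<bar>x \<bullet> v\<bar> / (3 * r\<^sup>2) \<le> 2 * (2 * r * norm v) / (3 * r\<^sup>2)"
      by (intro divide_right_mono mult_left_mono) auto
    also have "\<dots> = (4 / 3) * norm v / r" using that by (simp add: power2_eq_square)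
    also have "\<dots> \<le> 2 * norm v / r" using that by (intro divide_right_mono mult_right_mono) auto
    finally have "2 * \<bar>x \<bullet> v\<bar> / (3 * r\<^sup>2) \<le> 2 * norm v / r" .
    then have "2 * \<bar>x \<bullet> v\<bar> / (3 * r\<^sup>2) * \<bar>smooth_step_deriv ((x \<bullet> x - r\<^sup>2) / (3 * r\<^sup>2))\<bar>
        \<le> 2 * norm v / r * C"
      using C that by (intro mult_mono) auto
    then show ?thesis by (simp add: bump_deriv_def abs_mult mult_ac)
  qed
  with C(1) show thesis by (intro that[of "2 * C"]) auto
qed

section \<open>Square-integrable functions\<close>

lemma L2_measurable: "f \<in> L2 M \<Longrightarrow> f \<in> borel_measurable M"
  by (simp add: L2_def)

lemma L2_integrable_norm: "f \<in> L2 M \<Longrightarrow> integrable M (\<lambda>x. (cmod (f x))\<^sup>2)"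
  by (simp add: L2_def)

lemma L2_norm_nonneg: "0 \<le> L2_norm M f"
  by (simp add: L2_norm_def)

lemma L2_norm_square: "(L2_norm M f)\<^sup>2 = (\<integral>x. (cmod (f x))\<^sup>2 \<partial>M)"
  by (simp add: L2_norm_def)

lemma L2_dominated:
  assumes "g \<in> L2 M" "f \<in> borel_measurable M" "\<And>x. cmod (f x) \<le> C * cmod (g x)" "0 \<le> C"
  shows "f \<in> L2 M" "L2_norm M f \<le> C * L2_norm M g"
proof -
  have le: "(cmod (f x))\<^sup>2 \<le> C\<^sup>2 * (cmod (g x))\<^sup>2" for x
    using power_mono[OF assms(3)[of x], of 2] by (simp add: power_mult_distrib)
  have int: "integrable M (\<lambda>x. C\<^sup>2 * (cmod (g x))\<^sup>2)"
    using L2_integrable_norm[OF assms(1)] by simp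
  have "integrable M (\<lambda>x. (cmod (f x))\<^sup>2)"
    by (rule Bochner_Integration.integrable_bound[OF int]) (use assms le in auto)
  then show f: "f \<in> L2 M" using assms by (simp add: L2_def)
  have "(\<integral>x. (cmod (f x))\<^sup>2 \<partial>M) \<le> (\<integral>x. C\<^sup>2 * (cmod (g x))\<^sup>2 \<partial>M)"
    by (intro integral_mono L2_integrable_norm[OF f] int le)
  also have "\<dots> = (C * L2_norm M g)\<^sup>2"
    by (simp add: power_mult_distrib L2_norm_square)
  finally show "L2_norm M f \<le> C * L2_norm M g"
    unfolding L2_norm_square[symmetric]
    by (rule power2_le_imp_le) (simp add: L2_norm_nonneg assms(4))
qed

lemma L2_scale:
  assumes "f \<in> L2 M"
  shows "(\<lambda>x. c * f x) \<in> L2 M"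
  by (rule L2_dominated(1)[OF assms, where C = "cmod c"])
     (use L2_measurable[OF assms] in \<open>auto simp: norm_mult\<close>)

lemma L2_bounded_mult:
  assumes "f \<in> L2 M" "g \<in> borel_measurable M" "\<And>x. cmod (g x) \<le> C"
  shows "(\<lambda>x. g x * f x) \<in> L2 M" "(\<lambda>x. f x * g x) \<in> L2 M"
proof -
  have "0 \<le> C" using assms(3) norm_ge_zero order_trans by blast
  then show "(\<lambda>x. g x * f x) \<in> L2 M"
    by (intro L2_dominated(1)[OF assms(1), where C = C])
       (use L2_measurable[OF assms(1)] assms in \<open>auto simp: norm_mult mult_right_mono\<close>)
  then show "(\<lambda>x. f x * g x) \<in> L2 M" by (simp add: mult.commute)
qed

lemma cmod_add_square_le: "(cmod (a + b))\<^sup>2 \<le> 2 * (cmod a)\<^sup>2 + 2 * (cmod b)\<^sup>2"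
proof -
  have "(cmod (a + b))\<^sup>2 \<le> (cmod a + cmod b)\<^sup>2"
    by (intro power_mono norm_triangle_ineq) auto
  also have "\<dots> \<le> 2 * (cmod a)\<^sup>2 + 2 * (cmod b)\<^sup>2"
    using sum_squares_bound[of "cmod a" "cmod b"] by (simp add: power2_sum)
  finally show ?thesis .
qed

lemma L2_add:
  assumes "f \<in> L2 M" "g \<in> L2 M"
  shows "(\<lambda>x. f x + g x) \<in> L2 M"
proof -
  have "integrable M (\<lambda>x. 2 * (cmod (f x))\<^sup>2 + 2 * (cmod (g x))\<^sup>2)"
    using assms by (auto simp: L2_def)
  then have "integrable M (\<lambda>x. (cmod (f x + g x))\<^sup>2)"
    by (rule Bochner_Integration.integrable_bound)
       (use assms in \<open>auto simp: cmod_add_square_le L2_def\<close>)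
  then show ?thesis using assms by (auto simp: L2_def)
qed

lemma L2_diff: "f \<in> L2 M \<Longrightarrow> g \<in> L2 M \<Longrightarrow> (\<lambda>x. f x - g x) \<in> L2 M"
  using L2_add[of f M "\<lambda>x. - 1 * g x"] L2_scale[of g M "- 1"] by simp

lemma borel_measurable_cnj [measurable]: "cnj \<in> borel_measurable borel"
  by (intro borel_measurable_continuous_onI continuous_intros)

lemma L2_cnj: "f \<in> L2 M \<Longrightarrow> (\<lambda>x. cnj (f x)) \<in> L2 M"
  by (rule L2_dominated(1)[where C = 1 and g = f]) (auto dest: L2_measurable)

lemma L2_norm_minus_commute: "L2_norm M (\<lambda>x. f x - g x) = L2_norm M (\<lambda>x. g x - f x)"
  by (simp add: L2_norm_def norm_minus_commute)

lemma L2_mult_integrable: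
  assumes "f \<in> L2 M" "g \<in> L2 M"
  shows "integrable M (\<lambda>x. f x * g x)"
proof -
  have I: "integrable M (\<lambda>x. (cmod (f x))\<^sup>2 + (cmod (g x))\<^sup>2)"
    using assms by (auto simp: L2_def)
  have "cmod (f x) * cmod (g x) \<le> (cmod (f x))\<^sup>2 + (cmod (g x))\<^sup>2" for x
  proof -
    have "0 \<le> cmod (f x) * cmod (g x)" by simp
    with sum_squares_bound[of "cmod (f x)" "cmod (g x)"] show ?thesis by linarith
  qed
  then show ?thesis
    by (intro Bochner_Integration.integrable_bound[OF I])
       (use assms in \<open>auto simp: L2_def norm_mult\<close>)
qed

text \<open>Integrating (s|f| - |g|)^2 \<ge> 0 gives a quadratic inequality in \<open>s\<close>, and
  a good choice of \<open>s\<close> yields the claim. Vanishing norms are treated apart, since that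
  choice divides by the norm of \<open>f\<close> and the result is then divided by the norm of
  \<open>g\<close>.\<close>

lemma L2_Cauchy_Schwarz:
  assumes "f \<in> L2 M" "g \<in> L2 M"
  shows "(\<integral>x. cmod (f x * g x) \<partial>M) \<le> L2_norm M f * L2_norm M g"
proof -
  let ?I = "\<integral>x. cmod (f x * g x) \<partial>M"
  have I: "integrable M (\<lambda>x. cmod (f x * g x))"
    using L2_mult_integrable[OF assms] by simp
  note fi = L2_integrable_norm[OF assms(1)] and gi = L2_integrable_norm[OF assms(2)]
  have quad: "2 * s * ?I \<le> s\<^sup>2 * (L2_norm M f)\<^sup>2 + (L2_norm M g)\<^sup>2" for s
  proof -
    have "(\<integral>x. 2 * s * cmod (f x * g x) \<partial>M)
        \<le> (\<integral>x. s\<^sup>2 * (cmod (f x))\<^sup>2 + (cmod (g x))\<^sup>2 \<partial>M)"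
    proof (rule integral_mono)
      show "2 * s * cmod (f x * g x) \<le> s\<^sup>2 * (cmod (f x))\<^sup>2 + (cmod (g x))\<^sup>2" for x
        using zero_le_power2[of "s * cmod (f x) - cmod (g x)"]
        by (simp add: power2_diff power_mult_distrib norm_mult mult_ac)
    qed (use I fi gi in auto)
    then show ?thesis using I fi gi by (simp add: L2_norm_square)
  qed
  have I0: "0 \<le> ?I" by simp
  show ?thesis
  proof (cases "L2_norm M f = 0")
    case True
    have "?I = 0"
    proof (rule ccontr)
      assume "?I \<noteq> 0"
      then have pos: "?I > 0" using I0 by linarith
      \<comment> \<open>Without the quadratic term the inequality is linear in \<open>s\<close>;
        this value of \<open>s\<close> makes its left side
        \<open>(L2_norm M g)\<^sup>2 + 1\<close>.\<close>
      have "2 * (((L2_norm M g)\<^sup>2 + 1) / (2 * ?I)) * ?I \<le> (L2_norm M g)\<^sup>2"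
        using quad[of "((L2_norm M g)\<^sup>2 + 1) / (2 * ?I)"] True by simp
      then show False using pos by simp
    qed
    then show ?thesis using True by simp
  next
    case False
    then have pos: "L2_norm M f > 0" using L2_norm_nonneg[of M f] by linarith
    have "2 * (L2_norm M g / L2_norm M f) * ?I \<le> 2 * (L2_norm M g)\<^sup>2"
      using quad[of "L2_norm M g / L2_norm M f"] pos by (simp add: power_divide)
    then have le: "L2_norm M g * ?I \<le> (L2_norm M g)\<^sup>2 * L2_norm M f"
      using pos by (simp add: field_simps)
    show ?thesis
    proof (cases "L2_norm M g = 0")
      case True
      have "?I = 0"
      proof (rule ccontr)
        assume "?I \<noteq> 0"
        then have posI: "?I > 0" using I0 by linarith
        \<comment> \<open>At this value the quadratic term is half of the linear one, so the
          inequality fails unless both vanish.\<close>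
        define s where "s = ?I / (L2_norm M f)\<^sup>2"
        have "s > 0" using posI pos by (simp add: s_def)
        have "2 * s * ?I \<le> s * s * (L2_norm M f)\<^sup>2"
          using quad[of s] True by (simp add: power2_eq_square)
        also have "\<dots> = s * ?I" using pos by (simp add: s_def power2_eq_square)
        finally show False using \<open>s > 0\<close> posI by simp
      qed
      then show ?thesis using True by simp
    next
      case False
      then have "L2_norm M g > 0" using L2_norm_nonneg[of M g] by linarith
      then show ?thesis using le by (simp add: power2_eq_square mult.assoc mult.commute)
    qed
  qed
qed

lemma L2_integral_mult_bound:
  assumes "f \<in> L2 M" "g \<in> L2 M"
  shows "cmod (\<integral>x. f x * g x \<partial>M) \<le> L2_norm M f * L2_norm M g"
  using integral_norm_bound[of M "\<lambda>x. f x * g x"] L2_Cauchy_Schwarz[OF assms] by linarith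

lemma L2_norm_triangle:
  assumes "f \<in> L2 M" "g \<in> L2 M"
  shows "L2_norm M (\<lambda>x. f x + g x) \<le> L2_norm M f + L2_norm M g"
proof -
  have I: "integrable M (\<lambda>x. cmod (f x * g x))"
    using L2_mult_integrable[OF assms] by simp
  note fi = L2_integrable_norm[OF assms(1)] and gi = L2_integrable_norm[OF assms(2)]
  have "(L2_norm M (\<lambda>x. f x + g x))\<^sup>2 = (\<integral>x. (cmod (f x + g x))\<^sup>2 \<partial>M)"
    by (rule L2_norm_square)
  also have "\<dots> \<le> (\<integral>x. (cmod (f x))\<^sup>2 + 2 * cmod (f x * g x) + (cmod (g x))\<^sup>2 \<partial>M)"
  proof (rule integral_mono)
    show "integrable M (\<lambda>x. (cmod (f x + g x))\<^sup>2)"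
      by (rule L2_integrable_norm[OF L2_add[OF assms]])
    fix x
    have "(cmod (f x + g x))\<^sup>2 \<le> (cmod (f x) + cmod (g x))\<^sup>2"
      by (intro power_mono norm_triangle_ineq) auto
    then show "(cmod (f x + g x))\<^sup>2 \<le> (cmod (f x))\<^sup>2 + 2 * cmod (f x * g x) + (cmod (g x))\<^sup>2"
      by (simp add: power2_sum norm_mult mult_ac)
  qed (use I fi gi in auto)
  also have "\<dots> = (L2_norm M f)\<^sup>2 + 2 * (\<integral>x. cmod (f x * g x) \<partial>M) + (L2_norm M g)\<^sup>2"
    using I fi gi by (simp add: L2_norm_square)
  also have "\<dots> \<le> (L2_norm M f + L2_norm M g)\<^sup>2"
    using L2_Cauchy_Schwarz[OF assms] by (simp add: power2_sum)
  finally show ?thesis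
    by (rule power2_le_imp_le) (simp add: L2_norm_nonneg)
qed

lemma L2_norm_scale: "L2_norm M (\<lambda>x. c * f x) = cmod c * L2_norm M f"
  by (simp add: L2_norm_def norm_mult power_mult_distrib real_sqrt_mult)

lemma tendsto_integral_mult_L2:
  assumes "\<And>n. us n \<in> L2 M" "u \<in> L2 M" "g \<in> L2 M"
    and "(\<lambda>n. L2_norm M (\<lambda>x. us n x - u x)) \<longlonglongrightarrow> 0"
  shows "(\<lambda>n. \<integral>x. us n x * g x \<partial>M) \<longlonglongrightarrow> (\<integral>x. u x * g x \<partial>M)"
proof (rule Lim_transform2[OF _ ])
  show "(\<lambda>n. \<integral>x. u x * g x \<partial>M) \<longlonglongrightarrow> (\<integral>x. u x * g x \<partial>M)" by simp
  have "(\<lambda>n. (\<integral>x. us n x * g x \<partial>M) - (\<integral>x. u x * g x \<partial>M)) \<longlonglongrightarrow> 0"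
  proof (rule Lim_null_comparison)
    show "(\<lambda>n. L2_norm M (\<lambda>x. us n x - u x) * L2_norm M g) \<longlonglongrightarrow> 0"
      by (rule tendsto_mult_left_zero[OF assms(4)])
    have "norm ((\<integral>x. us n x * g x \<partial>M) - (\<integral>x. u x * g x \<partial>M))
        \<le> L2_norm M (\<lambda>x. us n x - u x) * L2_norm M g" for n
    proof -
      have "(\<integral>x. us n x * g x \<partial>M) - (\<integral>x. u x * g x \<partial>M) = (\<integral>x. (us n x - u x) * g x \<partial>M)"
        using L2_mult_integrable[OF assms(1)[of n] assms(3)] L2_mult_integrable[OF assms(2,3)]
        by (simp add: left_diff_distrib)
      then show ?thesis
        using L2_integral_mult_bound[OF L2_diff[OF assms(1)[of n] assms(2)] assms(3)] by simp
    qed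
    then show "\<forall>\<^sub>F n in sequentially. norm ((\<integral>x. us n x * g x \<partial>M) - (\<integral>x. u x * g x \<partial>M))
        \<le> L2_norm M (\<lambda>x. us n x - u x) * L2_norm M g" by simp
  qed
  then show "(\<lambda>n. (\<integral>x. u x * g x \<partial>M) - (\<integral>x. us n x * g x \<partial>M)) \<longlonglongrightarrow> 0"
    using tendsto_minus by fastforce
qed

text \<open>Approximation within every \<open>e\<close> replaces sequences, and the tolerances
  \<open>inverse (real (Suc n))\<close> recover them. In this form sums and near-minimizers are
  handled without extracting sequences.\<close>

lemma L2_closure_iff:
  "(u, v) \<in> L2_closure M G \<longleftrightarrow> u \<in> L2 M \<and> v \<in> L2 M \<and>
    (\<forall>e>0. \<exists>(f, h) \<in> G \<inter> L2 M \<times> L2 M.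
      L2_norm M (\<lambda>x. f x - u x) < e \<and> L2_norm M (\<lambda>x. h x - v x) < e)"
  (is "?L \<longleftrightarrow> ?R")
proof
  assume ?L
  then obtain us vs where uv: "u \<in> L2 M" "v \<in> L2 M"
    "\<And>n::nat. (us n, vs n) \<in> G \<inter> L2 M \<times> L2 M"
    and lim: "(\<lambda>n. L2_norm M (\<lambda>x. us n x - u x)) \<longlonglongrightarrow> 0"
       "(\<lambda>n. L2_norm M (\<lambda>x. vs n x - v x)) \<longlonglongrightarrow> 0"
    unfolding L2_closure_def by auto
  have "\<exists>(f, h) \<in> G \<inter> L2 M \<times> L2 M.
      L2_norm M (\<lambda>x. f x - u x) < e \<and> L2_norm M (\<lambda>x. h x - v x) < e" if "e > 0" for e
  proof -
    have "\<forall>\<^sub>F n in sequentially. L2_norm M (\<lambda>x. us n x - u x) < e \<and> L2_norm M (\<lambda>x. vs n x - v x) < e"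
      using order_tendstoD(2)[OF lim(1) that] order_tendstoD(2)[OF lim(2) that]
      by (rule eventually_conj)
    then obtain n where "L2_norm M (\<lambda>x. us n x - u x) < e" "L2_norm M (\<lambda>x. vs n x - v x) < e"
      by (auto simp: eventually_sequentially)
    then show ?thesis using uv(3)[of n] by blast
  qed
  then show ?R using uv by blast
next
  assume R: ?R
  have "\<exists>p. p \<in> G \<inter> L2 M \<times> L2 M \<and> L2_norm M (\<lambda>x. fst p x - u x) < inverse (real (Suc n))
      \<and> L2_norm M (\<lambda>x. snd p x - v x) < inverse (real (Suc n))" for n
  proof -
    have "0 < inverse (real (Suc n))" by simp
    with R obtain f h where "(f, h) \<in> G \<inter> L2 M \<times> L2 M"
      "L2_norm M (\<lambda>x. f x - u x) < inverse (real (Suc n))"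
      "L2_norm M (\<lambda>x. h x - v x) < inverse (real (Suc n))"
      by blast
    then show ?thesis by (intro exI[of _ "(f, h)"]) simp
  qed
  then have "\<exists>p. \<forall>n. p n \<in> G \<inter> L2 M \<times> L2 M
      \<and> L2_norm M (\<lambda>x. fst (p n) x - u x) < inverse (real (Suc n))
      \<and> L2_norm M (\<lambda>x. snd (p n) x - v x) < inverse (real (Suc n))"
    by (intro choice allI)
  then obtain p where p: "\<And>n. p n \<in> G \<inter> L2 M \<times> L2 M"
    "\<And>n. L2_norm M (\<lambda>x. fst (p n) x - u x) < inverse (real (Suc n))"
    "\<And>n. L2_norm M (\<lambda>x. snd (p n) x - v x) < inverse (real (Suc n))"
    by blast
  have "(\<lambda>n. L2_norm M (\<lambda>x. fst (p n) x - u x)) \<longlonglongrightarrow> 0"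
    by (rule real_tendsto_sandwich[OF _ _ tendsto_const LIMSEQ_inverse_real_of_nat])
       (auto intro!: always_eventually less_imp_le p(2)[simplified] simp: L2_norm_nonneg)
  moreover have "(\<lambda>n. L2_norm M (\<lambda>x. snd (p n) x - v x)) \<longlonglongrightarrow> 0"
    by (rule real_tendsto_sandwich[OF _ _ tendsto_const LIMSEQ_inverse_real_of_nat])
       (auto intro!: always_eventually less_imp_le p(3)[simplified] simp: L2_norm_nonneg)
  moreover have "\<forall>n. (fst (p n), snd (p n)) \<in> G \<inter> L2 M \<times> L2 M"
    using p(1) by simp
  ultimately have "\<exists>us vs. (\<forall>n::nat. (us n, vs n) \<in> G \<inter> L2 M \<times> L2 M) \<and>
      (\<lambda>n. L2_norm M (\<lambda>x. us n x - u x)) \<longlonglongrightarrow> 0 \<and> (\<lambda>n. L2_norm M (\<lambda>x. vs n x - v x)) \<longlonglongrightarrow> 0"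
    by - (rule exI[of _ "\<lambda>n. fst (p n)"], rule exI[of _ "\<lambda>n. snd (p n)"], intro conjI)
  then show ?L
    unfolding L2_closure_def mem_Collect_eq prod.case using R by simp
qed

text \<open>Reassembles a pair from its localized pieces; each summand gets half of the
  tolerance.\<close>

lemma L2_closure_add:
  assumes "\<And>f h f' h'. (f, h) \<in> G \<Longrightarrow> (f', h') \<in> G \<Longrightarrow> (\<lambda>x. f x + f' x, \<lambda>x. h x + h' x) \<in> G"
    and "(u, v) \<in> L2_closure M G" "(u', v') \<in> L2_closure M G"
  shows "(\<lambda>x. u x + u' x, \<lambda>x. v x + v' x) \<in> L2_closure M G"
proof -
  note uv = assms(2)[unfolded L2_closure_iff] assms(3)[unfolded L2_closure_iff]
  show ?thesis
    unfolding L2_closure_iff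
  proof (intro conjI allI impI)
    show "(\<lambda>x. u x + u' x) \<in> L2 M" "(\<lambda>x. v x + v' x) \<in> L2 M"
      using uv L2_add by blast+
    fix e :: real assume "e > 0"
    then have e: "e / 2 > 0" by simp
    from e uv(1) obtain f h where fh: "(f, h) \<in> G \<inter> L2 M \<times> L2 M"
      "L2_norm M (\<lambda>x. f x - u x) < e / 2" "L2_norm M (\<lambda>x. h x - v x) < e / 2" by blast
    from e uv(2) obtain f' h' where fh': "(f', h') \<in> G \<inter> L2 M \<times> L2 M"
      "L2_norm M (\<lambda>x. f' x - u' x) < e / 2" "L2_norm M (\<lambda>x. h' x - v' x) < e / 2" by blast
    have tri: "L2_norm M (\<lambda>x. a x + a' x - (b x + b' x)) < e"
      if "a \<in> L2 M" "a' \<in> L2 M" "b \<in> L2 M" "b' \<in> L2 M"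
        "L2_norm M (\<lambda>x. a x - b x) < e / 2" "L2_norm M (\<lambda>x. a' x - b' x) < e / 2"
      for a a' b b' :: "'a \<Rightarrow> complex"
    proof -
      have "L2_norm M (\<lambda>x. (a x - b x) + (a' x - b' x)) < e"
        using L2_norm_triangle[OF L2_diff L2_diff, of a M b a' b'] that by simp
      then show ?thesis by (simp add: algebra_simps)
    qed
    show "\<exists>(f, h)\<in>G \<inter> L2 M \<times> L2 M. L2_norm M (\<lambda>x. f x - (u x + u' x)) < e
        \<and> L2_norm M (\<lambda>x. h x - (v x + v' x)) < e"
      by (rule bexI[of _ "(\<lambda>x. f x + f' x, \<lambda>x. h x + h' x)"])
         (use fh fh' uv assms(1) tri L2_add in auto)
  qed
qed

text \<open>The real inner product underlying the complex one. The minimization argument varies a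
  pair only by real multiples, and then the squared norm expands with real parts.\<close>

definition re_inner :: "'a measure \<Rightarrow> ('a \<Rightarrow> complex) \<Rightarrow> ('a \<Rightarrow> complex) \<Rightarrow> real"
  where "re_inner M f g = Re (\<integral>x. f x * cnj (g x) \<partial>M)"

lemma L2_norm_square_perturb:
  assumes "f \<in> L2 M" "h \<in> L2 M"
  shows "(L2_norm M (\<lambda>x. h x + of_real t * f x))\<^sup>2 =
    (L2_norm M h)\<^sup>2 + 2 * t * re_inner M f h + t\<^sup>2 * (L2_norm M f)\<^sup>2"
proof -
  note fi = L2_integrable_norm[OF assms(1)] and hi = L2_integrable_norm[OF assms(2)]
  have I: "integrable M (\<lambda>x. f x * cnj (h x))"
    by (rule L2_mult_integrable[OF assms(1) L2_cnj[OF assms(2)]])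
  define r where "r x = Re (f x * cnj (h x))" for x
  have eq: "(cmod (h x + of_real t * f x))\<^sup>2 =
      (cmod (h x))\<^sup>2 + 2 * t * r x + t\<^sup>2 * (cmod (f x))\<^sup>2" for x
    unfolding cmod_power2 r_def by (simp add: power2_eq_square algebra_simps)
  have "integrable M r" "(\<integral>x. r x \<partial>M) = re_inner M f h"
    unfolding r_def[abs_def] re_inner_def using I by (rule integrable_Re, rule integral_Re)
  then show ?thesis
    unfolding L2_norm_square eq using fi hi by simp
qed

lemma re_inner_diff:
  assumes "f \<in> L2 M" "g \<in> L2 M" "h \<in> L2 M"
  shows "re_inner M (\<lambda>x. f x - g x) h = re_inner M f h - re_inner M g h"
  unfolding re_inner_def
  using L2_mult_integrable[OF assms(1) L2_cnj[OF assms(3)]]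
    L2_mult_integrable[OF assms(2) L2_cnj[OF assms(3)]]
  by (simp add: left_diff_distrib)

lemma re_inner_self: "re_inner M f f = (L2_norm M f)\<^sup>2"
  by (simp add: re_inner_def L2_norm_square complex_norm_square[symmetric] del: of_real_power)

text \<open>
  This replaces Mazur's lemma and needs no completeness: if \<open>g\<close> nearly minimizes the distance
  to \<open>(w, z)\<close>, then \<open>g - (w, z)\<close> is nearly orthogonal to \<open>G\<close>, hence to the weak limit \<open>(w, z)\<close>.
\<close>

lemma weak_limit_in_L2_closure:
  assumes lin: "\<And>f h f' h' t. (f, h) \<in> G \<Longrightarrow> (f', h') \<in> G \<Longrightarrow>
      (\<lambda>x. f x + of_real t * f' x, \<lambda>x. h x + of_real t * h' x) \<in> G"
    and GL2: "G \<subseteq> L2 M \<times> L2 M"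
    and wz: "w \<in> L2 M" "z \<in> L2 M"
    and fp: "\<And>n::nat. (f n, p n) \<in> G"
    and bd: "\<And>n. L2_norm M (f n) \<le> C" "\<And>n. L2_norm M (p n) \<le> C"
    and limf: "\<And>h. h \<in> L2 M \<Longrightarrow> (\<lambda>n. \<integral>x. f n x * h x \<partial>M) \<longlonglongrightarrow> (\<integral>x. w x * h x \<partial>M)"
    and limp: "\<And>h. h \<in> L2 M \<Longrightarrow> (\<lambda>n. \<integral>x. p n x * h x \<partial>M) \<longlonglongrightarrow> (\<integral>x. z x * h x \<partial>M)"
  shows "(w, z) \<in> L2_closure M G"
proof -
  define N where "N = (\<lambda>(a, b). (L2_norm M a)\<^sup>2 + (L2_norm M b)\<^sup>2)"
  define W where "W = (\<lambda>(a, b). N (\<lambda>x. a x - w x, \<lambda>x. b x - z x))"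
  define d where "d = Inf (W ` G)"
  have N0: "0 \<le> N q" for q by (simp add: N_def split: prod.split)
  have W0: "0 \<le> W q" for q by (simp add: W_def N0 split: prod.split)
  have bdd: "bdd_below (W ` G)" by (rule bdd_belowI2[of _ 0]) (rule W0)
  have ne: "W ` G \<noteq> {}" using fp by blast
  have dle: "d \<le> W q" if "q \<in> G" for q
    unfolding d_def by (rule cINF_lower[OF bdd that])
  have d0: "0 \<le> d" unfolding d_def by (rule cINF_greatest) (use ne W0 in auto)
  \<comment> \<open>A common bound for the squared norms of the pairs that are tested:
    \<open>2 * C\<^sup>2\<close> for the sequence, and \<open>2 * N (w, z) + 2 * W (a, b)\<close>
    with \<open>W (a, b) < d + 1\<close> for a near-minimizer. The final 1 makes \<open>K\<close>
    positive.\<close>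
  define K where "K = 2 * C\<^sup>2 + 4 * (d + 1) + 2 * N (w, z) + 1"
  have "\<exists>a b. (a, b) \<in> G \<and> W (a, b) < d + e \<and> W (a, b) \<le> 2 * sqrt (e * K)"
    if e: "0 < e" "e < 1" for e
  proof -
    have "\<exists>y\<in>W ` G. y < d + e"
      using cInf_lessD[OF ne, of "d + e"] e by (auto simp: d_def)
    then obtain a b where ab: "(a, b) \<in> G" "W (a, b) < d + e" by auto
    then have abL: "a \<in> L2 M" "b \<in> L2 M" using GL2 by auto
    define h1 h2 where "h1 x = a x - w x" and "h2 x = b x - z x" for x
    have hL: "h1 \<in> L2 M" "h2 \<in> L2 M"
      unfolding h1_def[abs_def] h2_def[abs_def] using L2_diff abL wz by blast+
    have Wab: "W (a, b) = (L2_norm M h1)\<^sup>2 + (L2_norm M h2)\<^sup>2"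
      by (simp add: W_def N_def h1_def[abs_def] h2_def[abs_def])
    have orth: "\<bar>re_inner M f1 h1 + re_inner M f2 h2\<bar> \<le> sqrt (e * K)"
      if f12: "(f1, f2) \<in> G" "N (f1, f2) \<le> K" for f1 f2
    proof -
      let ?B = "re_inner M f1 h1 + re_inner M f2 h2"
      have fL: "f1 \<in> L2 M" "f2 \<in> L2 M" using GL2 f12 by auto
      have "K > 0"
      proof -
        have "0 \<le> 2 * C\<^sup>2" "0 \<le> 4 * (d + 1)" "0 \<le> 2 * N (w, z)"
          using d0 N0[of "(w, z)"] by simp_all
        then show ?thesis unfolding K_def by (intro add_nonneg_pos add_nonneg_nonneg) simp_all
      qed
      \<comment> \<open>The minimizer of \<open>2 * t * ?B + t\<^sup>2 * K\<close>, with minimum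
        \<open>- (?B\<^sup>2 / K)\<close>. The squared distance started below \<open>d + e\<close>
        and cannot fall below \<open>d\<close>, so this gain is at most \<open>e\<close>.\<close>
      define t where "t = - ?B / K"
      have "d \<le> W (\<lambda>x. a x + of_real t * f1 x, \<lambda>x. b x + of_real t * f2 x)"
        by (rule dle[OF lin[OF ab(1) f12(1)]])
      also have "\<dots> = (L2_norm M (\<lambda>x. h1 x + of_real t * f1 x))\<^sup>2
          + (L2_norm M (\<lambda>x. h2 x + of_real t * f2 x))\<^sup>2"
        by (simp add: W_def N_def h1_def h2_def algebra_simps)
      also have "\<dots> = W (a, b) + 2 * t * ?B + t\<^sup>2 * N (f1, f2)"
        using fL hL by (simp add: L2_norm_square_perturb Wab N_def algebra_simps)
      also have "\<dots> \<le> (d + e) + (2 * t * ?B + t\<^sup>2 * K)"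
        using ab(2) mult_left_mono[OF f12(2), of "t\<^sup>2"] by simp
      also have "2 * t * ?B + t\<^sup>2 * K = - (?B\<^sup>2 / K)"
        using \<open>K > 0\<close> by (simp add: t_def power2_eq_square field_simps)
      finally have "?B\<^sup>2 / K \<le> e" by simp
      then have "?B\<^sup>2 \<le> e * K" using \<open>K > 0\<close> by (simp add: field_simps)
      then show ?thesis by (intro real_le_rsqrt) (simp only: power2_abs)
    qed
    have "N (a, b) \<le> K"
    proof -
      have sq: "(L2_norm M c)\<^sup>2 \<le> 2 * (L2_norm M c')\<^sup>2 + 2 * (L2_norm M (\<lambda>x. c x - c' x))\<^sup>2"
        if "c \<in> L2 M" "c' \<in> L2 M" for c c'
      proof -
        have "L2_norm M c \<le> L2_norm M c' + L2_norm M (\<lambda>x. c x - c' x)"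
          using L2_norm_triangle[OF that(2) L2_diff[OF that]] by simp
        then have "(L2_norm M c)\<^sup>2 \<le> (L2_norm M c' + L2_norm M (\<lambda>x. c x - c' x))\<^sup>2"
          by (intro power_mono L2_norm_nonneg)
        then show ?thesis
          using sum_squares_bound[of "L2_norm M c'" "L2_norm M (\<lambda>x. c x - c' x)"]
          by (simp add: power2_sum)
      qed
      have "N (a, b) \<le> 2 * N (w, z) + 2 * W (a, b)"
        using sq[OF abL(1) wz(1)] sq[OF abL(2) wz(2)] by (simp add: N_def W_def)
      also have "\<dots> \<le> 2 * N (w, z) + 4 * (d + 1)" using ab(2) e(2) d0 by simp
      also have "\<dots> \<le> K" unfolding K_def by simp
      finally show ?thesis .
    qed
    then have 1: "\<bar>re_inner M a h1 + re_inner M b h2\<bar> \<le> sqrt (e * K)"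
      by (rule orth[OF ab(1)])
    \<comment> \<open>The sequence enters here: each of its members is nearly orthogonal to
      \<open>(h1, h2)\<close>, with a bound that survives the weak limit.\<close>
    have 2: "\<bar>re_inner M w h1 + re_inner M z h2\<bar> \<le> sqrt (e * K)"
    proof (rule tendsto_upperbound)
      show "(\<lambda>n. \<bar>re_inner M (f n) h1 + re_inner M (p n) h2\<bar>)
          \<longlonglongrightarrow> \<bar>re_inner M w h1 + re_inner M z h2\<bar>"
        unfolding re_inner_def using limf[OF L2_cnj[OF hL(1)]] limp[OF L2_cnj[OF hL(2)]]
        by (intro tendsto_intros)
      have "N (f n, p n) \<le> K" for n
      proof -
        have "(L2_norm M (f n))\<^sup>2 \<le> C\<^sup>2" "(L2_norm M (p n))\<^sup>2 \<le> C\<^sup>2"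
          by (intro power_mono bd L2_norm_nonneg)+
        then have "N (f n, p n) \<le> 2 * C\<^sup>2" by (simp add: N_def)
        also have "\<dots> \<le> K" using d0 N0[of "(w, z)"] by (simp add: K_def)
        finally show ?thesis .
      qed
      then show "\<forall>\<^sub>F n in sequentially. \<bar>re_inner M (f n) h1 + re_inner M (p n) h2\<bar> \<le> sqrt (e * K)"
        by (intro always_eventually allI orth fp)
    qed simp
    \<comment> \<open>\<open>(h1, h2)\<close> is the difference of \<open>(a, b)\<close> and
      \<open>(w, z)\<close>, and both of these are nearly orthogonal to it, so its squared norm is
      small.\<close>
    have "W (a, b) = re_inner M h1 h1 + re_inner M h2 h2"
      by (simp add: Wab re_inner_self)
    also have "\<dots> = re_inner M (\<lambda>x. a x - w x) h1 + re_inner M (\<lambda>x. b x - z x) h2"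
      by (simp add: h1_def[abs_def] h2_def[abs_def])
    also have "\<dots> = (re_inner M a h1 + re_inner M b h2) - (re_inner M w h1 + re_inner M z h2)"
      using abL wz hL by (simp add: re_inner_diff)
    also have "\<dots> \<le> 2 * sqrt (e * K)" using 1 2 by linarith
    finally show ?thesis using ab by blast
  qed
  note near = this
  show ?thesis
    unfolding L2_closure_iff
  proof (intro conjI wz allI impI)
    fix r :: real assume r: "r > 0"
    have "((\<lambda>e. 2 * sqrt (e * K)) \<longlongrightarrow> 2 * sqrt (0 * K)) (at_right 0)"
      by (intro tendsto_intros)
    then have "\<forall>\<^sub>F e in at_right 0. 2 * sqrt (e * K) < r\<^sup>2"
      using r by (intro order_tendstoD) auto
    moreover have "\<forall>\<^sub>F e in at_right (0::real). 0 < e \<and> e < 1"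
      by (auto simp: eventually_at_right_field intro: exI[of _ 1])
    ultimately have "\<forall>\<^sub>F e in at_right 0. 2 * sqrt (e * K) < r\<^sup>2 \<and> 0 < e \<and> e < 1"
      by (rule eventually_conj)
    then obtain e where e: "2 * sqrt (e * K) < r\<^sup>2" "0 < e" "e < 1"
      using eventually_happens'[of "at_right (0::real)"] trivial_limit_at_right_real by auto
    obtain a b where ab: "(a, b) \<in> G" "W (a, b) \<le> 2 * sqrt (e * K)" using near[OF e(2,3)] by blast
    then have lt: "(L2_norm M (\<lambda>x. a x - w x))\<^sup>2 + (L2_norm M (\<lambda>x. b x - z x))\<^sup>2 < r\<^sup>2"
      using e(1) by (simp add: W_def N_def)
    have "L2_norm M (\<lambda>x. a x - w x) < r" "L2_norm M (\<lambda>x. b x - z x) < r"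
      using lt r by (auto intro!: power2_less_imp_less[of _ r]
          intro: le_less_trans[rotated] simp: add_increasing add_increasing2)
    then show "\<exists>(f, h)\<in>G \<inter> L2 M \<times> L2 M. L2_norm M (\<lambda>x. f x - w x) < r
        \<and> L2_norm M (\<lambda>x. h x - z x) < r"
      using ab(1) GL2 by blast
  qed
qed

section \<open>Schur's test\<close>

text \<open>Cauchy-Schwarz in \<open>y\<close> uses one slice bound; after the integrals are
  exchanged, the other slice bound is used in \<open>x\<close>. An indicator is general enough as a
  kernel, since the kernels met later are dominated by a constant times one.\<close>

lemma Schur_test_nn_integral:
  assumes "sigma_finite_measure M" and A[measurable]: "A \<in> sets (M \<Otimes>\<^sub>M M)"
    and a: "\<And>x. x \<in> space M \<Longrightarrow> (\<integral>\<^sup>+y. indicator A (x, y) \<partial>M) \<le> a"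
    and b: "\<And>y. y \<in> space M \<Longrightarrow> (\<integral>\<^sup>+x. indicator A (x, y) \<partial>M) \<le> b"
    and w[measurable]: "w \<in> borel_measurable M"
  shows "(\<integral>\<^sup>+x. (\<integral>\<^sup>+y. indicator A (x, y) * w y \<partial>M)\<^sup>2 \<partial>M) \<le> a * b * (\<integral>\<^sup>+y. (w y)\<^sup>2 \<partial>M)"
proof -
  interpret sigma_finite_measure M by fact
  interpret pair_sigma_finite M M by unfold_locales
  have "(\<integral>\<^sup>+x. (\<integral>\<^sup>+y. indicator A (x, y) * w y \<partial>M)\<^sup>2 \<partial>M)
      \<le> (\<integral>\<^sup>+x. a * (\<integral>\<^sup>+y. indicator A (x, y) * (w y)\<^sup>2 \<partial>M) \<partial>M)"
  proof (rule nn_integral_mono)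
    fix x assume x: "x \<in> space M"
    have [measurable]: "(\<lambda>y. indicator A (x, y) :: ennreal) \<in> borel_measurable M"
      using x by measurable
    \<comment> \<open>The indicator equals its own square, so one copy goes to each factor of
      Cauchy-Schwarz.\<close>
    have "(\<integral>\<^sup>+y. indicator A (x, y) * (indicator A (x, y) * w y) \<partial>M)\<^sup>2
        \<le> (\<integral>\<^sup>+y. (indicator A (x, y))\<^sup>2 \<partial>M) * (\<integral>\<^sup>+y. (indicator A (x, y) * w y)\<^sup>2 \<partial>M)"
      by (rule Cauchy_Schwarz_nn_integral) measurable
    also have "(\<lambda>y. (indicator A (x, y) :: ennreal)\<^sup>2) = (\<lambda>y. indicator A (x, y))"
      by (auto simp: indicator_def)
    also have "(\<lambda>y. (indicator A (x, y) * w y)\<^sup>2) = (\<lambda>y. indicator A (x, y) * (w y)\<^sup>2)"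
      by (auto simp: indicator_def)
    also have "(\<lambda>y. indicator A (x, y) * (indicator A (x, y) * w y)) = (\<lambda>y. indicator A (x, y) * w y)"
      by (auto simp: indicator_def)
    also have "(\<integral>\<^sup>+y. indicator A (x, y) \<partial>M) * (\<integral>\<^sup>+y. indicator A (x, y) * (w y)\<^sup>2 \<partial>M)
        \<le> a * (\<integral>\<^sup>+y. indicator A (x, y) * (w y)\<^sup>2 \<partial>M)"
      by (intro mult_right_mono a x) auto
    finally show "(\<integral>\<^sup>+y. indicator A (x, y) * w y \<partial>M)\<^sup>2
        \<le> a * (\<integral>\<^sup>+y. indicator A (x, y) * (w y)\<^sup>2 \<partial>M)" .
  qed
  also have "\<dots> = a * (\<integral>\<^sup>+x. (\<integral>\<^sup>+y. indicator A (x, y) * (w y)\<^sup>2 \<partial>M) \<partial>M)"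
    by (rule nn_integral_cmult) measurable
  also have "(\<integral>\<^sup>+x. (\<integral>\<^sup>+y. indicator A (x, y) * (w y)\<^sup>2 \<partial>M) \<partial>M)
      = (\<integral>\<^sup>+y. (\<integral>\<^sup>+x. indicator A (x, y) * (w y)\<^sup>2 \<partial>M) \<partial>M)"
    by (rule Fubini'[symmetric]) measurable
  also have "\<dots> \<le> (\<integral>\<^sup>+y. b * (w y)\<^sup>2 \<partial>M)"
  proof (rule nn_integral_mono)
    fix y assume y: "y \<in> space M"
    have [measurable]: "(\<lambda>x. indicator A (x, y) :: ennreal) \<in> borel_measurable M"
      using y by measurable
    have "(\<integral>\<^sup>+x. indicator A (x, y) * (w y)\<^sup>2 \<partial>M) = (\<integral>\<^sup>+x. indicator A (x, y) \<partial>M) * (w y)\<^sup>2"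
      by (rule nn_integral_multc) measurable
    also have "\<dots> \<le> b * (w y)\<^sup>2" by (intro mult_right_mono b y) auto
    finally show "(\<integral>\<^sup>+x. indicator A (x, y) * (w y)\<^sup>2 \<partial>M) \<le> b * (w y)\<^sup>2" .
  qed
  also have "\<dots> = b * (\<integral>\<^sup>+y. (w y)\<^sup>2 \<partial>M)"
    by (rule nn_integral_cmult) measurable
  finally show ?thesis by (simp add: mult.assoc mult_left_mono)
qed

text \<open>With extended nonnegative integrals the domination makes sense before anything is known
  to be integrable; square-integrability of \<open>f\<close> is part of the outcome. For height
  \<open>C\<close> of order s^(-n) and slices \<open>a\<close> of order s^n the bound is free of the
  scale s.\<close>

lemma Schur_test:
  assumes "sigma_finite_measure M" and A[measurable]: "A \<in> sets (M \<Otimes>\<^sub>M M)"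
    and a: "\<And>x. x \<in> space M \<Longrightarrow> (\<integral>\<^sup>+y. indicator A (x, y) \<partial>M) \<le> ennreal a"
    and b: "\<And>y. y \<in> space M \<Longrightarrow> (\<integral>\<^sup>+x. indicator A (x, y) \<partial>M) \<le> ennreal a"
    and w: "w \<in> L2 M" and f[measurable]: "f \<in> borel_measurable M"
    and fw: "\<And>x. x \<in> space M \<Longrightarrow>
      ennreal (cmod (f x)) \<le> ennreal C * (\<integral>\<^sup>+y. indicator A (x, y) * ennreal (cmod (w y)) \<partial>M)"
    and "0 \<le> C" "0 \<le> a"
  shows "f \<in> L2 M" "L2_norm M f \<le> C * a * L2_norm M w"
proof -
  have [measurable]: "w \<in> borel_measurable M" by (rule L2_measurable[OF w])
  have sq: "(ennreal (cmod z))\<^sup>2 = ennreal ((cmod z)\<^sup>2)" for z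
    by (simp add: ennreal_power)
  interpret sigma_finite_measure M by fact
  have "(\<integral>\<^sup>+x. ennreal ((cmod (f x))\<^sup>2) \<partial>M)
      \<le> (\<integral>\<^sup>+x. (ennreal C)\<^sup>2 * (\<integral>\<^sup>+y. indicator A (x, y) * ennreal (cmod (w y)) \<partial>M)\<^sup>2 \<partial>M)"
    unfolding sq[symmetric] power_mult_distrib[symmetric]
    by (intro nn_integral_mono power_mono fw) auto
  also have "\<dots> = (ennreal C)\<^sup>2 * (\<integral>\<^sup>+x. (\<integral>\<^sup>+y. indicator A (x, y) * ennreal (cmod (w y)) \<partial>M)\<^sup>2 \<partial>M)"
    by (rule nn_integral_cmult) measurable
  also have "\<dots> \<le> (ennreal C)\<^sup>2 * (ennreal a * ennreal a * (\<integral>\<^sup>+y. (ennreal (cmod (w y)))\<^sup>2 \<partial>M))"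
    by (intro mult_left_mono Schur_test_nn_integral a b assms(1)) auto
  also have "(\<integral>\<^sup>+y. (ennreal (cmod (w y)))\<^sup>2 \<partial>M) = ennreal ((L2_norm M w)\<^sup>2)"
    unfolding sq L2_norm_square
    by (rule nn_integral_eq_integral[OF L2_integrable_norm[OF w]]) simp
  also have "(ennreal C)\<^sup>2 * (ennreal a * ennreal a * ennreal ((L2_norm M w)\<^sup>2))
      = ennreal ((C * a * L2_norm M w)\<^sup>2)"
    using assms(8,9) by (simp add: ennreal_power power_mult_distrib power2_eq_square L2_norm_nonneg
        mult_ac flip: ennreal_mult)
  finally have le: "(\<integral>\<^sup>+x. ennreal ((cmod (f x))\<^sup>2) \<partial>M) \<le> ennreal ((C * a * L2_norm M w)\<^sup>2)" .
  have int: "integrable M (\<lambda>x. (cmod (f x))\<^sup>2)"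
    by (rule integrableI_bounded) (use le in \<open>auto intro: le_less_trans\<close>)
  then show "f \<in> L2 M" by (simp add: L2_def)
  have "(\<integral>x. (cmod (f x))\<^sup>2 \<partial>M) \<le> (C * a * L2_norm M w)\<^sup>2"
    using le nn_integral_eq_integral[OF int] by simp
  then show "L2_norm M f \<le> C * a * L2_norm M w"
    unfolding L2_norm_square[symmetric]
    by (rule power2_le_imp_le) (simp add: L2_norm_nonneg assms(8,9))
qed

section \<open>Adjoint and closure of a symmetric first-order operator\<close>

text \<open>Isolates what the abstract part takes from the manifold: an algebra of bounded smooth
  functions, dense in \<open>L2 M\<close>, and an operator obeying the Leibniz rule corrected by its
  zeroth-order term \<open>P (\<lambda>_. 1)\<close>. Dimension 0 and positive dimension are both
  instances.\<close>

locale symmetric_first_order =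
  fixes A :: "('a::t2_space, 'e::euclidean_space) chart set"
    and M :: "'a measure"
    and P :: "('a \<Rightarrow> complex) \<Rightarrow> 'a \<Rightarrow> complex"
  assumes finite_M: "finite_measure M"
    and smooth_measurable: "f \<in> smooth_functions A \<Longrightarrow> f \<in> borel_measurable M"
    and smooth_bounded: "f \<in> smooth_functions A \<Longrightarrow> \<exists>C. \<forall>x. cmod (f x) \<le> C"
    and smooth_const: "(\<lambda>x. c) \<in> smooth_functions A"
    and smooth_add: "f \<in> smooth_functions A \<Longrightarrow> g \<in> smooth_functions A
      \<Longrightarrow> (\<lambda>x. f x + g x) \<in> smooth_functions A"
    and smooth_mult: "f \<in> smooth_functions A \<Longrightarrow> g \<in> smooth_functions A
      \<Longrightarrow> (\<lambda>x. f x * g x) \<in> smooth_functions A"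
    and smooth_cnj: "f \<in> smooth_functions A \<Longrightarrow> (\<lambda>x. cnj (f x)) \<in> smooth_functions A"
    and smooth_dense: "u \<in> L2 M \<Longrightarrow> 0 < e
      \<Longrightarrow> \<exists>g\<in>smooth_functions A. L2_norm M (\<lambda>x. g x - u x) < e"
    and P_smooth: "f \<in> smooth_functions A \<Longrightarrow> P f \<in> smooth_functions A"
    and P_const: "P (\<lambda>_. c) x = c * P (\<lambda>_. 1) x"
    and P_add: "f \<in> smooth_functions A \<Longrightarrow> g \<in> smooth_functions A
      \<Longrightarrow> P (\<lambda>x. f x + g x) x = P f x + P g x"
    and P_mult: "f \<in> smooth_functions A \<Longrightarrow> g \<in> smooth_functions A
      \<Longrightarrow> P (\<lambda>x. f x * g x) x = f x * P g x + g x * P f x - f x * g x * P (\<lambda>_. 1) x"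
    and symmetric: "symmetric_operator A M P"
begin

lemma smooth_L2: "f \<in> smooth_functions A \<Longrightarrow> f \<in> L2 M"
proof -
  assume f: "f \<in> smooth_functions A"
  interpret finite_measure M by (rule finite_M)
  obtain C where "\<And>x. cmod (f x) \<le> C" using smooth_bounded[OF f] by blast
  then have "(cmod (f x))\<^sup>2 \<le> C\<^sup>2" for x by (intro power_mono) auto
  then have "integrable M (\<lambda>x. (cmod (f x))\<^sup>2)"
    using smooth_measurable[OF f] by (intro integrable_const_bound[where B = "C\<^sup>2"]) auto
  then show ?thesis using smooth_measurable[OF f] by (simp add: L2_def)
qed

lemma L2_smooth_mult:
  assumes "u \<in> L2 M" "g \<in> smooth_functions A"
  shows "(\<lambda>x. g x * u x) \<in> L2 M" "(\<lambda>x. u x * g x) \<in> L2 M"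
  using smooth_bounded[OF assms(2)] L2_bounded_mult[OF assms(1) smooth_measurable[OF assms(2)]]
  by blast+

lemma smooth_scale: "f \<in> smooth_functions A \<Longrightarrow> (\<lambda>x. c * f x) \<in> smooth_functions A"
  using smooth_mult[OF smooth_const] .

lemma smooth_diff:
  "f \<in> smooth_functions A \<Longrightarrow> g \<in> smooth_functions A \<Longrightarrow> (\<lambda>x. f x - g x) \<in> smooth_functions A"
  using smooth_add[OF _ smooth_scale[where c = "- 1"], of f g] by simp

text \<open>Homogeneity is assumed on constants only. The general case is the Leibniz rule with a
  constant factor, whose two zeroth-order terms cancel by \<open>P_const\<close>.\<close>

lemma P_scale: "f \<in> smooth_functions A \<Longrightarrow> P (\<lambda>x. c * f x) x = c * P f x"
  using P_mult[OF smooth_const, of f c x] P_const[of c x] by simp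

section \<open>The formal transpose and the inclusion of the closure in the adjoint\<close>

definition transpose_op :: "('a \<Rightarrow> complex) \<Rightarrow> 'a \<Rightarrow> complex"
  where "transpose_op g x = cnj (P (\<lambda>y. cnj (g y)) x)"

lemma transpose_op_smooth: "g \<in> smooth_functions A \<Longrightarrow> transpose_op g \<in> smooth_functions A"
  unfolding transpose_op_def[abs_def] by (intro smooth_cnj P_smooth)

lemma transpose_op_mult:
  assumes "f \<in> smooth_functions A" "g \<in> smooth_functions A"
  shows "transpose_op (\<lambda>x. f x * g x) x =
    f x * transpose_op g x + g x * transpose_op f x - f x * g x * transpose_op (\<lambda>_. 1) x"
  unfolding transpose_op_def using P_mult[OF smooth_cnj[OF assms(1)] smooth_cnj[OF assms(2)], of x]
  by simp

lemma transpose_op_diff: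
  assumes "f \<in> smooth_functions A" "g \<in> smooth_functions A"
  shows "transpose_op (\<lambda>x. f x - g x) x = transpose_op f x - transpose_op g x"
  unfolding transpose_op_def
  using P_add[OF smooth_cnj[OF assms(1)] smooth_scale[OF smooth_cnj[OF assms(2)], of "- 1"], of x]
    P_scale[OF smooth_cnj[OF assms(2)], of "- 1" x]
  by simp

text \<open>Symmetry for \<open>f\<close> and the conjugate of \<open>g\<close> is exactly this
  identity of integrals.\<close>

lemma formal_transpose_transpose_op: "formal_transpose A M P transpose_op"
  unfolding formal_transpose_def
proof (intro conjI ballI)
  fix g assume g: "g \<in> smooth_functions A"
  then show "transpose_op g \<in> smooth_functions A" by (rule transpose_op_smooth)
  fix f assume f: "f \<in> smooth_functions A"
  show "(\<integral>x. P f x * g x \<partial>M) = (\<integral>x. f x * transpose_op g x \<partial>M)"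
    using symmetric f smooth_cnj[OF g] unfolding symmetric_operator_def transpose_op_def
    by fastforce
qed

text \<open>\<open>distributional_image\<close> admits any transpose \<open>Q\<close>, so uniqueness
  is required before a fixed one can be used. Testing both pairings with the conjugate of the
  difference \<open>h\<close> makes the integral of its squared modulus vanish.\<close>

lemma formal_transpose_AE_eq:
  assumes "formal_transpose A M P Q" "g \<in> smooth_functions A"
  shows "AE x in M. Q g x = transpose_op g x"
proof -
  define h where "h x = Q g x - transpose_op g x" for x
  have Qg: "Q g \<in> smooth_functions A" using assms by (simp add: formal_transpose_def)
  have h: "h \<in> smooth_functions A"
    unfolding h_def[abs_def] by (intro smooth_diff Qg transpose_op_smooth assms)
  have hc: "(\<lambda>x. cnj (h x)) \<in> smooth_functions A" by (rule smooth_cnj[OF h])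
  have "(\<integral>x. cnj (h x) * Q g x \<partial>M) = (\<integral>x. P (\<lambda>x. cnj (h x)) x * g x \<partial>M)"
    using assms hc by (simp add: formal_transpose_def)
  also have "\<dots> = (\<integral>x. cnj (h x) * transpose_op g x \<partial>M)"
    using assms hc formal_transpose_transpose_op by (simp add: formal_transpose_def)
  finally have "(\<integral>x. cnj (h x) * Q g x \<partial>M) = (\<integral>x. cnj (h x) * transpose_op g x \<partial>M)" .
  then have "(\<integral>x. cnj (h x) * h x \<partial>M) = 0"
    using L2_mult_integrable[OF smooth_L2[OF hc] smooth_L2[OF Qg]]
      L2_mult_integrable[OF smooth_L2[OF hc] smooth_L2[OF transpose_op_smooth[OF assms(2)]]]
    by (simp add: h_def right_diff_distrib)
  then have "of_real (\<integral>x. (cmod (h x))\<^sup>2 \<partial>M) = (0 :: complex)"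
    unfolding integral_complex_of_real[symmetric] complex_norm_square by (simp add: mult.commute)
  then have "AE x in M. (cmod (h x))\<^sup>2 = 0"
    using integral_nonneg_eq_0_iff_AE[OF L2_integrable_norm[OF smooth_L2[OF h]]] by simp
  then show ?thesis by (auto simp: h_def)
qed

lemma adjoint_graph_iff:
  "(u, v) \<in> adjoint_graph A M P \<longleftrightarrow> u \<in> L2 M \<and> v \<in> L2 M \<and>
    (\<forall>g\<in>smooth_functions A. (\<integral>x. v x * g x \<partial>M) = (\<integral>x. u x * transpose_op g x \<partial>M))"
proof -
  have "(\<integral>x. u x * Q g x \<partial>M) = (\<integral>x. u x * transpose_op g x \<partial>M)"
    if "u \<in> L2 M" "formal_transpose A M P Q" "g \<in> smooth_functions A" for Q g
  proof (rule integral_cong_AE)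
    have "Q g \<in> smooth_functions A" using that by (simp add: formal_transpose_def)
    then show "(\<lambda>x. u x * Q g x) \<in> borel_measurable M"
      using L2_measurable[OF that(1)] smooth_measurable by measurable
    show "(\<lambda>x. u x * transpose_op g x) \<in> borel_measurable M"
      using L2_measurable[OF that(1)] smooth_measurable[OF transpose_op_smooth[OF that(3)]]
      by measurable
    show "AE x in M. u x * Q g x = u x * transpose_op g x"
      using formal_transpose_AE_eq[OF that(2,3)] by auto
  qed
  note eq = this
  show ?thesis
  proof
    assume "(u, v) \<in> adjoint_graph A M P"
    then obtain Q where uv: "u \<in> L2 M" "v \<in> L2 M" and Q: "formal_transpose A M P Q"
      and "\<forall>g\<in>smooth_functions A. (\<integral>x. v x * g x \<partial>M) = (\<integral>x. u x * Q g x \<partial>M)"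
      unfolding adjoint_graph_def distributional_image_def by blast
    then show "u \<in> L2 M \<and> v \<in> L2 M \<and>
        (\<forall>g\<in>smooth_functions A. (\<integral>x. v x * g x \<partial>M) = (\<integral>x. u x * transpose_op g x \<partial>M))"
      using eq[OF uv(1) Q] by simp
  next
    assume "u \<in> L2 M \<and> v \<in> L2 M \<and>
        (\<forall>g\<in>smooth_functions A. (\<integral>x. v x * g x \<partial>M) = (\<integral>x. u x * transpose_op g x \<partial>M))"
    then show "(u, v) \<in> adjoint_graph A M P"
      unfolding adjoint_graph_def distributional_image_def mem_Collect_eq prod.case
      using formal_transpose_transpose_op by (intro conjI exI[of _ transpose_op]) simp_all
  qed
qed

lemma operator_graph_iff: "(f, p) \<in> operator_graph A P \<longleftrightarrow> f \<in> smooth_functions A \<and> p = P f"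
  by (auto simp: operator_graph_def)

lemma operator_graph_L2: "operator_graph A P \<subseteq> L2 M \<times> L2 M"
  by (auto simp: operator_graph_iff smooth_L2 P_smooth)

lemma operator_graph_combination:
  assumes "(f, h) \<in> operator_graph A P" "(f', h') \<in> operator_graph A P"
  shows "(\<lambda>x. f x + c * f' x, \<lambda>x. h x + c * h' x) \<in> operator_graph A P"
  using assms P_add smooth_scale P_scale smooth_add by (auto simp: operator_graph_iff)

text \<open>Along the approximating sequence the identity of pairings is transposition, and both
  sides are continuous in \<open>L2 M\<close>.\<close>

lemma closure_subset_adjoint: "L2_closure M (operator_graph A P) \<subseteq> adjoint_graph A M P"
proof (rule subrelI)
  fix u v assume "(u, v) \<in> L2_closure M (operator_graph A P)"
  then obtain us vs where uv: "u \<in> L2 M" "v \<in> L2 M"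
    and graph: "\<forall>n::nat. (us n, vs n) \<in> operator_graph A P \<inter> L2 M \<times> L2 M"
    and lim0: "(\<lambda>n. L2_norm M (\<lambda>x. us n x - u x)) \<longlonglongrightarrow> 0"
      "(\<lambda>n. L2_norm M (\<lambda>x. vs n x - v x)) \<longlonglongrightarrow> 0"
    unfolding L2_closure_def mem_Collect_eq prod.case by blast
  have sm: "us n \<in> smooth_functions A" and vs: "vs n = P (us n)" for n
    using graph by (simp_all add: operator_graph_iff)
  note lim = lim0[unfolded vs]
  show "(u, v) \<in> adjoint_graph A M P"
    unfolding adjoint_graph_iff
  proof (intro conjI uv ballI)
    fix g assume g: "g \<in> smooth_functions A"
    have "(\<lambda>n. \<integral>x. P (us n) x * g x \<partial>M) \<longlonglongrightarrow> (\<integral>x. v x * g x \<partial>M)"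
      by (rule tendsto_integral_mult_L2[OF _ uv(2) smooth_L2[OF g] lim(2)])
         (simp add: sm smooth_L2 P_smooth)
    moreover have "(\<integral>x. P (us n) x * g x \<partial>M) = (\<integral>x. us n x * transpose_op g x \<partial>M)" for n
      using formal_transpose_transpose_op sm g by (simp add: formal_transpose_def)
    moreover have "(\<lambda>n. \<integral>x. us n x * transpose_op g x \<partial>M) \<longlonglongrightarrow> (\<integral>x. u x * transpose_op g x \<partial>M)"
      by (rule tendsto_integral_mult_L2[OF _ uv(1) smooth_L2[OF transpose_op_smooth[OF g]] lim(1)])
         (simp add: sm smooth_L2)
    ultimately show "(\<integral>x. v x * g x \<partial>M) = (\<integral>x. u x * transpose_op g x \<partial>M)"
      using LIMSEQ_unique by auto
  qed
qed

text \<open>The conjugate of \<open>h\<close> is a limit of smooth functions, so the integral of the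
  squared modulus of \<open>h\<close> is arbitrarily small compared with the norm of
  \<open>h\<close>.\<close>

lemma L2_norm_eq_0_if_orthogonal:
  assumes h: "h \<in> L2 M" and "\<And>g. g \<in> smooth_functions A \<Longrightarrow> (\<integral>x. h x * g x \<partial>M) = 0"
  shows "L2_norm M h = 0"
proof -
  have hc: "(\<lambda>x. cnj (h x)) \<in> L2 M" by (rule L2_cnj[OF h])
  have le: "(L2_norm M h)\<^sup>2 \<le> L2_norm M h * e" if "e > 0" for e
  proof -
    obtain g where g: "g \<in> smooth_functions A" "L2_norm M (\<lambda>x. g x - cnj (h x)) < e"
      using smooth_dense[OF hc \<open>e > 0\<close>] by blast
    have "(L2_norm M h)\<^sup>2 = cmod (\<integral>x. h x * cnj (h x) \<partial>M)"
      unfolding L2_norm_square complex_norm_square[symmetric] integral_complex_of_real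
      by (simp add: integral_nonneg)
    also have "(\<integral>x. h x * cnj (h x) \<partial>M) = - (\<integral>x. h x * (g x - cnj (h x)) \<partial>M)"
      using assms(2)[OF g(1)] L2_mult_integrable[OF h smooth_L2[OF g(1)]] L2_mult_integrable[OF h hc]
      by (simp add: right_diff_distrib)
    also have "cmod \<dots> \<le> L2_norm M h * L2_norm M (\<lambda>x. g x - cnj (h x))"
      using L2_integral_mult_bound[OF h L2_diff[OF smooth_L2[OF g(1)] hc]] by simp
    also have "\<dots> \<le> L2_norm M h * e"
      using g(2) by (intro mult_left_mono L2_norm_nonneg) simp
    finally show ?thesis .
  qed
  show ?thesis
  proof (rule ccontr)
    assume "L2_norm M h \<noteq> 0"
    then have pos: "L2_norm M h > 0" using L2_norm_nonneg[of M h] by linarith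
    then show False using le[of "L2_norm M h / 2"] by (simp add: power2_eq_square)
  qed
qed

text \<open>\<open>P u\<close> and \<open>v\<close> agree almost everywhere, and the closure does
  not see representatives, so the constant sequence \<open>(u, P u)\<close> works. This settles
  dimension 0, and also the pairs with \<open>u = 0\<close> at which the localization ends.\<close>

lemma adjoint_smooth_in_closure:
  assumes "(u, v) \<in> adjoint_graph A M P" "u \<in> smooth_functions A"
  shows "(u, v) \<in> L2_closure M (operator_graph A P)"
proof -
  note uv = assms(1)[unfolded adjoint_graph_iff]
  have Pu: "P u \<in> smooth_functions A" by (rule P_smooth[OF assms(2)])
  have "(\<integral>x. (P u x - v x) * g x \<partial>M) = 0" if g: "g \<in> smooth_functions A" for g
  proof -
    have "(\<integral>x. P u x * g x \<partial>M) = (\<integral>x. v x * g x \<partial>M)"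
      using uv g formal_transpose_transpose_op assms(2) by (simp add: formal_transpose_def)
    then show ?thesis
      using L2_mult_integrable[OF smooth_L2[OF Pu] smooth_L2[OF g]]
        L2_mult_integrable[OF _ smooth_L2[OF g]] uv
      by (simp add: left_diff_distrib)
  qed
  then have 0: "L2_norm M (\<lambda>x. P u x - v x) = 0"
    using L2_norm_eq_0_if_orthogonal[OF L2_diff[OF smooth_L2[OF Pu]]] uv by blast
  have "L2_norm M (\<lambda>x. u x - u x) = 0" by (simp add: L2_norm_def)
  with 0 show ?thesis
    unfolding L2_closure_iff using uv assms(2) Pu smooth_L2
    by (auto intro!: bexI[of _ "(u, P u)"] simp: operator_graph_iff)
qed

text \<open>By the Leibniz rule, the commutator of \<open>transpose_op\<close> with multiplication
  by \<open>\<xi>\<close> is multiplication by this function. Degree 1 makes it an operator of order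
  zero.\<close>

definition commutator :: "('a \<Rightarrow> complex) \<Rightarrow> 'a \<Rightarrow> complex"
  where "commutator \<xi> x = transpose_op \<xi> x - \<xi> x * transpose_op (\<lambda>_. 1) x"

lemma commutator_smooth: "\<xi> \<in> smooth_functions A \<Longrightarrow> commutator \<xi> \<in> smooth_functions A"
  unfolding commutator_def[abs_def]
  by (intro smooth_diff smooth_mult transpose_op_smooth smooth_const)

lemma commutator_one_minus:
  "\<xi> \<in> smooth_functions A \<Longrightarrow> commutator (\<lambda>x. 1 - \<xi> x) x = - commutator \<xi> x"
  using transpose_op_diff[OF smooth_const, of \<xi> 1 x] by (simp add: commutator_def algebra_simps)

text \<open>A weak Leibniz rule: test the original pair with \<open>\<xi>\<close> times
  \<open>g\<close> and split off the commutator. The correction is subtracted because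
  \<open>P\<close> and its transpose have opposite commutators with \<open>\<xi>\<close>; being
  bounded, it keeps the second component in \<open>L2 M\<close>.\<close>

lemma adjoint_localize:
  assumes uv: "(u, v) \<in> adjoint_graph A M P" and \<xi>: "\<xi> \<in> smooth_functions A"
  shows "(\<lambda>x. \<xi> x * u x, \<lambda>x. \<xi> x * v x - u x * commutator \<xi> x) \<in> adjoint_graph A M P"
proof -
  note uv = uv[unfolded adjoint_graph_iff]
  then have u: "u \<in> L2 M" and v: "v \<in> L2 M" by auto
  show ?thesis
    unfolding adjoint_graph_iff
  proof (intro conjI ballI)
    show "(\<lambda>x. \<xi> x * u x) \<in> L2 M" by (rule L2_smooth_mult[OF u \<xi>])
    show "(\<lambda>x. \<xi> x * v x - u x * commutator \<xi> x) \<in> L2 M"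
      by (intro L2_diff L2_smooth_mult u v \<xi> commutator_smooth)
    fix g assume g: "g \<in> smooth_functions A"
    have \<xi>g: "(\<lambda>x. \<xi> x * g x) \<in> smooth_functions A" by (rule smooth_mult[OF \<xi> g])
    have cg: "(\<lambda>x. commutator \<xi> x * g x) \<in> smooth_functions A"
      by (rule smooth_mult[OF commutator_smooth[OF \<xi>] g])
    have "(\<integral>x. (\<xi> x * v x - u x * commutator \<xi> x) * g x \<partial>M)
        = (\<integral>x. v x * (\<xi> x * g x) - u x * (commutator \<xi> x * g x) \<partial>M)"
      by (simp add: algebra_simps)
    also have "\<dots> = (\<integral>x. v x * (\<xi> x * g x) \<partial>M) - (\<integral>x. u x * (commutator \<xi> x * g x) \<partial>M)"
      by (intro Bochner_Integration.integral_diff L2_mult_integrable u v smooth_L2 \<xi>g cg)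
    also have "(\<integral>x. v x * (\<xi> x * g x) \<partial>M) = (\<integral>x. u x * transpose_op (\<lambda>x. \<xi> x * g x) x \<partial>M)"
      by (rule bspec[OF uv[THEN conjunct2, THEN conjunct2] \<xi>g])
    also have "\<dots> - (\<integral>x. u x * (commutator \<xi> x * g x) \<partial>M)
        = (\<integral>x. u x * transpose_op (\<lambda>x. \<xi> x * g x) x - u x * (commutator \<xi> x * g x) \<partial>M)"
      by (intro Bochner_Integration.integral_diff[symmetric] L2_mult_integrable u smooth_L2
          transpose_op_smooth \<xi>g cg)
    also have "\<dots> = (\<integral>x. \<xi> x * u x * transpose_op g x \<partial>M)"
      by (simp add: transpose_op_mult[OF \<xi> g] commutator_def algebra_simps)
    finally show "(\<integral>x. (\<xi> x * v x - u x * commutator \<xi> x) * g x \<partial>M)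
        = (\<integral>x. \<xi> x * u x * transpose_op g x \<partial>M)" .
  qed
qed

text \<open>
  The factors \<open>1 - \<psi>\<close> are peeled off one at a time, so no partition of unity is needed.
\<close>

lemma adjoint_in_closure_by_localization:
  assumes "\<And>\<psi>. \<psi> \<in> set \<psi>s \<Longrightarrow> \<psi> \<in> smooth_functions A"
    and "\<And>\<psi> u v. \<psi> \<in> set \<psi>s \<Longrightarrow> (u, v) \<in> adjoint_graph A M P \<Longrightarrow>
      (\<lambda>x. \<psi> x * u x, \<lambda>x. \<psi> x * v x - u x * commutator \<psi> x) \<in> L2_closure M (operator_graph A P)"
    and "(u, v) \<in> adjoint_graph A M P"
    and "\<And>x. (\<Prod>\<psi>\<leftarrow>\<psi>s. 1 - \<psi> x) * u x = 0"
  shows "(u, v) \<in> L2_closure M (operator_graph A P)"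
  using assms
proof (induction \<psi>s arbitrary: u v)
  case Nil
  \<comment> \<open>The empty product is 1, so the hypothesis forces \<open>u\<close> to vanish
    everywhere.\<close>
  then have "u = (\<lambda>x. 0)" by auto
  then show ?case using adjoint_smooth_in_closure[OF Nil(3)] smooth_const by simp
next
  case (Cons \<psi> \<psi>s)
  have \<psi>: "\<psi> \<in> smooth_functions A" using Cons.prems(1) by simp
  then have \<psi>1: "(\<lambda>x. 1 - \<psi> x) \<in> smooth_functions A" by (intro smooth_diff smooth_const)
  have 1: "(\<lambda>x. \<psi> x * u x, \<lambda>x. \<psi> x * v x - u x * commutator \<psi> x) \<in> L2_closure M (operator_graph A P)"
    by (rule Cons.prems(2)[OF _ Cons.prems(3)]) simp
  have 2: "(\<lambda>x. (1 - \<psi> x) * u x, \<lambda>x. (1 - \<psi> x) * v x - u x * commutator (\<lambda>x. 1 - \<psi> x) x)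
      \<in> L2_closure M (operator_graph A P)"
  proof (rule Cons.IH)
    show "(\<lambda>x. (1 - \<psi> x) * u x, \<lambda>x. (1 - \<psi> x) * v x - u x * commutator (\<lambda>x. 1 - \<psi> x) x)
        \<in> adjoint_graph A M P"
      by (rule adjoint_localize[OF Cons.prems(3) \<psi>1])
    show "(\<Prod>\<psi>\<leftarrow>\<psi>s. 1 - \<psi> x) * ((1 - \<psi> x) * u x) = 0" for x
      using Cons.prems(4)[of x] by (auto simp: algebra_simps)
  qed (use Cons.prems in auto)
  \<comment> \<open>The commutators of \<open>\<psi>\<close> and \<open>1 - \<psi>\<close> are
    opposite, so the two corrected second components add up to \<open>v\<close>.\<close>
  have "(\<lambda>x. \<psi> x * u x + (1 - \<psi> x) * u x,
      \<lambda>x. (\<psi> x * v x - u x * commutator \<psi> x) + ((1 - \<psi> x) * v x - u x * commutator (\<lambda>x. 1 - \<psi> x) x))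
      \<in> L2_closure M (operator_graph A P)"
    by (rule L2_closure_add[OF _ 1 2]) (use operator_graph_combination[where c = 1] in auto)
  then show ?case by (simp add: commutator_one_minus[OF \<psi>] algebra_simps)
qed

text \<open>For real \<open>\<xi>\<close> the commutator of \<open>P\<close> with
  \<open>\<xi>\<close> is multiplication by \<open>d\<close>, and symmetry makes it skew. Computing
  the integral of \<open>P\<close> applied to \<open>\<xi>\<close> times \<open>f\<close> once by
  transposition onto 1 and once by the Leibniz rule shows that the integral of \<open>f\<close>
  times \<open>d + cnj d\<close> vanishes; taking this sum itself as \<open>f\<close> leaves the
  square of twice the real part.\<close>

lemma real_symbol:
  assumes \<xi>: "\<xi> \<in> smooth_functions A" and real: "\<And>x. cnj (\<xi> x) = \<xi> x"
  shows "AE x in M. Re (P \<xi> x - \<xi> x * P (\<lambda>_. 1) x) = 0"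
proof -
  define d where "d x = P \<xi> x - \<xi> x * P (\<lambda>_. 1) x" for x
  have d: "d \<in> smooth_functions A"
    unfolding d_def[abs_def] by (intro smooth_diff smooth_mult P_smooth \<xi> smooth_const)
  define f where "f x = d x + cnj (d x)" for x
  have f: "f \<in> smooth_functions A" unfolding f_def[abs_def] by (intro smooth_add smooth_cnj d)
  define Q1 where "Q1 = transpose_op (\<lambda>_. 1)"
  have Q1: "Q1 \<in> smooth_functions A" unfolding Q1_def by (intro transpose_op_smooth smooth_const)
  have c1: "(\<lambda>_. 1) \<in> smooth_functions A" by (rule smooth_const)
  have \<xi>f: "(\<lambda>x. \<xi> x * f x) \<in> smooth_functions A" by (rule smooth_mult[OF \<xi> f])
  have T\<xi>: "transpose_op \<xi> x = cnj (d x) + \<xi> x * Q1 x" for x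
    using real by (simp add: transpose_op_def d_def Q1_def algebra_simps)
  have 1: "(\<integral>x. P (\<lambda>x. \<xi> x * f x) x \<partial>M) = (\<integral>x. \<xi> x * f x * Q1 x \<partial>M)"
    using formal_transpose_transpose_op \<xi>f c1 unfolding formal_transpose_def Q1_def by fastforce
  have 2: "(\<integral>x. P f x * \<xi> x \<partial>M) = (\<integral>x. f x * transpose_op \<xi> x \<partial>M)"
    using formal_transpose_transpose_op f \<xi> unfolding formal_transpose_def by blast
  have int: "integrable M h" if "h \<in> smooth_functions A" for h
    using L2_mult_integrable[OF smooth_L2[OF that] smooth_L2[OF c1]] by simp
  have "(\<integral>x. P (\<lambda>x. \<xi> x * f x) x \<partial>M) = (\<integral>x. P f x * \<xi> x + f x * d x \<partial>M)"
    by (rule Bochner_Integration.integral_cong[OF refl])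
       (simp add: P_mult[OF \<xi> f] d_def algebra_simps)
  also have "\<dots> = (\<integral>x. P f x * \<xi> x \<partial>M) + (\<integral>x. f x * d x \<partial>M)"
    by (intro Bochner_Integration.integral_add int smooth_mult P_smooth f \<xi> d)
  also have "\<dots> = (\<integral>x. f x * transpose_op \<xi> x \<partial>M) + (\<integral>x. f x * d x \<partial>M)"
    by (simp only: 2)
  also have "\<dots> = (\<integral>x. f x * transpose_op \<xi> x + f x * d x \<partial>M)"
    by (intro Bochner_Integration.integral_add[symmetric] int smooth_mult transpose_op_smooth f \<xi> d)
  finally have "(\<integral>x. f x * transpose_op \<xi> x + f x * d x \<partial>M) - (\<integral>x. \<xi> x * f x * Q1 x \<partial>M) = 0"
    using 1 by simp
  moreover have "(\<integral>x. f x * transpose_op \<xi> x + f x * d x \<partial>M) - (\<integral>x. \<xi> x * f x * Q1 x \<partial>M)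
      = (\<integral>x. (f x * transpose_op \<xi> x + f x * d x) - \<xi> x * f x * Q1 x \<partial>M)"
    by (intro Bochner_Integration.integral_diff[symmetric] int smooth_add smooth_mult
        transpose_op_smooth f \<xi> d Q1)
  moreover have "(f x * transpose_op \<xi> x + f x * d x) - \<xi> x * f x * Q1 x
      = of_real ((2 * Re (d x))\<^sup>2)" for x
    by (simp add: T\<xi> f_def complex_eq_iff power2_eq_square algebra_simps)
  ultimately have "(\<integral>x. (2 * Re (d x))\<^sup>2 \<partial>M) = 0"
    by (metis (no_types, lifting) integral_complex_of_real of_real_eq_0_iff Bochner_Integration.integral_cong)
  moreover have "integrable M (\<lambda>x. (2 * Re (d x))\<^sup>2)"
  proof -
    have "integrable M (\<lambda>x. Re (f x * f x))" by (intro integrable_Re int smooth_mult f)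
    then show ?thesis by (simp add: f_def power2_eq_square algebra_simps)
  qed
  ultimately have "AE x in M. (2 * Re (d x))\<^sup>2 = 0"
    using integral_nonneg_eq_0_iff_AE[of M "\<lambda>x. (2 * Re (d x))\<^sup>2"] by simp
  then have "AE x in M. Re (d x) = 0" by simp
  then show ?thesis unfolding d_def .
qed

text \<open>Uniform bounds extend convergence of pairings from smooth functions to all of
  \<open>L2 M\<close>. The limit of \<open>P (f n)\<close> comes for free: its pairing with
  \<open>g\<close> is that of \<open>f n\<close> with \<open>transpose_op g\<close>, and
  \<open>(w, z)\<close> lies in the adjoint graph.\<close>

lemma adjoint_in_closure_by_bounded_approximation:
  assumes wz: "(w, z) \<in> adjoint_graph A M P"
    and f: "\<And>n::nat. f n \<in> smooth_functions A"
    and bd: "\<And>n. L2_norm M (f n) \<le> C" "\<And>n. L2_norm M (P (f n)) \<le> C"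
    and lim: "\<And>g. g \<in> smooth_functions A \<Longrightarrow>
      (\<lambda>n. \<integral>x. f n x * g x \<partial>M) \<longlonglongrightarrow> (\<integral>x. w x * g x \<partial>M)"
  shows "(w, z) \<in> L2_closure M (operator_graph A P)"
proof -
  note wz = wz[unfolded adjoint_graph_iff]
  then have w: "w \<in> L2 M" and z: "z \<in> L2 M" by auto
  have ext: "(\<lambda>n. \<integral>x. a n x * h x \<partial>M) \<longlonglongrightarrow> (\<integral>x. b x * h x \<partial>M)"
    if a: "\<And>n. a n \<in> L2 M" "\<And>n. L2_norm M (a n) \<le> C" and b: "b \<in> L2 M" and h: "h \<in> L2 M"
      and alim: "\<And>g. g \<in> smooth_functions A \<Longrightarrow>
        (\<lambda>n. \<integral>x. a n x * g x \<partial>M) \<longlonglongrightarrow> (\<integral>x. b x * g x \<partial>M)" for a :: "nat \<Rightarrow> 'a \<Rightarrow> complex" and b h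
  proof (rule tendstoI)
    fix e :: real assume "e > 0"
    \<comment> \<open>Replacing \<open>h\<close> by \<open>g\<close> on both sides costs
      \<open>L2_norm M (a n) + L2_norm M b\<close> times their distance. \<open>B\<close> strictly
      exceeds this sum of norms, so a distance below \<open>e / (2 * B)\<close> keeps the cost under
      \<open>e / 2\<close>.\<close>
    define B where "B = C + L2_norm M b + 1"
    have "C \<ge> 0" using a(2)[of 0] L2_norm_nonneg[of M "a 0"] by linarith
    then have B: "B > 0" using L2_norm_nonneg[of M b] by (simp add: B_def)
    have "e / (2 * B) > 0" using \<open>e > 0\<close> B by simp
    then obtain g where g: "g \<in> smooth_functions A" "L2_norm M (\<lambda>x. g x - h x) < e / (2 * B)"
      using smooth_dense[OF h] by blast
    have gL: "g \<in> L2 M" by (rule smooth_L2[OF g(1)])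
    have "\<forall>\<^sub>F n in sequentially. dist (\<integral>x. a n x * g x \<partial>M) (\<integral>x. b x * g x \<partial>M) < e / 2"
      by (rule tendstoD[OF alim[OF g(1)]]) (use \<open>e > 0\<close> in simp)
    then show "\<forall>\<^sub>F n in sequentially. dist (\<integral>x. a n x * h x \<partial>M) (\<integral>x. b x * h x \<partial>M) < e"
    proof eventually_elim
      case (elim n)
      have diff: "cmod ((\<integral>x. c x * h x \<partial>M) - (\<integral>x. c x * g x \<partial>M)) \<le> L2_norm M c * (e / (2 * B))"
        if "c \<in> L2 M" for c
      proof -
        have "(\<integral>x. c x * h x \<partial>M) - (\<integral>x. c x * g x \<partial>M) = (\<integral>x. c x * (h x - g x) \<partial>M)"
          using L2_mult_integrable[OF that h] L2_mult_integrable[OF that gL]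
          by (simp add: right_diff_distrib)
        then have "cmod ((\<integral>x. c x * h x \<partial>M) - (\<integral>x. c x * g x \<partial>M))
            \<le> L2_norm M c * L2_norm M (\<lambda>x. h x - g x)"
          using L2_integral_mult_bound[OF that L2_diff[OF h gL]] by simp
        also have "\<dots> \<le> L2_norm M c * (e / (2 * B))"
          using g(2) by (intro mult_left_mono L2_norm_nonneg) (simp add: L2_norm_minus_commute[of M h])
        finally show ?thesis .
      qed
      have "L2_norm M (a n) * (e / (2 * B)) + L2_norm M b * (e / (2 * B))
          = (L2_norm M (a n) + L2_norm M b) * (e / (2 * B))"
        by (simp only: distrib_right)
      also have "\<dots> < B * (e / (2 * B))"
        using a(2)[of n] \<open>e / (2 * B) > 0\<close> by (intro mult_strict_right_mono) (auto simp: B_def)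
      also have "\<dots> = e / 2" using B by simp
      finally have lt: "L2_norm M (a n) * (e / (2 * B)) + L2_norm M b * (e / (2 * B)) < e / 2" .
      have tri: "cmod (p - q) \<le> cmod (p - p') + cmod (p' - q') + cmod (q - q')" for p q p' q'
        using norm_triangle_ineq[of "(p - p') + (p' - q')" "q' - q"]
          norm_triangle_ineq[of "p - p'" "p' - q'"] by (simp add: norm_minus_commute)
      show ?case
        unfolding dist_norm
        using tri[of "\<integral>x. a n x * h x \<partial>M" "\<integral>x. b x * h x \<partial>M" "\<integral>x. a n x * g x \<partial>M"
            "\<integral>x. b x * g x \<partial>M"] diff[OF a(1)[of n]] diff[OF b] elim lt
        unfolding dist_norm by linarith
    qed
  qed
  have limP: "(\<lambda>n. \<integral>x. P (f n) x * g x \<partial>M) \<longlonglongrightarrow> (\<integral>x. z x * g x \<partial>M)"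
    if g: "g \<in> smooth_functions A" for g
  proof -
    have "(\<integral>x. P (f n) x * g x \<partial>M) = (\<integral>x. f n x * transpose_op g x \<partial>M)" for n
      using formal_transpose_transpose_op f g by (simp add: formal_transpose_def)
    then show ?thesis
      using lim[OF transpose_op_smooth[OF g]] wz g by simp
  qed
  show ?thesis
  proof (rule weak_limit_in_L2_closure[where f = f and p = "\<lambda>n. P (f n)" and C = C])
    show "(\<lambda>x. f x + of_real t * f' x, \<lambda>x. h x + of_real t * h' x) \<in> operator_graph A P"
      if "(f, h) \<in> operator_graph A P" "(f', h') \<in> operator_graph A P" for f h f' h' t
      by (rule operator_graph_combination[OF that])
    show "(\<lambda>n. \<integral>x. f n x * h x \<partial>M) \<longlonglongrightarrow> (\<integral>x. w x * h x \<partial>M)" if "h \<in> L2 M" for h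
      by (rule ext[OF smooth_L2[OF f] bd(1) w that lim])
    show "(\<lambda>n. \<integral>x. P (f n) x * h x \<partial>M) \<longlonglongrightarrow> (\<integral>x. z x * h x \<partial>M)" if "h \<in> L2 M" for h
      by (rule ext[OF smooth_L2[OF P_smooth[OF f]] bd(2) z that limP])
  qed (use f bd operator_graph_L2 w z in \<open>auto simp: operator_graph_iff\<close>)
qed

end

section \<open>A density criterion in the space of square-integrable functions\<close>

definition L2_approximable :: "'a measure \<Rightarrow> ('a \<Rightarrow> complex) set \<Rightarrow> ('a \<Rightarrow> complex) \<Rightarrow> bool"
  where "L2_approximable M S u \<longleftrightarrow>
    u \<in> L2 M \<and> (\<forall>e>0. \<exists>g\<in>S. L2_norm M (\<lambda>x. g x - u x) < e)"

lemma L2_approximable_limit: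
  assumes S: "S \<subseteq> L2 M" and u: "u \<in> L2 M"
    and "\<And>n::nat. L2_approximable M S (us n)"
    and lim: "(\<lambda>n. L2_norm M (\<lambda>x. us n x - u x)) \<longlonglongrightarrow> 0"
  shows "L2_approximable M S u"
  unfolding L2_approximable_def
proof (intro conjI u allI impI)
  fix e :: real assume "e > 0"
  then have e: "e / 2 > 0" by simp
  obtain n where n: "L2_norm M (\<lambda>x. us n x - u x) < e / 2"
    using order_tendstoD(2)[OF lim e] by (auto simp: eventually_sequentially)
  have un: "us n \<in> L2 M" using assms(3) by (simp add: L2_approximable_def)
  obtain g where g: "g \<in> S" "L2_norm M (\<lambda>x. g x - us n x) < e / 2"
    using assms(3)[of n] e unfolding L2_approximable_def by blast
  then have "g \<in> L2 M" using S by blast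
  from L2_norm_triangle[OF L2_diff[OF this un] L2_diff[OF un u]]
  have "L2_norm M (\<lambda>x. g x - u x) \<le> L2_norm M (\<lambda>x. g x - us n x) + L2_norm M (\<lambda>x. us n x - u x)"
    by simp
  also have "\<dots> < e" using g n by simp
  finally show "\<exists>g\<in>S. L2_norm M (\<lambda>x. g x - u x) < e" using g(1) by blast
qed

lemma L2_approximable_add:
  assumes S: "S \<subseteq> L2 M" "\<And>f g. f \<in> S \<Longrightarrow> g \<in> S \<Longrightarrow> (\<lambda>x. f x + g x) \<in> S"
    and "L2_approximable M S u" "L2_approximable M S v"
  shows "L2_approximable M S (\<lambda>x. u x + v x)"
  unfolding L2_approximable_def
proof (intro conjI allI impI)
  note uv = assms(3,4)[unfolded L2_approximable_def]
  show "(\<lambda>x. u x + v x) \<in> L2 M" using uv L2_add by blast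
  fix e :: real assume "e > 0"
  then have e: "e / 2 > 0" by simp
  obtain f where f: "f \<in> S" "L2_norm M (\<lambda>x. f x - u x) < e / 2" using uv(1) e by blast
  obtain g where g: "g \<in> S" "L2_norm M (\<lambda>x. g x - v x) < e / 2" using uv(2) e by blast
  have "L2_norm M (\<lambda>x. (f x - u x) + (g x - v x)) < e"
    using L2_norm_triangle[OF L2_diff L2_diff, of f M u g v] f g S uv by (auto simp: subset_iff)
  then have "L2_norm M (\<lambda>x. (f x + g x) - (u x + v x)) < e" by (simp add: algebra_simps)
  then show "\<exists>h\<in>S. L2_norm M (\<lambda>x. h x - (u x + v x)) < e"
    by (rule bexI[OF _ S(2)[OF f(1) g(1)]])
qed

lemma L2_approximable_scale:
  assumes S: "\<And>f c. f \<in> S \<Longrightarrow> (\<lambda>x. c * f x) \<in> S" and u: "L2_approximable M S u"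
  shows "L2_approximable M S (\<lambda>x. c * u x)"
  unfolding L2_approximable_def
proof (intro conjI allI impI)
  note u = u[unfolded L2_approximable_def]
  show "(\<lambda>x. c * u x) \<in> L2 M" using u L2_scale by blast
  fix e :: real assume "e > 0"
  then have "e / (cmod c + 1) > 0" by (simp add: add_nonneg_pos)
  then obtain f where f: "f \<in> S" "L2_norm M (\<lambda>x. f x - u x) < e / (cmod c + 1)" using u by blast
  have "L2_norm M (\<lambda>x. c * f x - c * u x) = cmod c * L2_norm M (\<lambda>x. f x - u x)"
    using L2_norm_scale[of M c "\<lambda>x. f x - u x"] by (simp add: right_diff_distrib)
  also have "\<dots> \<le> (cmod c + 1) * L2_norm M (\<lambda>x. f x - u x)"
    by (intro mult_right_mono L2_norm_nonneg) simp
  also have "\<dots> < e" using f(2) by (simp add: pos_less_divide_eq add_nonneg_pos mult.commute)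
  finally show "\<exists>h\<in>S. L2_norm M (\<lambda>x. h x - c * u x) < e"
    by (rule bexI[OF _ S[OF f(1)]])
qed

lemma L2_norm_dominated_convergence:
  assumes "u \<in> L2 M" "\<And>n::nat. us n \<in> borel_measurable M" "h \<in> L2 M"
    and "\<And>n x. x \<in> space M \<Longrightarrow> cmod (us n x - u x) \<le> cmod (h x)"
    and "\<And>x. x \<in> space M \<Longrightarrow> (\<lambda>n. us n x) \<longlonglongrightarrow> u x"
  shows "(\<lambda>n. L2_norm M (\<lambda>x. us n x - u x)) \<longlonglongrightarrow> 0"
proof -
  have [measurable]: "u \<in> borel_measurable M" by (rule L2_measurable[OF assms(1)])
  note assms(2)[measurable]
  have "(\<lambda>n. \<integral>x. (cmod (us n x - u x))\<^sup>2 \<partial>M) \<longlonglongrightarrow> (\<integral>x. 0 \<partial>M)"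
  proof (rule integral_dominated_convergence)
    show "integrable M (\<lambda>x. (cmod (h x))\<^sup>2)" by (rule L2_integrable_norm[OF assms(3)])
    show "AE x in M. (\<lambda>n. (cmod (us n x - u x))\<^sup>2) \<longlonglongrightarrow> 0"
    proof (rule AE_I2)
      fix x assume "x \<in> space M"
      from tendsto_power[OF tendsto_norm[OF tendsto_diff[OF assms(5)[OF this] tendsto_const]], of "u x" 2]
      show "(\<lambda>n. (cmod (us n x - u x))\<^sup>2) \<longlonglongrightarrow> 0" by simp
    qed
    show "AE x in M. norm ((cmod (us n x - u x))\<^sup>2) \<le> (cmod (h x))\<^sup>2" for n
      using assms(4) by (auto intro!: power_mono)
  qed simp_all
  from tendsto_real_sqrt[OF this] show ?thesis by (simp add: L2_norm_def)
qed

text \<open>Open sets are stable under intersection and generate the Borel sets, so a Dynkin-system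
  argument extends approximability of indicators from open to Borel sets. Simple functions and
  dominated convergence do the rest.\<close>

lemma L2_approximable_all:
  fixes M :: "'a::topological_space measure"
  assumes fin: "finite_measure M" and sets: "sets M = sets borel"
    and S: "S \<subseteq> L2 M" "\<And>f g. f \<in> S \<Longrightarrow> g \<in> S \<Longrightarrow> (\<lambda>x. f x + g x) \<in> S"
      "\<And>f c. f \<in> S \<Longrightarrow> (\<lambda>x. c * f x) \<in> S" "(\<lambda>x. 1) \<in> S"
    and op: "\<And>T. open T \<Longrightarrow> L2_approximable M S (indicator T)"
    and u: "u \<in> L2 M"
  shows "L2_approximable M S u"
proof -
  interpret finite_measure M by fact
  have sp: "space M = UNIV" using sets_eq_imp_space_eq[OF sets] by simp
  have ind_L2: "indicator B \<in> L2 M" if "B \<in> sets M" for B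
  proof -
    have "(cmod (indicator B x))\<^sup>2 = indicator B x" for x by (simp add: indicator_def)
    then show ?thesis using that by (simp add: L2_def integrable_real_indicator emeasure_finite less_top[symmetric])
  qed
  have zero: "L2_approximable M S (\<lambda>x. 0)"
    using L2_approximable_scale[OF S(3) op[of UNIV], of 0] by simp
  have ind: "L2_approximable M S (indicator B)" if B: "B \<in> sets M" for B
  proof -
    have stable: "Int_stable {T::'a set. open T}" "{T::'a set. open T} \<subseteq> Pow UNIV"
      by (auto simp: Int_stable_def)
    have "B \<in> sigma_sets UNIV {T. open T}" using B sets sets_borel by auto
    then show ?thesis
    proof (induction rule: sigma_sets_induct_disjoint[OF stable,
          consumes 1, case_names basic empty compl union])
      case (basic B)
      then show ?case by (simp add: op)
    next
      case empty
      show ?case using zero by simp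
    next
      case (compl B)
      have "L2_approximable M S (\<lambda>x. indicator UNIV x + (- 1) * indicator B x)"
        by (rule L2_approximable_add[OF S(1,2) op L2_approximable_scale[OF S(3) compl(2)]]) (simp_all add: S)
      moreover have "(\<lambda>x. indicator UNIV x + (- 1) * indicator B x) = (indicator (UNIV - B) :: _ \<Rightarrow> complex)"
        by (auto simp: indicator_def)
      ultimately show ?case by simp
    next
      case (union B)
      have BM: "B n \<in> sets M" for n
        using union(2) sets sets_borel by auto
      \<comment> \<open>Indicators of finite partial unions, which are sums by disjointness. The
        constant 1 is square-integrable and dominates their distance to the limit.\<close>
      define us where "us n = (indicator (\<Union>i<n. B i) :: 'a \<Rightarrow> complex)" for n
      have un: "L2_approximable M S (us n)" for n
      proof (induction n)
        case 0
        show ?case using zero by (simp add: us_def)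
      next
        case (Suc n)
        have "us (Suc n) = (\<lambda>x. us n x + indicator (B n) x)"
        proof
          fix x
          have "B i \<inter> B n = {}" if "i < n" for i
            using union(1) that by (simp add: disjoint_family_on_def)
          then have "(\<Union>i<n. B i) \<inter> B n = {}" by blast
          moreover have "(\<Union>i<Suc n. B i) = (\<Union>i<n. B i) \<union> B n"
            by (auto simp: less_Suc_eq)
          ultimately show "us (Suc n) x = us n x + indicator (B n) x"
            by (auto simp: us_def indicator_def)
        qed
        then show ?case by (simp only: L2_approximable_add[OF S(1,2) Suc union(3)])
      qed
      show ?case
      proof (rule L2_approximable_limit[OF S(1) _ un])
        show uL: "indicator (\<Union> (range B)) \<in> L2 M" using BM by (intro ind_L2) auto
        show "(\<lambda>n. L2_norm M (\<lambda>x. us n x - indicator (\<Union> (range B)) x)) \<longlonglongrightarrow> 0"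
        proof (rule L2_norm_dominated_convergence[OF uL])
          show "us n \<in> borel_measurable M" for n
            using un[of n] by (simp add: L2_approximable_def L2_measurable)
          show "(\<lambda>x. 1) \<in> L2 M" using S by blast
          show "cmod (us n x - indicator (\<Union> (range B)) x) \<le> cmod 1" for n x
            by (auto simp: us_def indicator_def)
          fix x
          show "(\<lambda>n. us n x) \<longlonglongrightarrow> indicator (\<Union> (range B)) x"
          proof (cases "x \<in> \<Union> (range B)")
            case True
            then obtain i where i: "x \<in> B i" by blast
            have "\<forall>\<^sub>F n in sequentially. us n x = 1"
              using eventually_gt_at_top[of i] by eventually_elim (use i in \<open>auto simp: us_def indicator_def\<close>)
            then show ?thesis using True by (simp add: tendsto_eventually)
          next
            case False
            then have "us n x = 0" for n by (auto simp: us_def)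
            then show ?thesis using False by simp
          qed
        qed
      qed
    qed
  qed
  have [measurable]: "u \<in> borel_measurable M" by (rule L2_measurable[OF u])
  obtain F where F: "\<And>i. simple_function M (F i)" "\<And>x. (\<lambda>i. F i x) \<longlonglongrightarrow> u x"
    "\<And>i x. dist (F i x) 0 \<le> 2 * dist (u x) 0"
    using borel_measurable_implies_sequence_metric[of u M 0] by (auto simp: sp)
  have sumA: "L2_approximable M S (\<lambda>x. \<Sum>i\<in>I. c i * indicator (B i) x)"
    if "finite I" "\<And>i. i \<in> I \<Longrightarrow> B i \<in> sets M" for I :: "complex set" and c B
    using that
  proof (induction I rule: finite_induct)
    case empty
    show ?case using zero by simp
  next
    case (insert i I)
    have "L2_approximable M S (\<lambda>x. c i * indicator (B i) x + (\<Sum>i\<in>I. c i * indicator (B i) x))"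
      by (intro L2_approximable_add[OF S(1,2)] L2_approximable_scale[OF S(3)] ind insert) auto
    then show ?case by (simp only: sum.insert[OF insert(1,2)])
  qed
  have Fi: "L2_approximable M S (F i)" for i
  proof -
    have "L2_approximable M S (\<lambda>x. \<Sum>y\<in>range (F i). y * indicator (F i -` {y}) x)"
      using F(1)[of i] by (intro sumA) (auto simp: simple_function_def sp)
    moreover have "(\<Sum>y\<in>range (F i). y * indicator (F i -` {y}) x) = F i x" for x
    proof -
      have "finite (range (F i))" using F(1)[of i] by (simp add: simple_function_def sp)
      then have "(\<Sum>y\<in>range (F i). if y = F i x then y else 0) = F i x"
        by (simp add: sum.delta)
      moreover have "y * indicator (F i -` {y}) x = (if y = F i x then y else 0)" for y
        by (auto simp: indicator_def)
      ultimately show ?thesis by simp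
    qed
    ultimately show ?thesis by simp
  qed
  show ?thesis
  proof (rule L2_approximable_limit[OF S(1) u Fi])
    show "(\<lambda>n. L2_norm M (\<lambda>x. F n x - u x)) \<longlonglongrightarrow> 0"
    proof (rule L2_norm_dominated_convergence[OF u])
      show "F n \<in> borel_measurable M" for n
        using Fi[of n] by (simp add: L2_approximable_def L2_measurable)
      \<comment> \<open>The simple functions are bounded by twice the modulus of \<open>u\<close>,
        hence the error by three times it.\<close>
      show "(\<lambda>x. 3 * u x) \<in> L2 M" by (rule L2_scale[OF u])
      show "cmod (F n x - u x) \<le> cmod (3 * u x)" for n x
        using norm_triangle_ineq4[of "F n x" "u x"] F(3)[of n x] by (simp add: norm_mult)
    qed (rule F(2))
  qed
qed

section \<open>Closed manifolds with a smooth density\<close>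

text \<open>Relative to a single point every bounded linear map is a derivative, so the zero map
  witnesses differentiability; the induction hypothesis covers whichever derivative is
  chosen.\<close>

lemma smooth_on_subset_zero:
  assumes "S \<subseteq> {0}"
  shows "smooth_on S f"
  unfolding smooth_on_def
proof
  fix k
  have S: "S = {} \<or> S = {0}" using assms by blast
  show "times_differentiable_on k S f"
  proof (induction k arbitrary: f)
    case 0
    show ?case using S by auto
  next
    case (Suc k)
    have "f differentiable (at x within S)" if "x \<in> S" for x
      using S that exI[of bounded_linear, OF bounded_linear_zero]
      by (auto simp: differentiable_def has_derivative_within_singleton_iff)
    then show ?case using Suc by simp
  qed
qed

locale smooth_manifold =
  fixes E :: "'e::euclidean_space set" and A :: "('a::t2_space, 'e) chart set" and M :: "'a measure"
  assumes closed_manifold: "closed_manifold E A"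
    and smooth_density: "smooth_density E A M"
begin

lemma sets_M: "sets M = sets borel"
  using smooth_density by (simp add: smooth_density_def)

lemma space_M [simp]: "space M = UNIV"
  using sets_eq_imp_space_eq[OF sets_M] by simp

lemma compact_manifold: "compact (UNIV :: 'a set)"
  using closed_manifold by (simp add: closed_manifold_def)

lemma chart_exists: obtains U \<phi> where "(U, \<phi>) \<in> A" "x \<in> U"
proof -
  have "x \<in> (\<Union>(U, \<phi>)\<in>A. U)"
    using closed_manifold by (simp add: closed_manifold_def smooth_atlas_def)
  then show thesis using that by auto
qed

lemma chart:
  assumes "(U, \<phi>) \<in> A"
  shows "open U" "openin (top_of_set E) (\<phi> ` U)" "continuous_on U \<phi>"
    "continuous_on (\<phi> ` U) (inv_into U \<phi>)"
    and "\<And>x. x \<in> U \<Longrightarrow> inv_into U \<phi> (\<phi> x) = x"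
    and "\<And>y. y \<in> \<phi> ` U \<Longrightarrow> inv_into U \<phi> y \<in> U" "\<And>y. y \<in> \<phi> ` U \<Longrightarrow> \<phi> (inv_into U \<phi> y) = y"
proof -
  have "\<forall>(U, \<phi>)\<in>A. open U \<and> openin (top_of_set E) (\<phi> ` U) \<and>
                 homeomorphism U (\<phi> ` U) \<phi> (inv_into U \<phi>)"
    using closed_manifold by (simp add: closed_manifold_def smooth_atlas_def)
  then have *: "open U" "openin (top_of_set E) (\<phi> ` U)" "homeomorphism U (\<phi> ` U) \<phi> (inv_into U \<phi>)"
    using assms by auto
  show "open U" "openin (top_of_set E) (\<phi> ` U)" by fact+
  show "continuous_on U \<phi>" "continuous_on (\<phi> ` U) (inv_into U \<phi>)"
    using *(3) by (simp_all add: homeomorphism_def)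
  show "inv_into U \<phi> (\<phi> x) = x" if "x \<in> U" for x
    using homeomorphism_apply1[OF *(3) that] .
  show "inv_into U \<phi> y \<in> U" "\<phi> (inv_into U \<phi> y) = y" if "y \<in> \<phi> ` U" for y
    using that by (auto intro: inv_into_into f_inv_into_f)
qed

lemma transition_smooth:
  assumes "(U, \<phi>) \<in> A" "(V, \<psi>) \<in> A"
  shows "smooth_on (\<phi> ` (U \<inter> V)) (\<lambda>y. \<psi> (inv_into U \<phi> y))"
proof -
  have "\<forall>(U, \<phi>)\<in>A. \<forall>(V, \<psi>)\<in>A. smooth_on (\<phi> ` (U \<inter> V)) (\<psi> \<circ> inv_into U \<phi>)"
    using closed_manifold by (simp add: closed_manifold_def smooth_atlas_def)
  then show ?thesis using assms by (fastforce simp: o_def)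
qed

lemma E_cases: "E = UNIV \<or> E = {0}"
  using closed_manifold by (simp add: closed_manifold_def)

lemma chart_image_cases:
  assumes "(U, \<phi>) \<in> A"
  shows "open (\<phi> ` U) \<or> \<phi> ` U \<subseteq> {0}"
  using chart(2)[OF assms] E_cases by (auto simp: openin_subset dest: openin_imp_subset)

lemma chart_image_borel: "(U, \<phi>) \<in> A \<Longrightarrow> \<phi> ` U \<in> sets borel"
  using chart_image_cases[of U \<phi>] subset_singletonD by fastforce

lemma smooth_functionsD:
  "f \<in> smooth_functions A \<Longrightarrow> (U, \<phi>) \<in> A \<Longrightarrow> smooth_on (\<phi> ` U) (\<lambda>y. f (inv_into U \<phi> y))"
  unfolding smooth_functions_def o_def by blast

text \<open>In dimension 0 chart images lie in \<open>{0}\<close>, where smoothness is automatic, so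
  one rule serves both kinds of model space.\<close>

lemma smooth_functionsI:
  assumes "\<And>U \<phi>. (U, \<phi>) \<in> A \<Longrightarrow> open (\<phi> ` U) \<Longrightarrow> smooth_on (\<phi> ` U) (\<lambda>y. f (inv_into U \<phi> y))"
  shows "f \<in> smooth_functions A"
proof -
  have "smooth_on (\<phi> ` U) (f \<circ> inv_into U \<phi>)" if "(U, \<phi>) \<in> A" for U \<phi>
    unfolding o_def using chart_image_cases[OF that] assms[OF that] smooth_on_subset_zero by blast
  then show ?thesis unfolding smooth_functions_def by blast
qed

lemma smooth_functions_const: "(\<lambda>x. c) \<in> smooth_functions A"
  by (rule smooth_functionsI) (rule smooth_on_const)

lemma smooth_functions_add:
  "f \<in> smooth_functions A \<Longrightarrow> g \<in> smooth_functions A \<Longrightarrow> (\<lambda>x. f x + g x) \<in> smooth_functions A"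
  by (rule smooth_functionsI, rule smooth_on_add) (auto intro: smooth_functionsD)

lemma smooth_functions_mult:
  "f \<in> smooth_functions A \<Longrightarrow> g \<in> smooth_functions A \<Longrightarrow> (\<lambda>x. f x * g x) \<in> smooth_functions A"
  by (rule smooth_functionsI, rule smooth_on_mult) (auto intro: smooth_functionsD)

lemma smooth_functions_cnj:
  "f \<in> smooth_functions A \<Longrightarrow> (\<lambda>x. cnj (f x)) \<in> smooth_functions A"
  by (rule smooth_functionsI, rule smooth_on_cnj) (auto intro: smooth_functionsD)

lemma smooth_functions_prod:
  "finite I \<Longrightarrow> (\<And>i. i \<in> I \<Longrightarrow> f i \<in> smooth_functions A)
    \<Longrightarrow> (\<lambda>x. \<Prod>i\<in>I. f i x) \<in> smooth_functions A"
  by (induction I rule: finite_induct) (simp_all add: smooth_functions_const smooth_functions_mult)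

lemma smooth_functions_continuous: "f \<in> smooth_functions A \<Longrightarrow> continuous_on UNIV f"
proof (rule continuous_at_imp_continuous_on, rule ballI)
  fix x :: 'a assume f: "f \<in> smooth_functions A"
  obtain U \<phi> where U: "(U, \<phi>) \<in> A" "x \<in> U" by (rule chart_exists)
  have "continuous_on U (\<lambda>x. f (inv_into U \<phi> (\<phi> x)))"
    by (rule continuous_on_compose2[OF smooth_on_imp_continuous_on[OF smooth_functionsD[OF f U(1)]]
          chart(3)[OF U(1)]]) simp
  then have "continuous_on U f"
    by (rule continuous_on_cong[THEN iffD1, rotated 2]) (simp_all add: chart(5)[OF U(1)])
  then show "isCont f x" using chart(1)[OF U(1)] U(2) by (simp add: continuous_on_eq_continuous_at)
qed

lemma smooth_functions_measurable: "f \<in> smooth_functions A \<Longrightarrow> f \<in> borel_measurable M"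
  using borel_measurable_continuous_onI[OF smooth_functions_continuous]
    measurable_cong_sets[OF sets_M refl] by blast

lemma smooth_functions_bounded: "f \<in> smooth_functions A \<Longrightarrow> \<exists>C. \<forall>x. cmod (f x) \<le> C"
  using compact_imp_bounded[OF compact_continuous_image[OF smooth_functions_continuous compact_manifold]]
  by (auto simp: bounded_iff)

lemma chart_measurable:
  assumes "(U, \<phi>) \<in> A"
  shows "\<phi> \<in> restrict_space M U \<rightarrow>\<^sub>M borel"
proof -
  have "\<phi> \<in> restrict_space borel U \<rightarrow>\<^sub>M borel"
    by (rule borel_measurable_continuous_on_restrict[OF chart(3)[OF assms]])
  moreover have "sets (restrict_space M U) = sets (restrict_space borel U)"
    by (simp add: sets_restrict_space sets_M)
  ultimately show ?thesis using measurable_cong_sets by blast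
qed

lemma chart_domain_measurable: "(U, \<phi>) \<in> A \<Longrightarrow> U \<in> sets M"
  using chart(1) by (simp add: sets_M)

lemma model_sets: "sets (model_measure E) = sets borel"
  by (simp add: model_measure_def)

text \<open>Off the chart image \<open>w\<close> is arbitrary and possibly not measurable. Moving
  the indicator into the real factor yields a Borel function on the whole model space.\<close>

lemma chart_density:
  assumes "(U, \<phi>) \<in> A"
  obtains w :: "'e \<Rightarrow> real" where "smooth_on (\<phi> ` U) w" "\<And>y. y \<in> \<phi> ` U \<Longrightarrow> w y > 0"
    and "distr (restrict_space M U) borel \<phi> =
      density (model_measure E) (\<lambda>y. ennreal (indicator (\<phi> ` U) y * w y))"
    and "(\<lambda>y. indicator (\<phi> ` U) y * w y) \<in> borel_measurable borel"
proof -
  obtain w :: "'e \<Rightarrow> real" where w: "smooth_on (\<phi> ` U) w" "\<forall>y\<in>\<phi> ` U. w y > 0"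
    and d: "distr (restrict_space M U) borel \<phi> =
      density (model_measure E) (\<lambda>y. ennreal (w y) * indicator (\<phi> ` U) y)"
    using smooth_density assms unfolding smooth_density_def by fast
  have "ennreal (w y) * indicator (\<phi> ` U) y = ennreal (indicator (\<phi> ` U) y * w y)" for y
    by (simp add: indicator_def)
  moreover have "(\<lambda>y. indicator (\<phi> ` U) y * w y) \<in> borel_measurable borel"
    using borel_measurable_continuous_on_indicator[OF chart_image_borel[OF assms]
        smooth_on_imp_continuous_on[OF w(1)]] by simp
  ultimately show thesis
    using w(2) d by (intro that[OF w(1)]) (blast, simp_all)
qed

lemma chart_nn_integral:
  assumes U: "(U, \<phi>) \<in> A" and w: "distr (restrict_space M U) borel \<phi> =
      density (model_measure E) (\<lambda>y. ennreal (indicator (\<phi> ` U) y * w y))"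
    "(\<lambda>y. indicator (\<phi> ` U) y * w y) \<in> borel_measurable borel"
    and h: "h \<in> borel_measurable borel"
  shows "(\<integral>\<^sup>+x. h (\<phi> x) * indicator U x \<partial>M)
    = (\<integral>\<^sup>+y. ennreal (indicator (\<phi> ` U) y * w y) * h y \<partial>model_measure E)"
proof -
  have "(\<integral>\<^sup>+x. h (\<phi> x) * indicator U x \<partial>M) = (\<integral>\<^sup>+x. h (\<phi> x) \<partial>restrict_space M U)"
    using chart_domain_measurable[OF U] by (simp add: nn_integral_restrict_space)
  also have "\<dots> = (\<integral>\<^sup>+y. h y \<partial>distr (restrict_space M U) borel \<phi>)"
    using chart_measurable[OF U] h by (simp add: nn_integral_distr)
  also have "\<dots> = (\<integral>\<^sup>+y. ennreal (indicator (\<phi> ` U) y * w y) * h y \<partial>model_measure E)"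
    unfolding w(1)
  proof (rule nn_integral_density)
    show "h \<in> borel_measurable (model_measure E)"
      using h measurable_cong_sets[OF model_sets refl] by blast
    have "(\<lambda>y. ennreal (indicator (\<phi> ` U) y * w y)) \<in> borel_measurable borel"
      using w(2) by measurable
    then show "(\<lambda>y. ennreal (indicator (\<phi> ` U) y * w y)) \<in> borel_measurable (model_measure E)"
      using measurable_cong_sets[OF model_sets refl] by blast
  qed
  finally show ?thesis .
qed

text \<open>Finiteness of the measure has to be derived from the charts. The density is bounded on a
  compact coordinate ball; in dimension 0 a chart image carries at most the mass of the point
  0.\<close>

lemma locally_finite: "\<exists>V. open V \<and> x \<in> V \<and> emeasure M V < \<infinity>"
proof -
  obtain U \<phi> where U: "(U, \<phi>) \<in> A" "x \<in> U" by (rule chart_exists)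
  obtain w where w: "smooth_on (\<phi> ` U) w" "\<And>y. y \<in> \<phi> ` U \<Longrightarrow> w y > 0"
    "distr (restrict_space M U) borel \<phi> =
      density (model_measure E) (\<lambda>y. ennreal (indicator (\<phi> ` U) y * w y))"
    "(\<lambda>y. indicator (\<phi> ` U) y * w y) \<in> borel_measurable borel"
    using chart_density[OF U(1)] by blast
  have le: "emeasure M (U \<inter> \<phi> -` B) \<le> ennreal C * emeasure (model_measure E) B"
    if B: "B \<in> sets borel" and C: "\<And>y. y \<in> B \<inter> \<phi> ` U \<Longrightarrow> w y \<le> C" "0 \<le> C" for B C
  proof -
    have "(\<integral>\<^sup>+x. indicator B (\<phi> x) * indicator U x \<partial>M) = (\<integral>\<^sup>+x. indicator (U \<inter> \<phi> -` B) x \<partial>M)"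
      by (intro nn_integral_cong) (auto simp: indicator_def)
    moreover have "U \<inter> \<phi> -` B \<in> sets M"
      using measurable_sets[OF chart_measurable[OF U(1)] B] chart_domain_measurable[OF U(1)]
      by (auto simp: space_restrict_space sets_restrict_space_iff Int_commute)
    ultimately have "emeasure M (U \<inter> \<phi> -` B) = (\<integral>\<^sup>+x. indicator B (\<phi> x) * indicator U x \<partial>M)"
      by simp
    also have "\<dots> = (\<integral>\<^sup>+y. ennreal (indicator (\<phi> ` U) y * w y) * indicator B y \<partial>model_measure E)"
      using B by (intro chart_nn_integral[OF U(1) w(3,4)]) simp
    also have "\<dots> \<le> (\<integral>\<^sup>+y. ennreal C * indicator B y \<partial>model_measure E)"
      using C by (intro nn_integral_mono) (auto simp: indicator_def intro!: ennreal_leI)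
    also have "\<dots> = ennreal C * emeasure (model_measure E) B"
      using B by (intro nn_integral_cmult_indicator) (simp add: model_sets)
    finally show ?thesis .
  qed
  show ?thesis
  proof (cases "E = UNIV")
    case True
    then have op: "open (\<phi> ` U)" using chart(2)[OF U(1)] by simp
    moreover have "\<phi> x \<in> \<phi> ` U" using U(2) by simp
    ultimately obtain r where r: "r > 0" "cball (\<phi> x) r \<subseteq> \<phi> ` U"
      using open_contains_cball by blast
    have "compact (w ` cball (\<phi> x) r)"
      by (intro compact_continuous_image continuous_on_subset[OF smooth_on_imp_continuous_on[OF w(1)] r(2)])
         simp
    then obtain C where C: "\<forall>y\<in>cball (\<phi> x) r. \<bar>w y\<bar> \<le> C"
      by (auto dest!: compact_imp_bounded simp: bounded_iff simp del: mem_cball)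
    have "\<bar>w (\<phi> x)\<bar> \<le> C" using C r(1) by simp
    then have C0: "0 \<le> C" using abs_ge_zero order_trans by blast
    have Cw: "w y \<le> C" if "y \<in> ball (\<phi> x) r \<inter> \<phi> ` U" for y
      using bspec[OF C, of y] that by auto
    have "emeasure M (U \<inter> \<phi> -` ball (\<phi> x) r) \<le> ennreal C * emeasure lborel (ball (\<phi> x) r)"
      using le[of "ball (\<phi> x) r" C, OF _ Cw C0] True by (simp add: model_measure_def)
    also have "\<dots> < \<infinity>"
      using emeasure_bounded_finite[of "ball (\<phi> x) r"] by (simp add: ennreal_mult_less_top)
    finally have "emeasure M (U \<inter> \<phi> -` ball (\<phi> x) r) < \<infinity>" .
    moreover have "open (U \<inter> \<phi> -` ball (\<phi> x) r)"
      by (rule continuous_open_preimage[OF chart(3)[OF U(1)] chart(1)[OF U(1)] open_ball])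
    ultimately show ?thesis using U(2) r(1) by (intro exI[of _ "U \<inter> \<phi> -` ball (\<phi> x) r"]) simp
  next
    case False
    then have E: "E = {0}" using E_cases by simp
    then have sub: "\<phi> ` U \<subseteq> {0}" using chart(2)[OF U(1)] openin_subset by fastforce
    have "emeasure M (U \<inter> \<phi> -` UNIV) \<le> ennreal \<bar>w 0\<bar> * emeasure (model_measure E) UNIV"
      using sub by (intro le) auto
    also have "\<dots> < \<infinity>"
    proof -
      \<comment> \<open>Makes \<open>model_measure\<close> take its second branch, the counting
        measure on \<open>{0}\<close>.\<close>
      have "{0::'e} \<noteq> UNIV" using UNIV_not_singleton[of 0] by blast
      then have "emeasure (model_measure E) UNIV = 1"
        by (simp add: model_measure_def E emeasure_distr)
      then show ?thesis by simp
    qed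
    finally show ?thesis using U chart(1) by (intro exI[of _ U]) auto
  qed
qed

lemma finite_M: "finite_measure M"
proof -
  obtain V where V: "\<And>x. open (V x)" "\<And>x. x \<in> V x" "\<And>x. emeasure M (V x) < \<infinity>"
    using locally_finite by metis
  have cover: "UNIV \<subseteq> (\<Union>x\<in>UNIV. V x)" using V(2) by blast
  obtain D where D: "D \<subseteq> UNIV" "finite D" "UNIV \<subseteq> (\<Union>x\<in>D. V x)"
    by (rule compactE_image[OF compact_manifold V(1) cover])
  have "emeasure M UNIV \<le> emeasure M (\<Union>x\<in>D. V x)"
    using D(3) V(1) by (intro emeasure_mono) (auto simp: sets_M intro!: borel_open open_UN)
  also have "\<dots> \<le> (\<Sum>x\<in>D. emeasure M (V x))"
    using D(2) V(1) by (intro emeasure_subadditive_finite) (auto simp: sets_M intro!: borel_open)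
  also have "\<dots> < \<infinity>" using V(3) D(2) by (simp add: less_top)
  finally show ?thesis by (intro finite_measureI) (simp add: less_top)
qed

end

section \<open>Functions carried from one chart to the manifold, in positive dimension\<close>

definition extend_chart :: "'a set \<Rightarrow> ('a \<Rightarrow> 'e) \<Rightarrow> ('e \<Rightarrow> 'b::zero) \<Rightarrow> 'a \<Rightarrow> 'b"
  where "extend_chart U \<phi> h x = (if x \<in> U then h (\<phi> x) else 0)"

locale positive_dim_manifold = smooth_manifold E A M
  for E :: "'e::euclidean_space set" and A :: "('a::t2_space, 'e) chart set" and M :: "'a measure" +
  assumes E_UNIV: "E = UNIV"
begin

lemma chart_image_open: "(U, \<phi>) \<in> A \<Longrightarrow> open (\<phi> ` U)"
  using chart(2) E_UNIV by fastforce

text \<open>Compact support makes the extension by zero smooth across the edge of \<open>U\<close>.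
  In another chart, points of \<open>U\<close> are handled by the transition map; any other point
  has a neighbourhood missing the support, which is closed because the manifold is
  Hausdorff.\<close>

lemma extend_chart_smooth:
  fixes h :: "'e \<Rightarrow> complex"
  assumes U: "(U, \<phi>) \<in> A" and h: "smooth_on (\<phi> ` U) h" and K: "compact K" "K \<subseteq> \<phi> ` U"
    and h0: "\<And>y. y \<in> \<phi> ` U \<Longrightarrow> y \<notin> K \<Longrightarrow> h y = 0"
  shows "extend_chart U \<phi> h \<in> smooth_functions A"
proof (rule smooth_functionsI)
  fix V \<psi> assume V: "(V, \<psi>) \<in> A" "open (\<psi> ` V)"
  define C where "C = inv_into U \<phi> ` K"
  have "compact C"
    unfolding C_def by (intro compact_continuous_image continuous_on_subset[OF chart(4)[OF U] K(2)] K(1))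
  then have "closed C" by (rule compact_imp_closed)
  show "smooth_on (\<psi> ` V) (\<lambda>y. extend_chart U \<phi> h (inv_into V \<psi> y))"
  proof (rule smooth_on_local[OF V(2)])
    fix y assume y: "y \<in> \<psi> ` V"
    show "\<exists>T. open T \<and> y \<in> T \<and> smooth_on T (\<lambda>y. extend_chart U \<phi> h (inv_into V \<psi> y))"
    proof (cases "inv_into V \<psi> y \<in> U")
      case True
      define T where "T = \<psi> ` V \<inter> inv_into V \<psi> -` U"
      have T: "open T"
        unfolding T_def by (rule continuous_open_preimage[OF chart(4)[OF V(1)] V(2) chart(1)[OF U]])
      have "T \<subseteq> \<psi> ` (V \<inter> U)"
        unfolding T_def using chart(5)[OF V(1)] by auto
      moreover have "\<psi> ` (V \<inter> U) \<subseteq> T"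
        unfolding T_def using chart(5)[OF V(1)] by auto
      ultimately have T_eq: "T = \<psi> ` (V \<inter> U)" by blast
      have "smooth_on T (\<lambda>y. h (\<phi> (inv_into V \<psi> y)))"
        by (rule smooth_on_compose[OF T chart_image_open[OF U] _ _ h])
           (use transition_smooth[OF V(1) U] in \<open>auto simp: T_eq[symmetric] T_def\<close>)
      then have "smooth_on T (\<lambda>y. extend_chart U \<phi> h (inv_into V \<psi> y))"
        by (rule smooth_on_cong[THEN iffD1, rotated]) (simp add: T_def extend_chart_def)
      then show ?thesis using T y True by (auto simp: T_def)
    next
      case False
      define T where "T = \<psi> ` V \<inter> inv_into V \<psi> -` (- C)"
      have T: "open T"
        unfolding T_def by (rule continuous_open_preimage[OF chart(4)[OF V(1)] V(2)])
          (use \<open>closed C\<close> in auto)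
      have "inv_into V \<psi> y \<notin> C"
        using False K(2) chart(6)[OF U] by (auto simp: C_def)
      then have "y \<in> T" using y by (simp add: T_def)
      moreover have "smooth_on T (\<lambda>y. 0 :: complex)" by (rule smooth_on_const[OF T])
      then have "smooth_on T (\<lambda>y. extend_chart U \<phi> h (inv_into V \<psi> y))"
      proof (rule smooth_on_cong[THEN iffD1, rotated])
        fix z assume "z \<in> T"
        then have z: "inv_into V \<psi> z \<notin> C" by (simp add: T_def)
        show "0 = extend_chart U \<phi> h (inv_into V \<psi> z)"
        proof (cases "inv_into V \<psi> z \<in> U")
          case True
          then have "\<phi> (inv_into V \<psi> z) \<notin> K"
            using z chart(5)[OF U True] unfolding C_def by (metis imageI)
          then show ?thesis using h0 True by (simp add: extend_chart_def)
        qed (simp add: extend_chart_def)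
      qed
      ultimately show ?thesis using T by blast
    qed
  qed
qed

text \<open>The factor 4 leaves room for nested cutoffs: localizing functions live within distance
  \<open>2 * r\<close>, where the cutoff of the mollifier equals 1, and that cutoff vanishes beyond
  \<open>4 * r\<close>.\<close>

lemma chart_ball:
  assumes "open O'" "x \<in> O'"
  obtains U \<phi> r where "(U, \<phi>) \<in> A" "x \<in> U" "0 < r" "cball (\<phi> x) (4 * r) \<subseteq> \<phi> ` (U \<inter> O')"
proof -
  obtain U \<phi> where U: "(U, \<phi>) \<in> A" "x \<in> U" by (rule chart_exists)
  have "open (\<phi> ` U \<inter> inv_into U \<phi> -` O')"
    by (rule continuous_open_preimage[OF chart(4)[OF U(1)] chart_image_open[OF U(1)] assms(1)])
  moreover have "\<phi> x \<in> \<phi> ` U \<inter> inv_into U \<phi> -` O'"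
    using U assms chart(5)[OF U(1)] by simp
  ultimately obtain R where R: "R > 0" "cball (\<phi> x) R \<subseteq> \<phi> ` U \<inter> inv_into U \<phi> -` O'"
    using open_contains_cball by blast
  have "\<phi> ` U \<inter> inv_into U \<phi> -` O' \<subseteq> \<phi> ` (U \<inter> O')"
    using chart(5)[OF U(1)] by auto
  with R have "cball (\<phi> x) (4 * (R / 4)) \<subseteq> \<phi> ` (U \<inter> O')" by auto
  then show thesis using that[OF U, of "R / 4"] R(1) by simp
qed

lemma smooth_on_bump_shift: "open S \<Longrightarrow> smooth_on S (\<lambda>y. bump r (y - c))"
proof -
  assume S: "open S"
  have "smooth_on S (\<lambda>y. y + (- c))"
    by (rule smooth_on_add[OF S smooth_on_linear[OF bounded_linear_ident S] smooth_on_const[OF S]])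
  from smooth_on_compose[OF S open_UNIV _ this smooth_on_bump]
  show ?thesis by simp
qed

lemma smooth_bump_at:
  assumes U: "(U, \<phi>) \<in> A" and r: "0 < r" "cball c (2 * r) \<subseteq> \<phi> ` U"
  shows "extend_chart U \<phi> (\<lambda>y. complex_of_real (bump r (y - c))) \<in> smooth_functions A"
proof (rule extend_chart_smooth[OF U _ _ r(2)])
  show "smooth_on (\<phi> ` U) (\<lambda>y. complex_of_real (bump r (y - c)))"
    by (intro smooth_on_of_real smooth_on_bump_shift chart_image_open[OF U])
  show "complex_of_real (bump r (y - c)) = 0" if "y \<notin> cball c (2 * r)" for y
    using that r(1) bump_eq_0[of r "y - c"] by (simp add: dist_norm norm_minus_commute)
qed simp

text \<open>Bumps at finitely many points of \<open>K\<close> are combined as 1 minus the product of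
  1 minus each. The result is 1 as soon as one bump is 1, is 0 where all of them vanish, and stays
  between 0 and 1.\<close>

lemma smooth_Urysohn:
  assumes K: "compact K" and O': "open O'" "K \<subseteq> O'"
  obtains \<psi> where "\<psi> \<in> smooth_functions A" "\<And>x. x \<in> K \<Longrightarrow> \<psi> x = 1" "\<And>x. x \<notin> O' \<Longrightarrow> \<psi> x = 0"
    "\<And>x. cmod (\<psi> x) \<le> 1"
proof -
  \<comment> \<open>Neighbourhood and bump are packed into one pair, so that a single application of
    choice produces both families.\<close>
  have "\<exists>q. open (fst q) \<and> x \<in> fst q \<and>
      (\<lambda>y. complex_of_real (snd q y)) \<in> smooth_functions A \<and> (\<forall>y\<in>fst q. snd q y = 1) \<and>
      (\<forall>y. y \<notin> O' \<longrightarrow> snd q y = 0) \<and> (\<forall>y. 0 \<le> snd q y \<and> snd q y \<le> 1)" if xK: "x \<in> K" for x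
  proof -
    obtain U \<phi> r where U: "(U, \<phi>) \<in> A" "x \<in> U" and r: "0 < r" "cball (\<phi> x) (4 * r) \<subseteq> \<phi> ` (U \<inter> O')"
      by (rule chart_ball[OF O'(1) subsetD[OF O'(2) xK]])
    have sub: "cball (\<phi> x) (2 * r) \<subseteq> cball (\<phi> x) (4 * r)" using r(1) by auto
    define g where "g = extend_chart U \<phi> (\<lambda>y. bump r (y - \<phi> x))"
    have "(\<lambda>x. complex_of_real (g x)) = extend_chart U \<phi> (\<lambda>y. complex_of_real (bump r (y - \<phi> x)))"
      by (auto simp: g_def extend_chart_def)
    then have g: "(\<lambda>x. complex_of_real (g x)) \<in> smooth_functions A"
      using smooth_bump_at[OF U(1) r(1), of "\<phi> x"] sub r(2) by auto
    have "open (U \<inter> \<phi> -` ball (\<phi> x) r)"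
      by (rule continuous_open_preimage[OF chart(3)[OF U(1)] chart(1)[OF U(1)] open_ball])
    moreover have "\<forall>y\<in>U \<inter> \<phi> -` ball (\<phi> x) r. g y = 1"
      by (auto simp: g_def extend_chart_def dist_norm norm_minus_commute intro!: bump_eq_1)
    moreover have "g y = 0" if "y \<notin> O'" for y
    proof (cases "y \<in> U")
      case True
      have "\<phi> y \<notin> cball (\<phi> x) (4 * r)"
      proof
        assume "\<phi> y \<in> cball (\<phi> x) (4 * r)"
        then obtain y' where "y' \<in> U" "y' \<in> O'" "\<phi> y = \<phi> y'" using r(2) by blast
        then show False using that True chart(5)[OF U(1)] by metis
      qed
      then have "norm (\<phi> y - \<phi> x) \<ge> 2 * r" using r(1) by (simp add: dist_norm norm_minus_commute)
      then show ?thesis using r(1) by (simp add: g_def extend_chart_def bump_eq_0)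
    qed (simp add: g_def extend_chart_def)
    moreover have "0 \<le> g y \<and> g y \<le> 1" for y by (simp add: g_def extend_chart_def bump_bounds)
    ultimately show ?thesis using g U(2) r(1)
      by (intro exI[of _ "(U \<inter> \<phi> -` ball (\<phi> x) r, g)"]) auto
  qed
  then have "\<forall>x\<in>K. \<exists>q. open (fst q) \<and> x \<in> fst q \<and>
      (\<lambda>y. complex_of_real (snd q y)) \<in> smooth_functions A \<and> (\<forall>y\<in>fst q. snd q y = 1) \<and>
      (\<forall>y. y \<notin> O' \<longrightarrow> snd q y = 0) \<and> (\<forall>y. 0 \<le> snd q y \<and> snd q y \<le> 1)"
    by blast
  from bchoice[OF this] obtain q where q: "\<forall>x\<in>K. open (fst (q x)) \<and> x \<in> fst (q x) \<and>
      (\<lambda>y. complex_of_real (snd (q x) y)) \<in> smooth_functions A \<and> (\<forall>y\<in>fst (q x). snd (q x) y = 1) \<and>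
      (\<forall>y. y \<notin> O' \<longrightarrow> snd (q x) y = 0) \<and> (\<forall>y. 0 \<le> snd (q x) y \<and> snd (q x) y \<le> 1)"
    by blast
  define V g where "V x = fst (q x)" and "g x = snd (q x)" for x
  have Vg: "\<And>x. x \<in> K \<Longrightarrow> open (V x)" "\<And>x. x \<in> K \<Longrightarrow> x \<in> V x"
    "\<And>x. x \<in> K \<Longrightarrow> (\<lambda>y. complex_of_real (g x y)) \<in> smooth_functions A"
    "\<And>x y. x \<in> K \<Longrightarrow> y \<in> V x \<Longrightarrow> g x y = 1" "\<And>x y. x \<in> K \<Longrightarrow> y \<notin> O' \<Longrightarrow> g x y = 0"
    "\<And>x y. x \<in> K \<Longrightarrow> 0 \<le> g x y \<and> g x y \<le> 1"
    using q by (auto simp: V_def g_def)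
  have cover: "K \<subseteq> (\<Union>x\<in>K. V x)" using Vg(2) by blast
  obtain D where D: "D \<subseteq> K" "finite D" "K \<subseteq> (\<Union>x\<in>D. V x)"
    by (rule compactE_image[OF K Vg(1) cover])
  define p where "p y = (\<Prod>x\<in>D. 1 - g x y)" for y
  have p: "0 \<le> p y \<and> p y \<le> 1" for y
    unfolding p_def using Vg(6) D(1) by (intro conjI prod_nonneg prod_le_1) auto
  have "(\<lambda>y. 1 + (- 1) * (\<Prod>x\<in>D. 1 + (- 1) * complex_of_real (g x y))) \<in> smooth_functions A"
    using D Vg(3) by (intro smooth_functions_add smooth_functions_mult smooth_functions_const
        smooth_functions_prod) auto
  then have sm: "(\<lambda>y. complex_of_real (1 - p y)) \<in> smooth_functions A"
    by (simp add: p_def)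
  have "p y = 0" if yK: "y \<in> K" for y
  proof -
    obtain x where "x \<in> D" "y \<in> V x" using D(3) yK by blast
    then have "x \<in> D \<and> 1 - g x y = 0" using Vg(4) D(1) by auto
    then show ?thesis unfolding p_def using D(2) by (auto simp: prod_zero_iff)
  qed
  moreover have "p y = 1" if "y \<notin> O'" for y
    unfolding p_def using Vg(5) D(1) that by (intro prod.neutral) auto
  ultimately show thesis
    by (intro that[OF sm]) (use p in \<open>auto simp del: of_real_diff\<close>)
qed

text \<open>The point type is only a Hausdorff space, so the exhaustion is built in coordinates and
  carried back; compactness leaves finitely many charts. Eventual membership of each point is the
  form that dominated convergence consumes.\<close>

lemma open_sigma_compact:
  assumes "open O'"
  obtains K :: "nat \<Rightarrow> 'a set" where "\<And>n. compact (K n)" "\<And>n. K n \<subseteq> O'"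
    "\<And>x. x \<in> O' \<Longrightarrow> \<forall>\<^sub>F n in sequentially. x \<in> K n"
proof -
  have "\<exists>q. q \<in> A \<and> x \<in> fst q" for x
    by (rule chart_exists[of x]) (metis fst_conv)
  then obtain c where c: "\<And>x. c x \<in> A" "\<And>x. x \<in> fst (c x)"
    by metis
  have op: "open (fst (c x))" for x
    using c(1)[of x] chart(1)[of "fst (c x)" "snd (c x)"] by simp
  have cover: "UNIV \<subseteq> (\<Union>x\<in>UNIV. fst (c x))" using c(2) by blast
  obtain D where D: "D \<subseteq> UNIV" "finite D" "UNIV \<subseteq> (\<Union>x\<in>D. fst (c x))"
    by (rule compactE_image[OF compact_manifold op cover])
  define F where "F = c ` D"
  have F: "finite F" "F \<subseteq> A" "\<And>x. \<exists>(U, \<phi>)\<in>F. x \<in> U"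
    using D c by (auto simp: F_def split_beta)
  have charts: "\<exists>C. (\<forall>n::nat. compact (C n)) \<and> (\<forall>n. C n \<subseteq> \<phi> ` U \<inter> inv_into U \<phi> -` O') \<and>
      (\<forall>y\<in>\<phi> ` U \<inter> inv_into U \<phi> -` O'. \<forall>\<^sub>F n in sequentially. y \<in> C n)" if U: "(U, \<phi>) \<in> A" for U \<phi>
  proof -
    have "open (\<phi> ` U \<inter> inv_into U \<phi> -` O')"
      by (rule continuous_open_preimage[OF chart(4)[OF U] chart_image_open[OF U] assms])
    then obtain C where
      C: "\<And>n. compact (C n)" "\<And>n. C n \<subseteq> \<phi> ` U \<inter> inv_into U \<phi> -` O'"
        "\<And>n. C n \<subseteq> interior (C (Suc n))" "\<Union> (range C) = \<phi> ` U \<inter> inv_into U \<phi> -` O'"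
        "\<And>K. \<lbrakk>compact K; K \<subseteq> \<phi> ` U \<inter> inv_into U \<phi> -` O'\<rbrakk> \<Longrightarrow> \<exists>N. \<forall>n\<ge>N. K \<subseteq> C n"
      by (rule open_Union_compact_subsets) blast
    have "\<forall>\<^sub>F n in sequentially. y \<in> C n" if "y \<in> \<phi> ` U \<inter> inv_into U \<phi> -` O'" for y
      using C(5)[of "{y}"] that by (auto simp: eventually_sequentially)
    then show ?thesis using C(1,2) by blast
  qed
  have "\<forall>q\<in>F. \<exists>C. (\<forall>n::nat. compact (C n)) \<and>
      (\<forall>n. C n \<subseteq> snd q ` fst q \<inter> inv_into (fst q) (snd q) -` O') \<and>
      (\<forall>y\<in>snd q ` fst q \<inter> inv_into (fst q) (snd q) -` O'. \<forall>\<^sub>F n in sequentially. y \<in> C n)"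
  proof
    fix q assume "q \<in> F"
    then have "(fst q, snd q) \<in> A" using F(2) by auto
    then show "\<exists>C. (\<forall>n::nat. compact (C n)) \<and>
      (\<forall>n. C n \<subseteq> snd q ` fst q \<inter> inv_into (fst q) (snd q) -` O') \<and>
      (\<forall>y\<in>snd q ` fst q \<inter> inv_into (fst q) (snd q) -` O'. \<forall>\<^sub>F n in sequentially. y \<in> C n)"
      by (rule charts)
  qed
  from bchoice[OF this] obtain C where C0: "\<forall>q\<in>F. (\<forall>n::nat. compact (C q n)) \<and>
      (\<forall>n. C q n \<subseteq> snd q ` fst q \<inter> inv_into (fst q) (snd q) -` O') \<and>
      (\<forall>y\<in>snd q ` fst q \<inter> inv_into (fst q) (snd q) -` O'. \<forall>\<^sub>F n in sequentially. y \<in> C q n)"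
    by blast
  have C: "compact (C q n)" "C q n \<subseteq> snd q ` fst q \<inter> inv_into (fst q) (snd q) -` O'"
    "y \<in> snd q ` fst q \<inter> inv_into (fst q) (snd q) -` O' \<Longrightarrow> \<forall>\<^sub>F n in sequentially. y \<in> C q n"
    if "q \<in> F" for q n y
    using bspec[OF C0 that] by blast+
  define K where "K n = (\<Union>q\<in>F. inv_into (fst q) (snd q) ` C q n)" for n
  show thesis
  proof (rule that)
    show "compact (K n)" for n
      unfolding K_def
    proof (intro compact_UN F(1) compact_continuous_image C(1))
      fix q assume q: "q \<in> F"
      then have "(fst q, snd q) \<in> A" using F(2) by auto
      from chart(4)[OF this] show "continuous_on (C q n) (inv_into (fst q) (snd q))"
        by (rule continuous_on_subset) (use C(2)[OF q] in blast)
    qed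
    show "K n \<subseteq> O'" for n
      unfolding K_def using C(2) by fast
    fix x assume x: "x \<in> O'"
    obtain U \<phi> where q: "(U, \<phi>) \<in> F" "x \<in> U" using F(3)[of x] by blast
    then have U: "(U, \<phi>) \<in> A" using F(2) by blast
    have "\<forall>\<^sub>F n in sequentially. \<phi> x \<in> C (U, \<phi>) n"
      using C(3)[OF q(1), of "\<phi> x"] q(2) x chart(5)[OF U] by simp
    then show "\<forall>\<^sub>F n in sequentially. x \<in> K n"
    proof eventually_elim
      case (elim n)
      then have "inv_into U \<phi> (\<phi> x) \<in> inv_into (fst (U, \<phi>)) (snd (U, \<phi>)) ` C (U, \<phi>) n" by simp
      then have "x \<in> inv_into (fst (U, \<phi>)) (snd (U, \<phi>)) ` C (U, \<phi>) n"
        using chart(5)[OF U q(2)] by simp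
      then show ?case unfolding K_def using q(1) by blast
    qed
  qed
qed

lemma smooth_functions_L2: "f \<in> smooth_functions A \<Longrightarrow> f \<in> L2 M"
proof -
  assume f: "f \<in> smooth_functions A"
  interpret finite_measure M by (rule finite_M)
  obtain C where "\<And>x. cmod (f x) \<le> C" using smooth_functions_bounded[OF f] by blast
  moreover have "(\<lambda>x. 1) \<in> L2 M" by (simp add: L2_def)
  ultimately show ?thesis
    using L2_bounded_mult(1)[of "\<lambda>x. 1" M f C] smooth_functions_measurable[OF f] by simp
qed

text \<open>By the density criterion indicators of open sets have to be approximated. They are
  pointwise limits of Urysohn functions for an exhaustion by compact sets, with error dominated by
  the constant 2.\<close>

lemma smooth_functions_dense:
  assumes "u \<in> L2 M" "0 < e"
  shows "\<exists>g\<in>smooth_functions A. L2_norm M (\<lambda>x. g x - u x) < e"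
proof -
  have S: "smooth_functions A \<subseteq> L2 M" using smooth_functions_L2 by blast
  have "L2_approximable M (smooth_functions A) u"
  proof (rule L2_approximable_all[OF finite_M sets_M S])
    fix T :: "'a set" assume T: "open T"
    obtain K where K: "\<And>n::nat. compact (K n)" "\<And>n. K n \<subseteq> T"
      "\<And>x. x \<in> T \<Longrightarrow> \<forall>\<^sub>F n in sequentially. x \<in> K n"
      using open_sigma_compact[OF T] by blast
    have "\<exists>\<psi>. \<psi> \<in> smooth_functions A \<and> (\<forall>x\<in>K n. \<psi> x = 1) \<and> (\<forall>x. x \<notin> T \<longrightarrow> \<psi> x = 0) \<and>
        (\<forall>x. cmod (\<psi> x) \<le> 1)" for n
      using smooth_Urysohn[OF K(1) T K(2)] by metis
    then obtain \<psi> where \<psi>: "\<And>n. \<psi> n \<in> smooth_functions A" "\<And>n x. x \<in> K n \<Longrightarrow> \<psi> n x = 1"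
      "\<And>n x. x \<notin> T \<Longrightarrow> \<psi> n x = 0" "\<And>n x. cmod (\<psi> n x) \<le> 1"
      by metis
    have ind: "indicator T \<in> L2 M"
    proof -
      interpret finite_measure M by (rule finite_M)
      have "(\<lambda>x. 1) \<in> L2 M" by (simp add: L2_def)
      then show ?thesis
        by (rule L2_dominated(1)[where C = 1]) (use T in \<open>auto simp: sets_M indicator_def intro!: borel_measurable_indicator\<close>)
    qed
    show "L2_approximable M (smooth_functions A) (indicator T)"
    proof (rule L2_approximable_limit[OF S ind])
      show "L2_approximable M (smooth_functions A) (\<psi> n)" for n
        unfolding L2_approximable_def
        using \<psi>(1)[of n] S by (auto intro!: bexI[of _ "\<psi> n"] simp: L2_norm_def)
      show "(\<lambda>n. L2_norm M (\<lambda>x. \<psi> n x - indicator T x)) \<longlonglongrightarrow> 0"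
      proof (rule L2_norm_dominated_convergence[OF ind])
        show "\<psi> n \<in> borel_measurable M" for n by (rule smooth_functions_measurable[OF \<psi>(1)])
        show "(\<lambda>x. 2) \<in> L2 M" by (rule smooth_functions_L2[OF smooth_functions_const])
        show "cmod (\<psi> n x - indicator T x) \<le> cmod 2" for n x
          using norm_triangle_ineq4[of "\<psi> n x" "indicator T x"] \<psi>(4)[of n x]
          by (auto simp: indicator_def split: if_splits)
        fix x
        show "(\<lambda>n. \<psi> n x) \<longlonglongrightarrow> indicator T x"
        proof (cases "x \<in> T")
          case True
          have "\<forall>\<^sub>F n in sequentially. \<psi> n x = 1"
            using K(3)[OF True] by eventually_elim (rule \<psi>(2))
          then show ?thesis using True by (simp add: tendsto_eventually)
        next
          case False
          then show ?thesis using \<psi>(3) by simp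
        qed
      qed
    qed
  qed (use assms smooth_functions_add smooth_functions_mult[OF smooth_functions_const]
      smooth_functions_const in auto)
  then show ?thesis using assms(2) by (simp add: L2_approximable_def)
qed

end

section \<open>First-order operators on a closed manifold\<close>

locale manifold_operator = smooth_manifold E A M
  for E :: "'e::euclidean_space set" and A :: "('a::t2_space, 'e) chart set" and M :: "'a measure" +
  fixes P :: "('a \<Rightarrow> complex) \<Rightarrow> 'a \<Rightarrow> complex"
  assumes differential_operator: "differential_operator1 E A P"
    and symmetric_P: "symmetric_operator A M P"
begin

lemma operator_coefficients:
  assumes "(U, \<phi>) \<in> A"
  obtains a :: "'e \<Rightarrow> 'e \<Rightarrow> complex" and b :: "'e \<Rightarrow> complex" where
    "\<And>i. i \<in> Basis \<inter> E \<Longrightarrow> smooth_on (\<phi> ` U) (a i)" "smooth_on (\<phi> ` U) b"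
    "\<And>f x. f \<in> smooth_functions A \<Longrightarrow> x \<in> U \<Longrightarrow> P f x =
      (\<Sum>i\<in>Basis \<inter> E. a i (\<phi> x) *
        frechet_derivative (\<lambda>y. f (inv_into U \<phi> y)) (at (\<phi> x) within \<phi> ` U) i) + b (\<phi> x) * f x"
proof -
  have "\<exists>(a :: 'e \<Rightarrow> 'e \<Rightarrow> complex) (b :: 'e \<Rightarrow> complex).
       (\<forall>i\<in>Basis \<inter> E. smooth_on (\<phi> ` U) (a i)) \<and> smooth_on (\<phi> ` U) b \<and>
       (\<forall>f\<in>smooth_functions A. \<forall>x\<in>U.
          P f x =
            (\<Sum>i\<in>Basis \<inter> E. a i (\<phi> x) *
               frechet_derivative (f \<circ> inv_into U \<phi>) (at (\<phi> x) within \<phi> ` U) i)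
            + b (\<phi> x) * f x)"
    using differential_operator assms unfolding differential_operator1_def by fast
  then show thesis
    using that unfolding o_def by blast
qed

lemma Basis_Int_zero: "E = {0} \<Longrightarrow> Basis \<inter> E = {}"
  using nonzero_Basis by auto

text \<open>At a fixed point \<open>P\<close> is a derivation plus a multiple of evaluation. This
  form yields additivity and the Leibniz rule in all dimensions at once; in dimension 0 the
  derivation is an empty sum.\<close>

lemma local_form:
  obtains L :: "('a \<Rightarrow> complex) \<Rightarrow> complex" and b :: complex where
    "\<And>f. f \<in> smooth_functions A \<Longrightarrow> P f x = L f + b * f x"
    "\<And>f g. f \<in> smooth_functions A \<Longrightarrow> g \<in> smooth_functions A \<Longrightarrow> L (\<lambda>y. f y + g y) = L f + L g"
    "\<And>f g. f \<in> smooth_functions A \<Longrightarrow> g \<in> smooth_functions A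
      \<Longrightarrow> L (\<lambda>y. f y * g y) = f x * L g + g x * L f"
    "\<And>c. L (\<lambda>y. c) = 0"
proof -
  obtain U \<phi> where U: "(U, \<phi>) \<in> A" "x \<in> U" by (rule chart_exists)
  obtain a :: "'e \<Rightarrow> 'e \<Rightarrow> complex" and b :: "'e \<Rightarrow> complex" where ab:
    "\<And>i. i \<in> Basis \<inter> E \<Longrightarrow> smooth_on (\<phi> ` U) (a i)" "smooth_on (\<phi> ` U) b"
    "\<And>f x. f \<in> smooth_functions A \<Longrightarrow> x \<in> U \<Longrightarrow> P f x =
      (\<Sum>i\<in>Basis \<inter> E. a i (\<phi> x) *
        frechet_derivative (\<lambda>y. f (inv_into U \<phi> y)) (at (\<phi> x) within \<phi> ` U) i) + b (\<phi> x) * f x"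
    by (rule operator_coefficients[OF U(1)]) blast
  define D where "D f = frechet_derivative (\<lambda>y. f (inv_into U \<phi> y)) (at (\<phi> x) within \<phi> ` U)"
    for f :: "'a \<Rightarrow> complex"
  define L where "L f = (\<Sum>i\<in>Basis \<inter> E. a i (\<phi> x) * D f i)" for f
  show thesis
  proof (cases "E = {0}")
    case True
    then have L0: "L f = 0" for f by (simp add: L_def Basis_Int_zero)
    then show thesis
      using ab(3)[OF _ U(2)] by (intro that[of L "b (\<phi> x)"]) (simp_all add: L_def D_def)
  next
    case False
    then have "E = UNIV" using E_cases by blast
    then have op: "open (\<phi> ` U)" using chart(2)[OF U(1)] by simp
    have y: "\<phi> x \<in> \<phi> ` U" using U(2) by simp
    have inv: "inv_into U \<phi> (\<phi> x) = x" by (rule chart(5)[OF U])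
    have D_eq: "D f = frechet_derivative (\<lambda>y. f (inv_into U \<phi> y)) (at (\<phi> x))" for f
      by (simp add: D_def at_within_open[OF y op])
    have der: "((\<lambda>y. f (inv_into U \<phi> y)) has_derivative D f) (at (\<phi> x))"
      if "f \<in> smooth_functions A" for f
      unfolding D_eq by (rule smooth_on_has_derivative[OF smooth_functionsD[OF that U(1)] op y])
    have D_unique: "D f = F" if "((\<lambda>y. f (inv_into U \<phi> y)) has_derivative F) (at (\<phi> x))" for f F
      unfolding D_eq by (rule frechet_derivative_at[OF that, symmetric])
    have Dadd: "D (\<lambda>y. f y + g y) i = D f i + D g i"
      if "f \<in> smooth_functions A" "g \<in> smooth_functions A" for f g i
      using D_unique[OF has_derivative_add[OF der[OF that(1)] der[OF that(2)]]] by simp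
    have Dmult: "D (\<lambda>y. f y * g y) i = f x * D g i + D f i * g x"
      if "f \<in> smooth_functions A" "g \<in> smooth_functions A" for f g i
      using D_unique[OF has_derivative_mult[OF der[OF that(1)] der[OF that(2)]]] by (simp add: inv)
    have Dconst: "D (\<lambda>y. c) i = 0" for c i
      using D_unique[of "\<lambda>y. c", OF has_derivative_const] by simp
    show thesis
    proof (rule that[of L "b (\<phi> x)"])
      show "P f x = L f + b (\<phi> x) * f x" if "f \<in> smooth_functions A" for f
        using ab(3)[OF that U(2)] by (simp add: L_def D_def)
      show "L (\<lambda>y. f y + g y) = L f + L g"
        if "f \<in> smooth_functions A" "g \<in> smooth_functions A" for f g
        by (simp add: L_def Dadd[OF that] distrib_left sum.distrib)
      show "L (\<lambda>y. f y * g y) = f x * L g + g x * L f"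
        if "f \<in> smooth_functions A" "g \<in> smooth_functions A" for f g
        by (simp add: L_def Dmult[OF that] distrib_left sum.distrib sum_distrib_left mult_ac)
      show "L (\<lambda>y. c) = 0" for c by (simp add: L_def Dconst)
    qed
  qed
qed

lemma all_smooth_if_zero_dim: "E = {0} \<Longrightarrow> f \<in> smooth_functions A"
proof -
  assume E: "E = {0}"
  have "smooth_on (\<phi> ` U) (f \<circ> inv_into U \<phi>)" if "(U, \<phi>) \<in> A" for U \<phi>
    using openin_subset[OF chart(2)[OF that]] E by (intro smooth_on_subset_zero) simp
  then show "f \<in> smooth_functions A" unfolding smooth_functions_def by blast
qed

lemma P_smooth_functions:
  assumes f: "f \<in> smooth_functions A"
  shows "P f \<in> smooth_functions A"
proof (cases "E = {0}")
  case True
  then show ?thesis by (rule all_smooth_if_zero_dim)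
next
  case False
  then have E: "E = UNIV" using E_cases by blast
  show ?thesis
  proof (rule smooth_functionsI)
    fix U \<phi> assume U: "(U, \<phi>) \<in> A" "open (\<phi> ` U)"
    obtain a :: "'e \<Rightarrow> 'e \<Rightarrow> complex" and b :: "'e \<Rightarrow> complex" where ab:
      "\<And>i. i \<in> Basis \<inter> E \<Longrightarrow> smooth_on (\<phi> ` U) (a i)" "smooth_on (\<phi> ` U) b"
      "\<And>f x. f \<in> smooth_functions A \<Longrightarrow> x \<in> U \<Longrightarrow> P f x =
        (\<Sum>i\<in>Basis \<inter> E. a i (\<phi> x) *
          frechet_derivative (\<lambda>y. f (inv_into U \<phi> y)) (at (\<phi> x) within \<phi> ` U) i) + b (\<phi> x) * f x"
      by (rule operator_coefficients[OF U(1)]) blast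
    let ?f = "\<lambda>y. f (inv_into U \<phi> y)"
    have fs: "smooth_on (\<phi> ` U) ?f" by (rule smooth_functionsD[OF f U(1)])
    have "smooth_on (\<phi> ` U) (\<lambda>y. (\<Sum>i\<in>Basis. a i y * frechet_derivative ?f (at y) i) + b y * ?f y)"
      by (rule smooth_on_add[OF U(2) smooth_on_sum[OF U(2)] smooth_on_mult[OF U(2) ab(2) fs]],
          rule smooth_on_mult[OF U(2) _ smooth_on_frechet_derivative[OF fs U(2)]])
         (use ab(1) E in auto)
    then show "smooth_on (\<phi> ` U) (\<lambda>y. P f (inv_into U \<phi> y))"
    proof (rule smooth_on_cong[THEN iffD1, rotated])
      fix y assume y: "y \<in> \<phi> ` U"
      show "(\<Sum>i\<in>Basis. a i y * frechet_derivative ?f (at y) i) + b y * ?f y = P f (inv_into U \<phi> y)"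
        using ab(3)[OF f chart(6)[OF U(1) y]] E
        by (simp add: chart(7)[OF U(1) y] at_within_open[OF y U(2)])
    qed
  qed
qed

text \<open>Density of the smooth functions stays a hypothesis because it is trivial in dimension 0
  and comes from cutoffs otherwise.\<close>

lemma symmetric_first_orderI:
  assumes "\<And>u e. u \<in> L2 M \<Longrightarrow> 0 < e \<Longrightarrow>
    \<exists>g\<in>smooth_functions A. L2_norm M (\<lambda>x. g x - u x) < e"
  shows "symmetric_first_order A M P"
proof (rule symmetric_first_order.intro)
  show "finite_measure M" by (rule finite_M)
  show "f \<in> borel_measurable M" if "f \<in> smooth_functions A" for f
    by (rule smooth_functions_measurable[OF that])
  show "\<exists>C. \<forall>x. cmod (f x) \<le> C" if "f \<in> smooth_functions A" for f
    by (rule smooth_functions_bounded[OF that])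
  show "P (\<lambda>_. c) x = c * P (\<lambda>_. 1) x" for c x
    by (rule local_form[of x]) (simp add: smooth_functions_const)
  show "P (\<lambda>x. f x + g x) x = P f x + P g x"
    if "f \<in> smooth_functions A" "g \<in> smooth_functions A" for f g x
    by (rule local_form[of x]) (simp add: smooth_functions_add that algebra_simps)
  show "P (\<lambda>x. f x * g x) x = f x * P g x + g x * P f x - f x * g x * P (\<lambda>_. 1) x"
    if "f \<in> smooth_functions A" "g \<in> smooth_functions A" for f g x
    by (rule local_form[of x])
       (simp add: smooth_functions_mult smooth_functions_const that algebra_simps)
qed (use assms smooth_functions_const smooth_functions_add smooth_functions_mult
    smooth_functions_cnj P_smooth_functions symmetric_P in auto)

lemma essentially_self_adjoint_zero_dim:
  assumes "E = {0}"
  shows "essentially_self_adjoint A M P"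
proof -
  interpret symmetric_first_order A M P
  proof (rule symmetric_first_orderI)
    fix u :: "'a \<Rightarrow> complex" and e :: real assume "0 < e"
    then show "\<exists>g\<in>smooth_functions A. L2_norm M (\<lambda>x. g x - u x) < e"
      by (intro bexI[of _ u] all_smooth_if_zero_dim[OF assms]) (simp add: L2_norm_def)
  qed
  have "adjoint_graph A M P \<subseteq> L2_closure M (operator_graph A P)"
    using adjoint_smooth_in_closure all_smooth_if_zero_dim[OF assms] by auto
  then show ?thesis
    using closure_subset_adjoint by (auto simp: essentially_self_adjoint_def)
qed

end

section \<open>Smoothing by integral kernels\<close>

text \<open>The library's \<open>integral_norm_bound_integral\<close> is restricted to Euclidean domains.\<close>

lemma norm_integral_le:
  fixes f :: "'a \<Rightarrow> 'b::{banach, second_countable_topology}"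
  assumes "integrable M f" "integrable M g" "\<And>x. x \<in> space M \<Longrightarrow> norm (f x) \<le> g x"
  shows "norm (\<integral>x. f x \<partial>M) \<le> (\<integral>x. g x \<partial>M)"
  using integral_norm_bound[of M f] integral_mono[OF integrable_norm[OF assms(1)] assms(2,3)]
  by (rule order_trans)

lemma linear_norm_bound:
  fixes T :: "'e::euclidean_space \<Rightarrow> 'b::real_normed_vector"
  assumes "linear T"
  shows "norm (T v) \<le> (\<Sum>i\<in>Basis. norm (T i)) * norm v"
proof -
  have "T v = (\<Sum>i\<in>Basis. (v \<bullet> i) *\<^sub>R T i)"
    using linear_sum[OF assms, of "\<lambda>i. (v \<bullet> i) *\<^sub>R i" Basis]
    by (simp add: euclidean_representation linear_scale[OF assms])
  also have "norm \<dots> \<le> (\<Sum>i\<in>Basis. norm ((v \<bullet> i) *\<^sub>R T i))" by (rule norm_sum)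
  also have "\<dots> \<le> (\<Sum>i\<in>Basis. norm v * norm (T i))"
    by (intro sum_mono) (auto intro!: mult_right_mono Basis_le_norm)
  also have "\<dots> = (\<Sum>i\<in>Basis. norm (T i)) * norm v"
    by (simp add: sum_distrib_left[symmetric] mult.commute)
  finally show ?thesis .
qed

lemmas linear_functional_bound = linear_norm_bound[where 'b = real, unfolded real_norm_def]

text \<open>The class is stable under directional derivatives with the same \<open>R\<close>, so
  every bound proved for a test function applies to its derivatives, with other constants.\<close>

locale test_function =
  fixes h :: "'e::euclidean_space \<Rightarrow> real" and R :: real
  assumes smooth: "smooth_on UNIV h" and support: "R < norm x \<Longrightarrow> h x = 0"
begin

lemma has_derivative: "(h has_derivative frechet_derivative h (at x)) (at x)"
  by (rule smooth_on_has_derivative[OF smooth]) auto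

lemma derivative_test_function: "test_function (\<lambda>x. frechet_derivative h (at x) v) R"
proof
  show "smooth_on UNIV (\<lambda>x. frechet_derivative h (at x) v)"
    by (rule smooth_on_frechet_derivative[OF smooth open_UNIV])
  fix x :: 'e assume x: "R < norm x"
  have "open {x::'e. R < norm x}" by (intro open_Collect_less continuous_intros)
  then have "(h has_derivative (\<lambda>v. 0)) (at x)"
    by (rule has_derivative_transform_within_open[OF has_derivative_const]) (use x support in auto)
  from frechet_derivative_at[OF this] show "frechet_derivative h (at x) v = 0" by metis
qed

lemma bounded: obtains C where "0 < C" "\<And>x. \<bar>h x\<bar> \<le> C"
proof -
  have "compact (h ` cball 0 R)"
    by (intro compact_continuous_image[OF continuous_on_subset[OF smooth_on_imp_continuous_on[OF smooth]]])
       auto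
  then obtain C where C: "C > 0" "\<forall>x\<in>cball 0 R. \<bar>h x\<bar> \<le> C"
    by (auto dest!: compact_imp_bounded simp: bounded_pos simp del: mem_cball)
  have "\<bar>h x\<bar> \<le> C" for x
    using C support[of x] by (cases "norm x \<le> R") auto
  with C(1) show thesis by (rule that)
qed

lemma derivative_bounded:
  obtains C where "0 < C" "\<And>x v. \<bar>frechet_derivative h (at x) v\<bar> \<le> C * norm v"
proof -
  have "\<exists>C. 0 < C \<and> (\<forall>x. \<bar>frechet_derivative h (at x) i\<bar> \<le> C)" for i
    using test_function.bounded[OF derivative_test_function[of i]] by metis
  then obtain C where C: "\<And>i. 0 < C i" "\<And>i x. \<bar>frechet_derivative h (at x) i\<bar> \<le> C i"
    by metis
  have "\<bar>frechet_derivative h (at x) v\<bar> \<le> (\<Sum>i\<in>Basis. C i) * norm v" for x v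
  proof -
    have "\<bar>frechet_derivative h (at x) v\<bar> \<le> (\<Sum>i\<in>Basis. \<bar>frechet_derivative h (at x) i\<bar>) * norm v"
      by (rule linear_functional_bound[OF has_derivative_linear[OF has_derivative]])
    also have "\<dots> \<le> (\<Sum>i\<in>Basis. C i) * norm v"
      by (intro mult_right_mono sum_mono C) auto
    finally show ?thesis .
  qed
  moreover have "0 < (\<Sum>i\<in>Basis. C i)" by (intro sum_pos C) auto
  ultimately show thesis using that by blast
qed

lemma lipschitz: obtains C where "0 < C" "\<And>x y. \<bar>h x - h y\<bar> \<le> C * norm (x - y)"
proof -
  obtain C where C: "0 < C" "\<And>x v. \<bar>frechet_derivative h (at x) v\<bar> \<le> C * norm v"
    by (rule derivative_bounded) blast
  have "norm (h x - h y) \<le> C * norm (x - y)" for x y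
  proof (rule differentiable_bound[OF convex_UNIV])
    show "(h has_derivative frechet_derivative h (at x)) (at x)" for x by (rule has_derivative)
    show "onorm (frechet_derivative h (at x)) \<le> C" for x
      using C by (intro onorm_le) simp
  qed auto
  with C(1) that show thesis by auto
qed

text \<open>Directional derivatives are test functions and hence Lipschitz, so the linearization
  error is quadratic with a constant uniform in \<open>x\<close>. Uniformity is what allows the
  remainder to be integrated.\<close>

lemma second_order_remainder:
  obtains C where "0 < C"
    "\<And>x d. \<bar>h (x + d) - h x - frechet_derivative h (at x) d\<bar> \<le> C * (norm d)\<^sup>2"
proof -
  have "\<exists>C. 0 < C \<and> (\<forall>x y. \<bar>frechet_derivative h (at x) i - frechet_derivative h (at y) i\<bar> \<le> C * norm (x - y))" for i
    using test_function.lipschitz[OF derivative_test_function[of i]] by metis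
  then obtain C where C: "\<And>i. 0 < C i"
    "\<And>i x y. \<bar>frechet_derivative h (at x) i - frechet_derivative h (at y) i\<bar> \<le> C i * norm (x - y)"
    by metis
  have C0: "0 < (\<Sum>i\<in>Basis. C i)" by (intro sum_pos C) auto
  have "\<bar>h (x + d) - h x - frechet_derivative h (at x) d\<bar> \<le> (\<Sum>i\<in>Basis. C i) * (norm d)\<^sup>2" for x d
  proof -
    have "norm (h (x + d) - h x - frechet_derivative h (at x) ((x + d) - x))
        \<le> norm ((x + d) - x) * ((\<Sum>i\<in>Basis. C i) * norm d)"
    proof (rule differentiable_bound_linearization[where S = "cball x (norm d)"])
      show "x + t *\<^sub>R (x + d - x) \<in> cball x (norm d)" if "t \<in> {0..1}" for t
        using that by (auto simp: dist_norm intro!: mult_left_le_one_le)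
      show "(h has_derivative frechet_derivative h (at y)) (at y within cball x (norm d))" for y
        by (rule has_derivative_at_withinI[OF has_derivative])
      show "onorm (frechet_derivative h (at y) - frechet_derivative h (at x))
          \<le> (\<Sum>i\<in>Basis. C i) * norm d" if "y \<in> cball x (norm d)" for y
      proof (rule onorm_le)
        fix v
        have lin: "linear (frechet_derivative h (at z))" for z
          by (rule has_derivative_linear[OF has_derivative])
        have "\<bar>(frechet_derivative h (at y) - frechet_derivative h (at x)) v\<bar>
          \<le> (\<Sum>i\<in>Basis. \<bar>(frechet_derivative h (at y) - frechet_derivative h (at x)) i\<bar>) * norm v"
          by (rule linear_functional_bound) (simp add: fun_diff_def linear_compose_sub[OF lin lin])
        also have "\<dots> \<le> (\<Sum>i\<in>Basis. C i * norm d) * norm v"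
        proof (intro mult_right_mono sum_mono)
          fix i
          have "\<bar>frechet_derivative h (at y) i - frechet_derivative h (at x) i\<bar> \<le> C i * norm (y - x)"
            by (rule C)
          also have "\<dots> \<le> C i * norm d"
            using that C(1)[of i] by (intro mult_left_mono) (auto simp: dist_norm norm_minus_commute)
          finally show "\<bar>(frechet_derivative h (at y) - frechet_derivative h (at x)) i\<bar> \<le> C i * norm d"
            by simp
        qed simp
        finally show "norm ((frechet_derivative h (at y) - frechet_derivative h (at x)) v)
            \<le> (\<Sum>i\<in>Basis. C i) * norm d * norm v"
          by (simp add: sum_distrib_right)
      qed
    qed simp
    then show ?thesis by (simp add: power2_eq_square mult_ac)
  qed
  with C0 that show thesis by blast
qed

lemma kernel_integrable:
  assumes \<Phi>[measurable]: "\<Phi> \<in> M \<rightarrow>\<^sub>M borel" and c: "integrable M (c :: _ \<Rightarrow> complex)"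
  shows "integrable M (\<lambda>y. of_real (h (z - \<Phi> y)) * c y)"
proof -
  obtain C where C: "0 < C" "\<And>x. \<bar>h x\<bar> \<le> C" by (rule bounded) blast
  have [measurable]: "h \<in> borel_measurable borel"
    by (rule borel_measurable_continuous_onI[OF smooth_on_imp_continuous_on[OF smooth]])
  have [measurable]: "c \<in> borel_measurable M" using c by simp
  have "integrable M (\<lambda>y. C * cmod (c y))" using c by simp
  then show ?thesis
    by (rule Bochner_Integration.integrable_bound)
       (use C in \<open>auto simp: norm_mult intro!: AE_I2 mult_right_mono\<close>)
qed

lemma kernel_has_derivative:
  assumes \<Phi>: "\<Phi> \<in> M \<rightarrow>\<^sub>M borel" and c: "integrable M (c :: _ \<Rightarrow> complex)"
  shows "((\<lambda>z. \<integral>y. of_real (h (z - \<Phi> y)) * c y \<partial>M) has_derivative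
    (\<lambda>v. \<integral>y. of_real (frechet_derivative h (at (z - \<Phi> y)) v) * c y \<partial>M)) (at z)"
  unfolding has_derivative_at_alt
proof (intro conjI allI impI)
  let ?D = "\<lambda>v. \<integral>y. of_real (frechet_derivative h (at (z - \<Phi> y)) v) * c y \<partial>M"
  note int = kernel_integrable[OF \<Phi> c]
  note Dint = test_function.kernel_integrable[OF derivative_test_function \<Phi> c]
  have lin: "linear (frechet_derivative h (at x))" for x
    by (rule has_derivative_linear[OF has_derivative])
  obtain C where C: "0 < C" "\<And>x v. \<bar>frechet_derivative h (at x) v\<bar> \<le> C * norm v"
    by (rule derivative_bounded) blast
  show "bounded_linear ?D"
  proof (rule bounded_linear_intro)
    show "?D (v + v') = ?D v + ?D v'" for v v'
      by (simp add: linear_add[OF lin] distrib_right Dint)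
    show "?D (t *\<^sub>R v) = t *\<^sub>R ?D v" for t v
      by (simp add: linear_scale[OF lin] scaleR_conv_of_real mult.assoc)
    show "norm (?D v) \<le> norm v * (C * (\<integral>y. cmod (c y) \<partial>M))" for v
    proof -
      have "norm (?D v) \<le> (\<integral>y. C * norm v * cmod (c y) \<partial>M)"
      proof (rule norm_integral_le)
        show "integrable M (\<lambda>y. complex_of_real (frechet_derivative h (at (z - \<Phi> y)) v) * c y)"
          by (rule Dint)
      qed (use c C in \<open>auto simp: norm_mult intro!: mult_right_mono\<close>)
      then show ?thesis by (simp add: mult_ac)
    qed
  qed
  fix e :: real assume e: "0 < e"
  obtain B where B: "0 < B"
    "\<And>x d. \<bar>h (x + d) - h x - frechet_derivative h (at x) d\<bar> \<le> B * (norm d)\<^sup>2"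
    by (rule second_order_remainder) blast
  define I where "I = (\<integral>y. cmod (c y) \<partial>M)"
  have I: "0 \<le> I" by (simp add: I_def)
  \<comment> \<open>Adding 1 to \<open>I\<close> avoids division by zero when \<open>c\<close>
    vanishes almost everywhere.\<close>
  define d where "d = e / (B * (I + 1))"
  have d: "0 < d" using e B I by (simp add: d_def)
  show "\<exists>d>0. \<forall>z'. norm (z' - z) < d \<longrightarrow>
      norm ((\<integral>y. of_real (h (z' - \<Phi> y)) * c y \<partial>M) - (\<integral>y. of_real (h (z - \<Phi> y)) * c y \<partial>M)
        - ?D (z' - z)) \<le> e * norm (z' - z)"
  proof (intro exI[of _ d] conjI d allI impI)
    fix z' assume z': "norm (z' - z) < d"
    have "(\<integral>y. of_real (h (z' - \<Phi> y)) * c y \<partial>M) - (\<integral>y. of_real (h (z - \<Phi> y)) * c y \<partial>M)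
        - ?D (z' - z) = (\<integral>y. of_real (h (z' - \<Phi> y)) * c y - of_real (h (z - \<Phi> y)) * c y
          - of_real (frechet_derivative h (at (z - \<Phi> y)) (z' - z)) * c y \<partial>M)"
      by (simp add: int Dint)
    also have "norm \<dots> \<le> (\<integral>y. B * (norm (z' - z))\<^sup>2 * cmod (c y) \<partial>M)"
    proof (rule norm_integral_le)
      fix y
      have "cmod (of_real (h (z' - \<Phi> y)) * c y - of_real (h (z - \<Phi> y)) * c y
          - of_real (frechet_derivative h (at (z - \<Phi> y)) (z' - z)) * c y)
        = \<bar>h (z' - \<Phi> y) - h (z - \<Phi> y) - frechet_derivative h (at (z - \<Phi> y)) (z' - z)\<bar> * cmod (c y)"
        unfolding left_diff_distrib[symmetric] norm_mult of_real_diff[symmetric] norm_of_real ..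
      also have "\<dots> \<le> B * (norm (z' - z))\<^sup>2 * cmod (c y)"
        using B(2)[of "z - \<Phi> y" "z' - z"] by (intro mult_right_mono) auto
      finally show "norm (of_real (h (z' - \<Phi> y)) * c y - of_real (h (z - \<Phi> y)) * c y
          - of_real (frechet_derivative h (at (z - \<Phi> y)) (z' - z)) * c y)
          \<le> B * (norm (z' - z))\<^sup>2 * cmod (c y)" .
    qed (use c int Dint in auto)
    also have "\<dots> = (B * I * norm (z' - z)) * norm (z' - z)"
      by (simp add: I_def power2_eq_square mult_ac)
    also have "\<dots> \<le> e * norm (z' - z)"
    proof (rule mult_right_mono)
      have "B * I * norm (z' - z) \<le> B * (I + 1) * d"
        using z' B I by (intro mult_mono) auto
      also have "\<dots> = e" using B I by (simp add: d_def)
      finally show "B * I * norm (z' - z) \<le> e" .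
    qed simp
    finally show "norm ((\<integral>y. of_real (h (z' - \<Phi> y)) * c y \<partial>M)
        - (\<integral>y. of_real (h (z - \<Phi> y)) * c y \<partial>M) - ?D (z' - z)) \<le> e * norm (z' - z)" .
  qed
qed

end

text \<open>A directional derivative of such an integral is again one, with a derived test function;
  this is why \<open>h\<close> varies in the induction.\<close>

lemma smooth_on_kernel_integral:
  assumes "test_function h R" "\<Phi> \<in> M \<rightarrow>\<^sub>M borel" "integrable M (c :: _ \<Rightarrow> complex)"
  shows "smooth_on UNIV (\<lambda>z. \<integral>y. of_real (h (z - \<Phi> y)) * c y \<partial>M)"
  unfolding smooth_on_def
proof
  fix k
  show "times_differentiable_on k UNIV (\<lambda>z. \<integral>y. of_real (h (z - \<Phi> y)) * c y \<partial>M)"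
    using assms(1)
  proof (induction k arbitrary: h)
    case 0
    show ?case
      by (auto intro!: continuous_at_imp_continuous_on has_derivative_continuous
          test_function.kernel_has_derivative[OF 0 assms(2,3)])
  next
    case (Suc k)
    show ?case
      by (rule times_differentiable_on_SucI[OF open_UNIV
            test_function.kernel_has_derivative[OF Suc.prems assms(2,3)]
            Suc.IH[OF test_function.derivative_test_function[OF Suc.prems]]])
  qed
qed

lemma test_function_bump: "0 < r \<Longrightarrow> test_function (bump r) (2 * r)"
  by unfold_locales (auto intro: smooth_on_bump bump_eq_0)

section \<open>The mass of a bump function\<close>

text \<open>The \<open>itself\<close> argument names the space, on whose dimension the value
  depends. The mass stands in for an explicit multiple of s^n.\<close>

definition bump_mass :: "'e::euclidean_space itself \<Rightarrow> real \<Rightarrow> real"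
  where "bump_mass _ s = (\<integral>x. bump s (x :: 'e) \<partial>lborel)"

lemma bump_measurable [measurable]: "bump s \<in> borel_measurable borel"
  by (intro borel_measurable_continuous_onI smooth_on_imp_continuous_on smooth_on_bump)

lemma bump_integrable:
  assumes "0 < s"
  shows "integrable lborel (bump s :: 'e::euclidean_space \<Rightarrow> real)"
proof (rule Bochner_Integration.integrable_bound)
  show "integrable lborel (indicator (cball 0 (2 * s)) :: 'e \<Rightarrow> real)"
    using emeasure_bounded_finite[of "cball (0::'e) (2 * s)"]
    by (intro integrable_real_indicator) auto
  show "AE x::'e in lborel. norm (bump s x) \<le> norm (indicat_real (cball 0 (2 * s)) x)"
    by (auto simp: indicator_def bump_bounds bump_eq_0[OF assms] abs_of_nonneg)
qed simp

lemma bump_shift_integral: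
  "(\<integral>x. bump s (x - t) \<partial>lborel) = bump_mass TYPE('e) s" for t :: "'e::euclidean_space"
proof -
  have "(\<integral>x. bump s (x - t) \<partial>lborel) = (\<integral>x. bump s (x - t) \<partial>distr lborel borel ((+) t))"
    by (simp add: lborel_distr_plus)
  also have "\<dots> = (\<integral>x. bump s (t + x - t) \<partial>lborel)"
    by (rule integral_distr) auto
  finally show ?thesis by (simp add: bump_mass_def)
qed

lemma bump_shift_integrable:
  fixes t :: "'e::euclidean_space"
  assumes "0 < s"
  shows "integrable lborel (\<lambda>x. bump s (x - t))"
proof -
  have "integrable (distr lborel borel ((+) t)) (\<lambda>x. bump s (x - t)) \<longleftrightarrow>
      integrable lborel (\<lambda>x. bump s (t + x - t))"
    by (rule integrable_distr_eq) auto
  then show ?thesis using bump_integrable[OF assms] by (simp add: lborel_distr_plus)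
qed

text \<open>\<open>bump s\<close> dominates the indicator of the ball of radius \<open>s\<close>,
  and doubling the radius costs \<open>2 ^ DIM('e)\<close>. The ball on the left carries the kernel
  around \<open>z\<close>, so this is the volume estimate behind the slice bound in Schur's
  test.\<close>

lemma content_le_bump_mass:
  fixes z :: "'e::euclidean_space"
  assumes "0 < s"
  shows "measure lborel (cball z (2 * s)) \<le> 2 ^ DIM('e) * bump_mass TYPE('e) s"
proof -
  have int: "integrable lborel (indicator (cball 0 s) :: 'e \<Rightarrow> real)"
    using emeasure_bounded_finite[of "cball (0::'e) s"] by (intro integrable_real_indicator) auto
  have "measure lborel (cball (0::'e) s) = (\<integral>x. indicator (cball (0::'e) s) x \<partial>lborel)" by simp
  also have "\<dots> \<le> bump_mass TYPE('e) s"
    unfolding bump_mass_def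
    by (intro integral_mono int bump_integrable assms)
       (auto simp: indicator_def bump_bounds bump_eq_1)
  finally have "measure lborel (ball (0::'e) s) \<le> bump_mass TYPE('e) s"
    by (simp add: content_cball_conv_ball)
  moreover have "measure lborel (ball z (2 * s)) = 2 ^ DIM('e) * measure lborel (ball (0::'e) s)"
    using content_ball_conv_unit_ball[of "2 * s" z] content_ball_conv_unit_ball[of s "0::'e"] assms
    by (simp add: power_mult_distrib)
  ultimately show ?thesis by (simp add: content_cball_conv_ball)
qed

lemma bump_mass_pos:
  assumes "0 < s"
  shows "0 < bump_mass TYPE('e::euclidean_space) s"
proof -
  have "0 < measure lborel (cball (0::'e) (2 * s))" using assms by (intro content_cball_pos) simp
  also have "\<dots> \<le> 2 ^ DIM('e) * bump_mass TYPE('e) s" by (rule content_le_bump_mass[OF assms])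
  finally show ?thesis by (simp add: zero_less_mult_iff)
qed

lemma bump_deriv_eq_0_inner: "0 < r \<Longrightarrow> norm x < r \<Longrightarrow> bump_deriv r x v = 0"
proof -
  assume "0 < r" "norm x < r"
  then have "x \<bullet> x < r\<^sup>2" unfolding dot_square_norm by (intro power_strict_mono) auto
  with \<open>0 < r\<close> show ?thesis
    unfolding bump_deriv_def using smooth_step_deriv_eq_0[of "(x \<bullet> x - r\<^sup>2) / (3 * r\<^sup>2)"]
    by (auto simp: field_simps)
qed

lemma norm_integral_le_nn_integral:
  fixes f :: "'a \<Rightarrow> 'b::{banach, second_countable_topology}"
  shows "ennreal (norm (\<integral>x. f x \<partial>M)) \<le> (\<integral>\<^sup>+x. ennreal (norm (f x)) \<partial>M)"
  using integral_norm_bound_ennreal[of M f]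
  by (cases "integrable M f") (auto simp: not_integrable_integral_eq)

section \<open>Friedrichs mollification in a chart\<close>

locale positive_dim_operator = positive_dim_manifold E A M + manifold_operator E A M P
  for E :: "'e::euclidean_space set" and A :: "('a::t2_space, 'e) chart set" and M :: "'a measure"
    and P :: "('a \<Rightarrow> complex) \<Rightarrow> 'a \<Rightarrow> complex"

sublocale positive_dim_operator \<subseteq> symmetric_first_order A M P
  by (rule symmetric_first_orderI[OF smooth_functions_dense])

text \<open>Fixes one chart and a ball in its image, with \<open>w\<close> the density and
  \<open>a\<close>, \<open>b\<close> the coefficients of \<open>P\<close> there. The constants
  obtained in this locale must be uniform in the scale, which is therefore not a parameter of
  it.\<close>

locale chart_mollifier = positive_dim_operator E A M P
  for E :: "'e::euclidean_space set" and A :: "('a::t2_space, 'e) chart set" and M :: "'a measure"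
    and P :: "('a \<Rightarrow> complex) \<Rightarrow> 'a \<Rightarrow> complex" +
  fixes U :: "'a set" and \<phi> :: "'a \<Rightarrow> 'e" and y0 :: 'e and r :: real
    and w :: "'e \<Rightarrow> real" and a :: "'e \<Rightarrow> 'e \<Rightarrow> complex" and b :: "'e \<Rightarrow> complex"
  assumes U: "(U, \<phi>) \<in> A" and r: "0 < r" and ball: "cball y0 (4 * r) \<subseteq> \<phi> ` U"
    and w_smooth: "smooth_on (\<phi> ` U) w" and w_pos: "y \<in> \<phi> ` U \<Longrightarrow> 0 < w y"
    and w_distr: "distr (restrict_space M U) borel \<phi> =
      density lborel (\<lambda>y. ennreal (indicator (\<phi> ` U) y * w y))"
    and w_measurable: "(\<lambda>y. indicator (\<phi> ` U) y * w y) \<in> borel_measurable borel"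
    and a_smooth: "i \<in> Basis \<Longrightarrow> smooth_on (\<phi> ` U) (a i)" and b_smooth: "smooth_on (\<phi> ` U) b"
    and P_formula: "f \<in> smooth_functions A \<Longrightarrow> x \<in> U \<Longrightarrow> P f x =
      (\<Sum>i\<in>Basis. a i (\<phi> x) * frechet_derivative (\<lambda>y. f (inv_into U \<phi> y)) (at (\<phi> x)) i)
      + b (\<phi> x) * f x"
begin

text \<open>Zero outside \<open>U\<close>, so that it is Borel on the whole manifold. The artificial
  value is harmless because the weights of the kernels vanish there.\<close>

definition coord :: "'a \<Rightarrow> 'e"
  where "coord x = indicator U x *\<^sub>R \<phi> x"

definition cut :: "'e \<Rightarrow> real"
  where "cut y = bump (2 * r) (y - y0)"

text \<open>Dividing by the density makes the mollified functions converge to \<open>u\<close> instead of \<open>w u\<close>.\<close>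

definition kap :: "'e \<Rightarrow> real"
  where "kap y = cut y * inverse (w y)"

definition patch :: "'a set"
  where "patch = U \<inter> \<phi> -` cball y0 (4 * r)"

lemma coord_eq [simp]: "x \<in> U \<Longrightarrow> coord x = \<phi> x"
  by (simp add: coord_def)

lemma image_open: "open (\<phi> ` U)"
  by (rule chart_image_open[OF U])

lemma coord_measurable [measurable]: "coord \<in> borel_measurable M"
  using chart_measurable[OF U] chart_domain_measurable[OF U]
  by (simp add: coord_def[abs_def] borel_measurable_restrict_space_iff)

lemma U_measurable [measurable]: "U \<in> sets M"
  by (rule chart_domain_measurable[OF U])

lemma patch_eq: "patch = {x \<in> space M. x \<in> U \<and> dist y0 (coord x) \<le> 4 * r}"
  by (auto simp: patch_def)

lemma patch_measurable [measurable]: "patch \<in> sets M"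
  unfolding patch_eq by measurable

lemma patch_U: "x \<in> patch \<Longrightarrow> x \<in> U"
  by (simp add: patch_def)

lemma patch_image: "patch = inv_into U \<phi> ` cball y0 (4 * r)"
proof
  show "patch \<subseteq> inv_into U \<phi> ` cball y0 (4 * r)"
    using chart(5)[OF U] by (force simp: patch_def image_iff)
  show "inv_into U \<phi> ` cball y0 (4 * r) \<subseteq> patch"
    using chart(6,7)[OF U] ball by (auto simp: patch_def simp del: mem_cball)
qed

lemma patch_compact: "compact patch"
  unfolding patch_image
  by (intro compact_continuous_image continuous_on_subset[OF chart(4)[OF U] ball]) simp

lemma cut_bounds: "0 \<le> cut y" "cut y \<le> 1"
  by (simp_all add: cut_def bump_bounds)

lemma cut_eq_1: "norm (y - y0) \<le> 2 * r \<Longrightarrow> cut y = 1"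
  by (simp add: cut_def bump_eq_1)

lemma cut_eq_0: "y \<notin> cball y0 (4 * r) \<Longrightarrow> cut y = 0"
  using r by (simp add: cut_def bump_eq_0 dist_norm norm_minus_commute)

lemma cut_smooth: "open S \<Longrightarrow> smooth_on S cut"
  unfolding cut_def[abs_def] by (rule smooth_on_bump_shift)

lemma cut_has_derivative: "(cut has_derivative bump_deriv (2 * r) (y - y0)) (at y)"
proof -
  have "((\<lambda>y. y - y0) has_derivative (\<lambda>v. v)) (at y)" by (auto intro!: derivative_eq_intros)
  from diff_chain_at[OF this bump_has_derivative] show ?thesis
    by (simp add: cut_def[abs_def] o_def)
qed

lemma kap_smooth: "smooth_on (\<phi> ` U) kap"
proof -
  have "smooth_on (\<phi> ` U) (\<lambda>y. inverse (w y))"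
    by (rule smooth_on_compose[OF image_open _ _ w_smooth smooth_on_inverse_pos])
       (use w_pos in auto)
  then show ?thesis
    unfolding kap_def[abs_def] by (intro smooth_on_mult image_open cut_smooth)
qed

lemma kap_eq_0: "y \<notin> cball y0 (4 * r) \<Longrightarrow> kap y = 0"
  by (simp add: kap_def cut_eq_0)

lemma extend_smooth:
  assumes "smooth_on (\<phi> ` U) h" "\<And>y. y \<notin> cball y0 (4 * r) \<Longrightarrow> h y = (0 :: complex)"
  shows "extend_chart U \<phi> h \<in> smooth_functions A"
  by (rule extend_chart_smooth[OF U assms(1) _ ball assms(2)]) auto

lemma continuous_on_bounded:
  fixes h :: "'e \<Rightarrow> 'b::real_normed_vector"
  assumes "smooth_on (\<phi> ` U) h"
  obtains C where "0 < C" "\<And>y. y \<in> cball y0 (4 * r) \<Longrightarrow> norm (h y) \<le> C"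
proof -
  have "compact (h ` cball y0 (4 * r))"
    by (intro compact_continuous_image
        continuous_on_subset[OF smooth_on_imp_continuous_on[OF assms] ball]) simp
  then have "\<exists>C>0. \<forall>y\<in>cball y0 (4 * r). norm (h y) \<le> C"
    by (auto dest!: compact_imp_bounded simp: bounded_pos simp del: mem_cball)
  then show thesis using that by blast
qed

lemma kap_bounded: obtains C where "0 < C" "\<And>y. \<bar>kap y\<bar> \<le> C"
proof -
  obtain C where C: "0 < C" "\<And>y. y \<in> cball y0 (4 * r) \<Longrightarrow> norm (kap y) \<le> C"
    by (rule continuous_on_bounded[OF kap_smooth]) blast
  have "\<bar>kap y\<bar> \<le> C" for y
    using C kap_eq_0[of y] by (cases "y \<in> cball y0 (4 * r)") auto
  with C(1) show thesis by (rule that)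
qed

lemma P_extend:
  assumes "extend_chart U \<phi> h \<in> smooth_functions A" "x \<in> U" "(h has_derivative D) (at (\<phi> x))"
  shows "P (extend_chart U \<phi> h) x = (\<Sum>i\<in>Basis. a i (\<phi> x) * D i) + b (\<phi> x) * h (\<phi> x)"
proof -
  have "((\<lambda>y. extend_chart U \<phi> h (inv_into U \<phi> y)) has_derivative D) (at (\<phi> x))"
    by (rule has_derivative_transform_within_open[OF assms(3) image_open])
       (use assms(2) chart(6,7)[OF U] in \<open>auto simp: extend_chart_def\<close>)
  then have "frechet_derivative (\<lambda>y. extend_chart U \<phi> h (inv_into U \<phi> y)) (at (\<phi> x)) = D"
    by (rule frechet_derivative_at[symmetric])
  then show ?thesis
    using P_formula[OF assms(1,2)] assms(2) by (simp add: extend_chart_def)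
qed

text \<open>Locality of \<open>P\<close>, deduced from the Leibniz rule: with \<open>\<psi>\<close>
  equal to 1 on \<open>patch\<close> and 0 off \<open>U\<close>, \<open>f\<close> equals its product
  with \<open>\<psi>\<close>, and both factors vanish at \<open>x\<close>. The coordinate formula
  does not reach such points.\<close>

lemma P_eq_0_outside:
  assumes f: "f \<in> smooth_functions A" and "\<And>x. x \<notin> patch \<Longrightarrow> f x = 0" and x: "x \<notin> U"
  shows "P f x = 0"
proof -
  obtain \<psi> where \<psi>: "\<psi> \<in> smooth_functions A" "\<And>x. x \<in> patch \<Longrightarrow> \<psi> x = 1"
    "\<And>x. x \<notin> U \<Longrightarrow> \<psi> x = 0"
    by (rule smooth_Urysohn[OF patch_compact chart(1)[OF U]]) (auto dest: patch_U)
  have "(\<lambda>y. \<psi> y * f y) = f"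
  proof
    show "\<psi> y * f y = f y" for y using \<psi>(2)[of y] assms(2)[of y] by (cases "y \<in> patch") auto
  qed
  moreover have "f x = 0" using assms(2) x patch_U by blast
  ultimately show ?thesis
    using P_mult[OF \<psi>(1) f, of x] \<psi>(3)[OF x] by simp
qed

text \<open>\<open>real_symbol\<close> is applied to a cut-off coordinate function, which is smooth
  and real on the whole manifold. Where the cutoff is locally 1, the commutator of \<open>P\<close>
  with it is the coefficient \<open>a i\<close>.\<close>

lemma real_symbol_chart:
  assumes i: "i \<in> Basis"
  shows "AE x in M. x \<in> U \<longrightarrow> norm (\<phi> x - y0) < 2 * r \<longrightarrow> Re (a i (\<phi> x)) = 0"
proof -
  define h where "h y = complex_of_real (cut y * (y \<bullet> i))" for y
  have hs: "extend_chart U \<phi> h \<in> smooth_functions A"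
  proof (rule extend_smooth)
    show "smooth_on (\<phi> ` U) h"
      unfolding h_def[abs_def]
      by (intro smooth_on_of_real smooth_on_mult image_open cut_smooth
          smooth_on_linear[OF bounded_linear_inner_left])
    show "h y = 0" if "y \<notin> cball y0 (4 * r)" for y using cut_eq_0[OF that] by (simp add: h_def)
  qed
  have ae: "AE x in M. Re (P (extend_chart U \<phi> h) x - extend_chart U \<phi> h x * P (\<lambda>_. 1) x) = 0"
    by (rule real_symbol[OF hs]) (simp add: extend_chart_def h_def)
  have eq: "P (extend_chart U \<phi> h) x - extend_chart U \<phi> h x * P (\<lambda>_. 1) x = a i (\<phi> x)"
    if x: "x \<in> U" and near: "norm (\<phi> x - y0) < 2 * r" for x
  proof -
    have d0: "bump_deriv (2 * r) (\<phi> x - y0) v = 0" for v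
      using near r by (intro bump_deriv_eq_0_inner) auto
    have "((\<lambda>y. cut y * (y \<bullet> i)) has_derivative
        (\<lambda>v. cut (\<phi> x) * (v \<bullet> i) + bump_deriv (2 * r) (\<phi> x - y0) v * (\<phi> x \<bullet> i))) (at (\<phi> x))"
      by (rule has_derivative_mult[OF cut_has_derivative
            bounded_linear_imp_has_derivative[OF bounded_linear_inner_left]])
    then have "((\<lambda>y. cut y * (y \<bullet> i)) has_derivative (\<lambda>v. v \<bullet> i)) (at (\<phi> x))"
      using near cut_eq_1[of "\<phi> x"] by (simp add: d0)
    then have "(h has_derivative (\<lambda>v. complex_of_real (v \<bullet> i))) (at (\<phi> x))"
      unfolding h_def[abs_def] by (rule has_derivative_of_real)
    from P_extend[OF hs x this]
    have "P (extend_chart U \<phi> h) x = (\<Sum>j\<in>Basis. a j (\<phi> x) * complex_of_real (j \<bullet> i))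
        + b (\<phi> x) * h (\<phi> x)" .
    also have "(\<Sum>j\<in>Basis. a j (\<phi> x) * complex_of_real (j \<bullet> i)) = (\<Sum>j\<in>Basis. if j = i then a j (\<phi> x) else 0)"
      using i by (intro sum.cong) (auto simp: inner_Basis)
    also have "\<dots> = a i (\<phi> x)" using i by simp
    finally have "P (extend_chart U \<phi> h) x = a i (\<phi> x) + b (\<phi> x) * h (\<phi> x)" .
    moreover have "P (\<lambda>_. 1) x = b (\<phi> x)"
      using P_formula[OF smooth_functions_const x, of 1] by simp
    ultimately show ?thesis using x by (simp add: extend_chart_def)
  qed
  show ?thesis using ae by (rule eventually_mono) (intro impI, simp only: eq)
qed

lemma chart_integral:
  fixes h :: "'e \<Rightarrow> complex"
  assumes h: "h \<in> borel_measurable borel"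
  shows "(\<integral>x. indicator U x *\<^sub>R h (\<phi> x) \<partial>M) = (\<integral>y. (indicator (\<phi> ` U) y * w y) *\<^sub>R h y \<partial>lborel)"
proof -
  have "(\<integral>x. indicator U x *\<^sub>R h (\<phi> x) \<partial>M) = (\<integral>x. h (\<phi> x) \<partial>restrict_space M U)"
    using chart_domain_measurable[OF U] by (simp add: integral_restrict_space)
  also have "\<dots> = (\<integral>y. h y \<partial>distr (restrict_space M U) borel \<phi>)"
    by (rule integral_distr[symmetric, OF chart_measurable[OF U] h])
  also have "\<dots> = (\<integral>y. (indicator (\<phi> ` U) y * w y) *\<^sub>R h y \<partial>lborel)"
    unfolding w_distr
    by (rule integral_density) (use h w_measurable w_pos in \<open>auto simp: indicator_def less_imp_le\<close>)
  finally show ?thesis .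
qed

section \<open>Pairs of nearby points and the volume of their slices\<close>

definition near_pairs :: "real \<Rightarrow> ('a \<times> 'a) set"
  where "near_pairs s = {(x, y). x \<in> patch \<and> y \<in> patch \<and> dist (coord x) (coord y) \<le> 2 * s}"

lemma near_pairs_measurable [measurable]: "near_pairs s \<in> sets (M \<Otimes>\<^sub>M M)"
proof -
  have "near_pairs s = {p \<in> space (M \<Otimes>\<^sub>M M). fst p \<in> patch \<and> snd p \<in> patch
      \<and> dist (coord (fst p)) (coord (snd p)) \<le> 2 * s}"
    by (auto simp: near_pairs_def space_pair_measure)
  also have "\<dots> \<in> sets (M \<Otimes>\<^sub>M M)" by measurable
  finally show ?thesis .
qed

lemma near_pairs_sym: "(x, y) \<in> near_pairs s \<longleftrightarrow> (y, x) \<in> near_pairs s"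
  by (auto simp: near_pairs_def dist_commute)

text \<open>A slice lies in a coordinate ball of radius \<open>2 * s\<close> within the patch, where
  \<open>w\<close> is bounded. Since \<open>near_pairs\<close> is symmetric, this one estimate
  supplies both slice bounds of Schur's test.\<close>

lemma near_pairs_slice:
  obtains C where "0 < C" "\<And>s x. 0 < s \<Longrightarrow>
    (\<integral>\<^sup>+y. indicator (near_pairs s) (x, y) \<partial>M) \<le> ennreal (C * bump_mass TYPE('e) s)"
proof -
  obtain C where C: "0 < C" "\<And>y. y \<in> cball y0 (4 * r) \<Longrightarrow> norm (w y) \<le> C"
    by (rule continuous_on_bounded[OF w_smooth]) blast
  have "(\<integral>\<^sup>+y. indicator (near_pairs s) (x, y) \<partial>M) \<le> ennreal (C * 2 ^ DIM('e) * bump_mass TYPE('e) s)"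
    if s: "0 < s" for s x
  proof -
    define Q where "Q = cball y0 (4 * r) \<inter> cball (coord x) (2 * s)"
    have Q: "Q \<in> sets borel" unfolding Q_def by (intro sets.Int borel_closed) auto
    have "(\<integral>\<^sup>+y. indicator (near_pairs s) (x, y) \<partial>M) \<le> (\<integral>\<^sup>+y. indicator Q (\<phi> y) * indicator U y \<partial>M)"
      by (intro nn_integral_mono) (auto simp: indicator_def near_pairs_def patch_def Q_def)
    also have "\<dots> = (\<integral>\<^sup>+z. ennreal (indicator (\<phi> ` U) z * w z) * indicator Q z \<partial>model_measure E)"
      by (rule chart_nn_integral[OF U])
         (simp_all add: model_measure_def E_UNIV w_distr w_measurable borel_measurable_indicator Q)
    also have "\<dots> = (\<integral>\<^sup>+z. ennreal (indicator (\<phi> ` U) z * w z) * indicator Q z \<partial>lborel)"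
      by (simp add: model_measure_def E_UNIV)
    also have "\<dots> \<le> (\<integral>\<^sup>+z. ennreal C * indicator (cball (coord x) (2 * s)) z \<partial>lborel)"
    proof (intro nn_integral_mono)
      fix z
      show "ennreal (indicator (\<phi> ` U) z * w z) * indicator Q z
          \<le> ennreal C * indicator (cball (coord x) (2 * s)) z"
        using C(2)[of z] C(1) by (auto simp: indicator_def Q_def intro!: ennreal_leI)
    qed
    also have "\<dots> = ennreal C * emeasure lborel (cball (coord x) (2 * s))"
      by (intro nn_integral_cmult_indicator) simp
    also have "emeasure lborel (cball (coord x) (2 * s)) = ennreal (measure lborel (cball (coord x) (2 * s)))"
      using emeasure_bounded_finite[of "cball (coord x) (2 * s)"]
      by (intro emeasure_eq_ennreal_measure) auto
    also have "ennreal C * ennreal (measure lborel (cball (coord x) (2 * s)))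
        \<le> ennreal C * ennreal (2 ^ DIM('e) * bump_mass TYPE('e) s)"
      by (intro mult_left_mono ennreal_leI content_le_bump_mass s) simp
    also have "\<dots> = ennreal (C * 2 ^ DIM('e) * bump_mass TYPE('e) s)"
      using C(1) bump_mass_pos[OF s, where 'e = 'e] by (simp add: ennreal_mult[symmetric] mult.assoc)
    finally show ?thesis .
  qed
  then show thesis using C(1) by (intro that[of "C * 2 ^ DIM('e)"]) auto
qed

definition kapX :: "'a \<Rightarrow> real"
  where "kapX = extend_chart U \<phi> kap"

text \<open>Convolution with an unnormalized bump, written as an integral over the manifold. The
  weight \<open>kapX\<close> confines the integration to the patch and, where the cutoff is 1,
  cancels the density contained in \<open>M\<close>.\<close>

definition potential :: "real \<Rightarrow> ('a \<Rightarrow> complex) \<Rightarrow> 'e \<Rightarrow> complex"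
  where "potential s u z = (\<integral>y. of_real (bump s (z - coord y)) * (of_real (kapX y) * u y) \<partial>M)"

definition potential_deriv :: "real \<Rightarrow> ('a \<Rightarrow> complex) \<Rightarrow> 'e \<Rightarrow> 'e \<Rightarrow> complex"
  where "potential_deriv s u z v =
    (\<integral>y. of_real (bump_deriv s (z - coord y) v) * (of_real (kapX y) * u y) \<partial>M)"

text \<open>The potential lives on the whole model space; the outer \<open>cut\<close> lets its
  restriction to the chart extend by zero to a smooth function on the manifold.\<close>

definition mollify :: "real \<Rightarrow> ('a \<Rightarrow> complex) \<Rightarrow> 'a \<Rightarrow> complex"
  where "mollify s u = extend_chart U \<phi> (\<lambda>z. of_real (cut z) * potential s u z)"

lemma kapX_smooth: "(\<lambda>x. complex_of_real (kapX x)) \<in> smooth_functions A"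
proof -
  have "(\<lambda>x. complex_of_real (kapX x)) = extend_chart U \<phi> (\<lambda>y. complex_of_real (kap y))"
    by (auto simp: kapX_def extend_chart_def)
  also have "\<dots> \<in> smooth_functions A"
    by (rule extend_smooth[OF smooth_on_of_real[OF image_open kap_smooth]]) (simp add: kap_eq_0)
  finally show ?thesis .
qed

lemma kapX_eq_0: "x \<notin> patch \<Longrightarrow> kapX x = 0"
  by (auto simp: kapX_def extend_chart_def patch_def kap_eq_0 simp del: mem_cball)

lemma kapX_bounded: obtains C where "0 < C" "\<And>x. \<bar>kapX x\<bar> \<le> C"
proof -
  obtain C where C: "0 < C" "\<And>y. \<bar>kap y\<bar> \<le> C" by (rule kap_bounded) blast
  then have "\<bar>kapX x\<bar> \<le> C" for x by (simp add: kapX_def extend_chart_def)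
  with C(1) show thesis by (rule that)
qed

lemma kapX_mult_integrable: "u \<in> L2 M \<Longrightarrow> integrable M (\<lambda>y. of_real (kapX y) * u y)"
  by (rule L2_mult_integrable[OF smooth_L2[OF kapX_smooth]])

lemma potential_smooth:
  assumes "u \<in> L2 M" "0 < s"
  shows "smooth_on UNIV (potential s u)"
  unfolding potential_def[abs_def]
  by (rule smooth_on_kernel_integral[OF test_function_bump[OF assms(2)] coord_measurable
        kapX_mult_integrable[OF assms(1)]])

lemma potential_has_derivative:
  assumes "u \<in> L2 M" "0 < s"
  shows "(potential s u has_derivative potential_deriv s u z) (at z)"
  using test_function.kernel_has_derivative[OF test_function_bump[OF assms(2)] coord_measurable
        kapX_mult_integrable[OF assms(1)], of z]
  by (simp add: potential_def[abs_def] potential_deriv_def[abs_def] bump_deriv_eq_frechet)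

lemma potential_integrable:
  assumes "u \<in> L2 M" "0 < s"
  shows "integrable M (\<lambda>y. of_real (bump s (z - coord y)) * (of_real (kapX y) * u y))"
    and "integrable M (\<lambda>y. of_real (bump_deriv s (z - coord y) v) * (of_real (kapX y) * u y))"
  using test_function.kernel_integrable[OF test_function_bump[OF assms(2)] coord_measurable
        kapX_mult_integrable[OF assms(1)], of z]
    test_function.kernel_integrable[OF test_function.derivative_test_function[OF
        test_function_bump[OF assms(2)]] coord_measurable kapX_mult_integrable[OF assms(1)], of z v]
  by (simp_all add: bump_deriv_eq_frechet)

lemma mollify_smooth:
  assumes "u \<in> L2 M" "0 < s"
  shows "mollify s u \<in> smooth_functions A"
  unfolding mollify_def
proof (rule extend_smooth)
  show "smooth_on (\<phi> ` U) (\<lambda>z. of_real (cut z) * potential s u z)"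
    by (intro smooth_on_mult smooth_on_of_real image_open cut_smooth
        smooth_on_subset[OF potential_smooth[OF assms] image_open open_UNIV subset_UNIV])
qed (simp add: cut_eq_0)

lemma mollify_eq_0: "x \<notin> patch \<Longrightarrow> mollify s u x = 0"
  by (auto simp: mollify_def extend_chart_def patch_def cut_eq_0 simp del: mem_cball)

text \<open>Domination is asked almost everywhere because the real parts of the coefficients are
  known to vanish only in that sense.\<close>

lemma kernel_bound:
  assumes [measurable]: "u \<in> borel_measurable M" and "0 \<le> C"
    and "AE y in M. norm (f y) \<le> C * indicator (near_pairs s) (x, y) * cmod (u y)"
  shows "ennreal (cmod (\<integral>y. f y \<partial>M))
    \<le> ennreal C * (\<integral>\<^sup>+y. indicator (near_pairs s) (x, y) * ennreal (cmod (u y)) \<partial>M)"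
proof -
  have "x \<in> space M" by simp
  then have [measurable]: "(\<lambda>y. indicator (near_pairs s) (x, y) :: ennreal) \<in> borel_measurable M"
    by measurable
  have "ennreal (cmod (\<integral>y. f y \<partial>M)) \<le> (\<integral>\<^sup>+y. ennreal (cmod (f y)) \<partial>M)"
    by (rule norm_integral_le_nn_integral)
  also have "\<dots> \<le> (\<integral>\<^sup>+y. ennreal C * (indicator (near_pairs s) (x, y) * ennreal (cmod (u y))) \<partial>M)"
  proof (rule nn_integral_mono_AE)
    show "AE y in M. ennreal (cmod (f y))
        \<le> ennreal C * (indicator (near_pairs s) (x, y) * ennreal (cmod (u y)))"
      using assms(3)
    proof eventually_elim
      case (elim y)
      then show ?case
        using assms(2) by (cases "(x, y) \<in> near_pairs s") (auto simp: ennreal_mult[symmetric] intro!: ennreal_leI)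
    qed
  qed
  also have "\<dots> = ennreal C * (\<integral>\<^sup>+y. indicator (near_pairs s) (x, y) * ennreal (cmod (u y)) \<partial>M)"
    by (rule nn_integral_cmult) measurable
  finally show ?thesis .
qed

lemma near_pairsI: "x \<in> patch \<Longrightarrow> y \<in> patch \<Longrightarrow> norm (\<phi> x - \<phi> y) \<le> 2 * s \<Longrightarrow> (x, y) \<in> near_pairs s"
  by (auto simp: near_pairs_def dist_norm patch_U)

lemma kapX_kernel_bound:
  assumes C: "\<And>x. \<bar>kapX x\<bar> \<le> C" and s: "0 < s" and x: "x \<in> patch"
  shows "norm (of_real (bump s (\<phi> x - coord y)) * (of_real (kapX y) * u y))
    \<le> C * indicator (near_pairs s) (x, y) * cmod (u y)"
proof (cases "y \<in> patch \<and> norm (\<phi> x - \<phi> y) \<le> 2 * s")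
  case True
  then have "(x, y) \<in> near_pairs s" using near_pairsI x by blast
  moreover have "\<bar>bump s (\<phi> x - coord y)\<bar> * \<bar>kapX y\<bar> \<le> 1 * C"
    using C by (intro mult_mono) (auto simp: bump_bounds abs_of_nonneg)
  ultimately show ?thesis by (simp add: norm_mult mult_right_mono mult.assoc[symmetric])
next
  case False
  have "0 \<le> C" using C[of x] by linarith
  have "bump s (\<phi> x - coord y) * kapX y = 0"
  proof (cases "y \<in> patch")
    case True
    then show ?thesis using False s bump_eq_0[of s "\<phi> x - coord y"] by (simp add: patch_U)
  qed (simp add: kapX_eq_0)
  then show ?thesis using \<open>0 \<le> C\<close> by auto
qed

lemma mollify_bound:
  obtains C where "0 < C" "\<And>s u x. 0 < s \<Longrightarrow> u \<in> L2 M \<Longrightarrow> ennreal (cmod (mollify s u x))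
    \<le> ennreal C * (\<integral>\<^sup>+y. indicator (near_pairs s) (x, y) * ennreal (cmod (u y)) \<partial>M)"
proof -
  obtain C where C: "0 < C" "\<And>x. \<bar>kapX x\<bar> \<le> C" by (rule kapX_bounded) blast
  have "ennreal (cmod (mollify s u x))
    \<le> ennreal C * (\<integral>\<^sup>+y. indicator (near_pairs s) (x, y) * ennreal (cmod (u y)) \<partial>M)"
    if s: "0 < s" and u: "u \<in> L2 M" for s u x
  proof (cases "x \<in> patch")
    case True
    have "cmod (mollify s u x) \<le> cmod (potential s u (\<phi> x))"
      using True cut_bounds[of "\<phi> x"]
      by (auto simp: mollify_def extend_chart_def norm_mult patch_U intro!: mult_left_le_one_le)
    then have "ennreal (cmod (mollify s u x)) \<le> ennreal (cmod (potential s u (\<phi> x)))"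
      by (rule ennreal_leI)
    also have "\<dots> \<le> ennreal C * (\<integral>\<^sup>+y. indicator (near_pairs s) (x, y) * ennreal (cmod (u y)) \<partial>M)"
      unfolding potential_def
      by (rule kernel_bound[OF L2_measurable[OF u]])
         (use C in \<open>auto intro!: AE_I2 kapX_kernel_bound[OF C(2) s True]\<close>)
    finally show ?thesis .
  qed (simp add: mollify_eq_0)
  with C(1) show thesis by (rule that)
qed

text \<open>Convexity of the ball turns a derivative bound into a Lipschitz bound. For the
  coefficients it supplies the factor \<open>s\<close> that compensates the derivative of the
  kernel.\<close>

lemma smooth_on_lipschitz:
  fixes h :: "'e \<Rightarrow> complex"
  assumes h: "smooth_on (\<phi> ` U) h"
  obtains L where "0 < L" "\<And>x y. x \<in> cball y0 (4 * r) \<Longrightarrow> y \<in> cball y0 (4 * r) \<Longrightarrow>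
    norm (h x - h y) \<le> L * norm (x - y)"
proof -
  let ?D = "\<lambda>x. frechet_derivative h (at x)"
  have "\<exists>C. 0 < C \<and> (\<forall>y\<in>cball y0 (4 * r). norm (?D y i) \<le> C)" for i
    by (rule continuous_on_bounded[OF smooth_on_frechet_derivative[OF h image_open, of i]]) blast
  then obtain C where C: "\<And>i. 0 < C i" "\<And>i y. y \<in> cball y0 (4 * r) \<Longrightarrow> norm (?D y i) \<le> C i"
    by metis
  have "norm (h x - h y) \<le> (\<Sum>i\<in>Basis. C i) * norm (x - y)"
    if xy: "x \<in> cball y0 (4 * r)" "y \<in> cball y0 (4 * r)" for x y
  proof (rule differentiable_bound[OF convex_cball _ _ xy])
    fix z assume z: "z \<in> cball y0 (4 * r)"
    have D: "(h has_derivative ?D z) (at z)"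
      by (rule smooth_on_has_derivative[OF h image_open subsetD[OF ball z]])
    then show "(h has_derivative ?D z) (at z within cball y0 (4 * r))"
      by (rule has_derivative_at_withinI)
    show "onorm (?D z) \<le> (\<Sum>i\<in>Basis. C i)"
    proof (rule onorm_le)
      fix v
      have "norm (?D z v) \<le> (\<Sum>i\<in>Basis. norm (?D z i)) * norm v"
        by (rule linear_norm_bound[OF has_derivative_linear[OF D]])
      also have "\<dots> \<le> (\<Sum>i\<in>Basis. C i) * norm v"
        by (intro mult_right_mono sum_mono C z) simp
      finally show "norm (?D z v) \<le> (\<Sum>i\<in>Basis. C i) * norm v" .
    qed
  qed
  moreover have "0 < (\<Sum>i\<in>Basis. C i)" by (intro sum_pos C) auto
  ultimately show thesis using that by blast
qed

section \<open>The operator applied to mollified functions\<close>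

definition cut_symbol :: "'e \<Rightarrow> complex"
  where "cut_symbol z =
    (\<Sum>i\<in>Basis. a i z * of_real (bump_deriv (2 * r) (z - y0) i)) + b z * of_real (cut z)"

text \<open>Coordinate expression of \<open>P\<close> applied to \<open>kap\<close>, just as
  \<open>cut_symbol\<close> is for \<open>cut\<close>: the term without kernel derivative that
  arises when \<open>P\<close> meets a product containing the weight.\<close>

definition kap_symbol :: "'e \<Rightarrow> complex"
  where "kap_symbol z =
    (\<Sum>i\<in>Basis. a i z * of_real (frechet_derivative kap (at z) i)) + b z * of_real (kap z)"

lemma cut_symbol_smooth: "smooth_on (\<phi> ` U) cut_symbol"
proof -
  have "smooth_on (\<phi> ` U) (\<lambda>z. frechet_derivative cut (at z) i)" for i
    by (rule smooth_on_frechet_derivative[OF cut_smooth[OF image_open] image_open])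
  moreover have "frechet_derivative cut (at z) = bump_deriv (2 * r) (z - y0)" for z
    by (rule frechet_derivative_at[OF cut_has_derivative, symmetric])
  ultimately have 1: "smooth_on (\<phi> ` U) (\<lambda>z. bump_deriv (2 * r) (z - y0) i)" for i by simp
  show ?thesis
    unfolding cut_symbol_def[abs_def]
    by (intro smooth_on_add smooth_on_sum smooth_on_mult smooth_on_of_real image_open a_smooth
        b_smooth cut_smooth 1)
qed

lemma kap_symbol_smooth: "smooth_on (\<phi> ` U) kap_symbol"
  unfolding kap_symbol_def[abs_def]
  by (intro smooth_on_add smooth_on_sum smooth_on_mult smooth_on_of_real image_open a_smooth
      b_smooth kap_smooth smooth_on_frechet_derivative[OF kap_smooth])

lemma P_mollify:
  assumes u: "u \<in> L2 M" and s: "0 < s" and x: "x \<in> U"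
  shows "P (mollify s u) x = cut_symbol (\<phi> x) * potential s u (\<phi> x)
    + of_real (cut (\<phi> x)) * (\<Sum>i\<in>Basis. a i (\<phi> x) * potential_deriv s u (\<phi> x) i)"
proof -
  have "((\<lambda>z. complex_of_real (cut z) * potential s u z) has_derivative
      (\<lambda>v. of_real (cut (\<phi> x)) * potential_deriv s u (\<phi> x) v
        + of_real (bump_deriv (2 * r) (\<phi> x - y0) v) * potential s u (\<phi> x))) (at (\<phi> x))"
    by (rule has_derivative_mult[OF has_derivative_of_real[OF cut_has_derivative]
          potential_has_derivative[OF u s]])
  from P_extend[OF mollify_smooth[OF u s, unfolded mollify_def] x this]
  show ?thesis
    unfolding mollify_def cut_symbol_def
    by (simp add: algebra_simps sum.distrib sum_distrib_left sum_distrib_right)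
qed

text \<open>The kernel of \<open>potential s\<close> at the fixed point \<open>z\<close>, weight
  included, read as a test function of the integration variable. Pairing it with \<open>v\<close>
  is, by the adjoint identity, pairing its transpose with \<open>u\<close>.\<close>

definition kernel_test :: "real \<Rightarrow> 'e \<Rightarrow> 'a \<Rightarrow> complex"
  where "kernel_test s z = extend_chart U \<phi> (\<lambda>y. of_real (kap y * bump s (z - y)))"

lemma kernel_test_smooth: "kernel_test s z \<in> smooth_functions A"
  unfolding kernel_test_def
proof (rule extend_smooth)
  have "(\<lambda>y. bump s (z - y)) = (\<lambda>y. bump s (y - z))"
    using bump_minus[of s "_ - _"] by (metis minus_diff_eq)
  then have "smooth_on (\<phi> ` U) (\<lambda>y. bump s (z - y))"
    using smooth_on_bump_shift[OF image_open, of s z] by simp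
  then show "smooth_on (\<phi> ` U) (\<lambda>y. complex_of_real (kap y * bump s (z - y)))"
    by (intro smooth_on_of_real smooth_on_mult image_open kap_smooth)
qed (simp add: kap_eq_0)

lemma kernel_test_eq: "kernel_test s z y = of_real (bump s (z - coord y)) * of_real (kapX y)"
  by (simp add: kernel_test_def kapX_def extend_chart_def)

text \<open>Differentiating \<open>bump s (z - y)\<close> in \<open>y\<close> rather than in
  \<open>z\<close> changes the sign. The kernel is real, so the conjugations in
  \<open>transpose_op\<close> affect only the coefficients.\<close>

lemma transpose_kernel_test:
  assumes y: "y \<in> U"
  shows "transpose_op (kernel_test s z) y = cnj (kap_symbol (\<phi> y)) * of_real (bump s (z - \<phi> y))
    - of_real (kap (\<phi> y)) * (\<Sum>i\<in>Basis. cnj (a i (\<phi> y)) * of_real (bump_deriv s (z - \<phi> y) i))"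
proof -
  let ?K = "frechet_derivative kap (at (\<phi> y))"
  have "((\<lambda>t. z - t) has_derivative (\<lambda>v. - v)) (at (\<phi> y))" by (auto intro!: derivative_eq_intros)
  from diff_chain_at[OF this bump_has_derivative]
  have "((\<lambda>t. bump s (z - t)) has_derivative (\<lambda>v. bump_deriv s (z - \<phi> y) (- v))) (at (\<phi> y))"
    by (simp add: o_def)
  moreover have "bump_deriv s (z - \<phi> y) (- v) = - bump_deriv s (z - \<phi> y) v" for v
    by (simp add: bump_deriv_def)
  ultimately have 1: "((\<lambda>t. bump s (z - t)) has_derivative (\<lambda>v. - bump_deriv s (z - \<phi> y) v)) (at (\<phi> y))"
    by simp
  have 2: "(kap has_derivative ?K) (at (\<phi> y))"
    by (rule smooth_on_has_derivative[OF kap_smooth image_open]) (use y in auto)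
  have "((\<lambda>t. complex_of_real (kap t * bump s (z - t))) has_derivative
      (\<lambda>v. of_real (kap (\<phi> y) * - bump_deriv s (z - \<phi> y) v + ?K v * bump s (z - \<phi> y)))) (at (\<phi> y))"
    by (rule has_derivative_of_real[OF has_derivative_mult[OF 2 1]])
  from P_extend[OF kernel_test_smooth[of s z, unfolded kernel_test_def] y this]
  have "P (kernel_test s z) y = kap_symbol (\<phi> y) * of_real (bump s (z - \<phi> y))
    - of_real (kap (\<phi> y)) * (\<Sum>i\<in>Basis. a i (\<phi> y) * of_real (bump_deriv s (z - \<phi> y) i))"
    unfolding kernel_test_def kap_symbol_def
    by (simp add: algebra_simps sum.distrib sum_subtractf sum_distrib_left sum_distrib_right)
  moreover have "(\<lambda>y. cnj (kernel_test s z y)) = kernel_test s z"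
    by (rule ext) (simp add: kernel_test_eq)
  ultimately show ?thesis by (simp add: transpose_op_def)
qed

text \<open>\<open>S\<close> collects the kernel derivatives with coefficients at \<open>x\<close>;
  \<open>V\<close> is the mollification of \<open>v\<close>, rewritten by the transposed kernel with
  coefficients at \<open>y\<close>. In \<open>S - V\<close> the coefficients enter as differences,
  which absorb the factor \<open>1 / s\<close>, so every kernel involved is bounded by a constant on
  \<open>near_pairs s\<close>.\<close>

lemma P_mollify_bound:
  obtains C where "0 < C" "\<And>s u v x. 0 < s \<Longrightarrow> (u, v) \<in> adjoint_graph A M P \<Longrightarrow>
    (\<And>y. u y \<noteq> 0 \<Longrightarrow> y \<in> U \<and> norm (\<phi> y - y0) < 2 * r) \<Longrightarrow>
    ennreal (cmod (P (mollify s u) x)) \<le>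
      ennreal C * (\<integral>\<^sup>+y. indicator (near_pairs s) (x, y) * ennreal (cmod (u y) + cmod (v y)) \<partial>M)"
proof -
  obtain Ck where Ck: "0 < Ck" "\<And>x. \<bar>kapX x\<bar> \<le> Ck" by (rule kapX_bounded) blast
  obtain Cs where Cs: "0 < Cs" "\<And>z. z \<in> cball y0 (4 * r) \<Longrightarrow> norm (cut_symbol z) \<le> Cs"
    by (rule continuous_on_bounded[OF cut_symbol_smooth]) blast
  obtain Cq where Cq: "0 < Cq" "\<And>z. z \<in> cball y0 (4 * r) \<Longrightarrow> norm (kap_symbol z) \<le> Cq"
    by (rule continuous_on_bounded[OF kap_symbol_smooth]) blast
  obtain Cb where Cb: "0 < Cb"
    "\<And>s (d::'e) v. 0 < s \<Longrightarrow> \<bar>bump_deriv s d v\<bar> \<le> Cb / s * norm v"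
    by (rule bump_deriv_bound) blast
  have "\<exists>L. 0 < L \<and> (i \<in> Basis \<longrightarrow> (\<forall>x\<in>cball y0 (4 * r). \<forall>y\<in>cball y0 (4 * r).
      norm (a i x - a i y) \<le> L * norm (x - y)))" for i
  proof (cases "i \<in> Basis")
    case True
    show ?thesis by (rule smooth_on_lipschitz[OF a_smooth[OF True]]) blast
  qed (auto intro: exI[of _ 1])
  then obtain L where L: "\<And>i. 0 < L i" "\<And>i x y. i \<in> Basis \<Longrightarrow> x \<in> cball y0 (4 * r) \<Longrightarrow>
      y \<in> cball y0 (4 * r) \<Longrightarrow> norm (a i x - a i y) \<le> L i * norm (x - y)"
    by metis
  \<comment> \<open>Bounds the kernel of \<open>S - V\<close>: the sum comes from the coefficient
    differences, \<open>Cq\<close> from \<open>kap_symbol\<close>.\<close>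
  define C3 where "C3 = Ck * (\<Sum>i\<in>Basis. L i * (2 * Cb)) + Cq"
  have C3: "0 \<le> C3"
    unfolding C3_def using Ck Cq Cb L(1)
    by (intro add_nonneg_nonneg mult_nonneg_nonneg sum_nonneg) (auto intro: less_imp_le)
  \<comment> \<open>One contribution each from \<open>cut_symbol\<close> times \<open>F\<close>,
    from \<open>S - V\<close> and from \<open>V\<close>.\<close>
  define C where "C = Cs * Ck + (C3 + Ck)"
  have C: "0 < C" unfolding C_def using Cs Ck C3 by (simp add: add_pos_nonneg)
  have "ennreal (cmod (P (mollify s u) x)) \<le>
      ennreal C * (\<integral>\<^sup>+y. indicator (near_pairs s) (x, y) * ennreal (cmod (u y) + cmod (v y)) \<partial>M)"
    if s: "0 < s" and uv: "(u, v) \<in> adjoint_graph A M P"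
      and supp: "\<And>y. u y \<noteq> 0 \<Longrightarrow> y \<in> U \<and> norm (\<phi> y - y0) < 2 * r" for s u v x
  proof (cases "x \<in> patch")
    case False
    have "P (mollify s u) x = 0"
    \<comment> \<open>Inside \<open>U\<close> but off the patch, the cutoff and its derivative
      vanish. Outside \<open>U\<close> locality of \<open>P\<close> takes over.\<close>
    proof (cases "x \<in> U")
      case True
      then have out: "\<phi> x \<notin> cball y0 (4 * r)" using False by (simp add: patch_def)
      then have "bump_deriv (2 * r) (\<phi> x - y0) i = 0" for i
        using r by (intro bump_deriv_eq_0) (auto simp: dist_norm norm_minus_commute)
      then have "cut_symbol (\<phi> x) = 0" using cut_eq_0[OF out] by (simp add: cut_symbol_def)
      then show ?thesis
        using P_mollify[OF _ s True, of u] uv cut_eq_0[OF out] by (simp add: adjoint_graph_iff)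
    next
      case False
      then show ?thesis
        using uv by (intro P_eq_0_outside mollify_smooth mollify_eq_0 s) (auto simp: adjoint_graph_iff)
    qed
    then show ?thesis by simp
  next
    case x: True
    then have xU: "x \<in> U" and xK: "\<phi> x \<in> cball y0 (4 * r)" by (auto simp: patch_def)
    note uv_def = uv[unfolded adjoint_graph_iff]
    have uL: "u \<in> L2 M" and vL: "v \<in> L2 M" using uv_def by auto
    have [measurable]: "u \<in> borel_measurable M" "v \<in> borel_measurable M"
      using uL vL by (simp_all add: L2_measurable)
    have "x \<in> space M" by simp
    then have [measurable]: "(\<lambda>y. indicator (near_pairs s) (x, y) :: ennreal) \<in> borel_measurable M"
      by measurable
    let ?z = "\<phi> x"
    define R where "R = (\<integral>\<^sup>+y. indicator (near_pairs s) (x, y) * ennreal (cmod (u y) + cmod (v y)) \<partial>M)"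
    have Ru: "(\<integral>\<^sup>+y. indicator (near_pairs s) (x, y) * ennreal (cmod (u y)) \<partial>M) \<le> R"
      and Rv: "(\<integral>\<^sup>+y. indicator (near_pairs s) (x, y) * ennreal (cmod (v y)) \<partial>M) \<le> R"
      unfolding R_def by (intro nn_integral_mono mult_left_mono ennreal_leI; simp)+
    define F where "F = potential s u ?z"
    define S where "S = (\<Sum>i\<in>Basis. a i ?z * potential_deriv s u ?z i)"
    define V where "V = (\<integral>y. of_real (bump s (?z - coord y)) * (of_real (kapX y) * v y) \<partial>M)"
    have eF: "ennreal (cmod F) \<le> ennreal Ck * R"
    proof -
      have "ennreal (cmod F)
          \<le> ennreal Ck * (\<integral>\<^sup>+y. indicator (near_pairs s) (x, y) * ennreal (cmod (u y)) \<partial>M)"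
        unfolding F_def potential_def
        by (rule kernel_bound) (use Ck in \<open>auto intro!: AE_I2 kapX_kernel_bound[OF Ck(2) s x]\<close>)
      also have "\<dots> \<le> ennreal Ck * R" by (intro mult_left_mono Ru) simp
      finally show ?thesis .
    qed
    have eV: "ennreal (cmod V) \<le> ennreal Ck * R"
    proof -
      have "ennreal (cmod V)
          \<le> ennreal Ck * (\<integral>\<^sup>+y. indicator (near_pairs s) (x, y) * ennreal (cmod (v y)) \<partial>M)"
        unfolding V_def
        by (rule kernel_bound) (use Ck in \<open>auto intro!: AE_I2 kapX_kernel_bound[OF Ck(2) s x]\<close>)
      also have "\<dots> \<le> ennreal Ck * R" by (intro mult_left_mono Rv) simp
      finally show ?thesis .
    qed
    have eSV: "ennreal (cmod (S - V)) \<le> ennreal C3 * R"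
    proof -
      let ?T = "transpose_op (kernel_test s ?z)"
      define f where "f y = (\<Sum>i\<in>Basis. a i ?z *
        (of_real (bump_deriv s (?z - coord y) i) * (of_real (kapX y) * u y))) - u y * ?T y" for y
      have Tsm: "?T \<in> smooth_functions A" by (rule transpose_op_smooth[OF kernel_test_smooth])
      \<comment> \<open>Here \<open>v\<close> is linked to \<open>u\<close>: the adjoint identity is
        used with the kernel as test function.\<close>
      have "V = (\<integral>y. v y * kernel_test s ?z y \<partial>M)"
        by (simp add: V_def kernel_test_eq mult_ac)
      also have "\<dots> = (\<integral>y. u y * ?T y \<partial>M)"
        using uv_def kernel_test_smooth by blast
      finally have "S - V = (\<integral>y. f y \<partial>M)"
        unfolding S_def potential_deriv_def f_def[abs_def]
        using L2_mult_integrable[OF uL smooth_L2[OF Tsm]] potential_integrable(2)[OF uL s]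
        by simp
      moreover have "AE y in M. norm (f y) \<le> C3 * indicator (near_pairs s) (x, y) * cmod (u y)"
      proof -
        have "AE y in M. \<forall>i\<in>Basis. y \<in> U \<longrightarrow> norm (\<phi> y - y0) < 2 * r \<longrightarrow> Re (a i (\<phi> y)) = 0"
          by (intro AE_finite_allI real_symbol_chart) simp_all
        then show ?thesis
        proof (rule eventually_mono)
          fix y assume sym: "\<forall>i\<in>Basis. y \<in> U \<longrightarrow> norm (\<phi> y - y0) < 2 * r \<longrightarrow> Re (a i (\<phi> y)) = 0"
          show "norm (f y) \<le> C3 * indicator (near_pairs s) (x, y) * cmod (u y)"
          proof (cases "u y = 0")
            case True
            then show ?thesis by (simp add: f_def)
          next
            case False
            then have yU: "y \<in> U" and near: "norm (\<phi> y - y0) < 2 * r" using supp by auto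
            then have yK: "\<phi> y \<in> cball y0 (4 * r)" using r by (simp add: dist_norm norm_minus_commute)
            then have yp: "y \<in> patch" using yU by (simp add: patch_def)
            \<comment> \<open>Skewness turns the conjugated coefficient at \<open>y\<close>, with
              its sign, into the one that is subtracted from the coefficient at \<open>x\<close>. It
              is available because \<open>u\<close> lives where the real parts vanish.\<close>
            have anti: "cnj (a i (\<phi> y)) = - a i (\<phi> y)" if "i \<in> Basis" for i
              using sym that yU near by (simp add: complex_eq_iff)
            let ?bd = "\<lambda>i. complex_of_real (bump_deriv s (?z - \<phi> y) i)"
            let ?k = "complex_of_real (kap (\<phi> y))"
            have kX: "kapX y = kap (\<phi> y)" using yU by (simp add: kapX_def extend_chart_def)
            define S1 S2 where "S1 = (\<Sum>i\<in>Basis. a i ?z * ?bd i)"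
              and "S2 = (\<Sum>i\<in>Basis. a i (\<phi> y) * ?bd i)"
            have "(\<Sum>i\<in>Basis. cnj (a i (\<phi> y)) * ?bd i) = - S2"
              by (simp add: S2_def anti sum_negf cong: sum.cong)
            then have T: "?T y = cnj (kap_symbol (\<phi> y)) * of_real (bump s (?z - \<phi> y)) + ?k * S2"
              by (simp add: transpose_kernel_test[OF yU])
            have "f y = u y * (?k * S1) - u y * ?T y"
              using yU kX by (simp add: f_def S1_def sum_distrib_left mult_ac)
            also have "\<dots> = u y * (?k * (S1 - S2)
                - cnj (kap_symbol (\<phi> y)) * of_real (bump s (?z - \<phi> y)))"
              unfolding T by (simp add: algebra_simps)
            also have "S1 - S2 = (\<Sum>i\<in>Basis. (a i ?z - a i (\<phi> y)) * ?bd i)"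
              by (simp add: S1_def S2_def left_diff_distrib sum_subtractf)
            finally have f_eq: "f y = u y * (?k * (\<Sum>i\<in>Basis. (a i ?z - a i (\<phi> y)) * ?bd i)
                - cnj (kap_symbol (\<phi> y)) * of_real (bump s (?z - \<phi> y)))" .
            show ?thesis
            proof (cases "norm (?z - \<phi> y) \<le> 2 * s")
              case False
              then have "f y = 0"
                unfolding f_eq using s by (simp add: bump_deriv_eq_0 bump_eq_0)
              then show ?thesis using C3 by simp
            next
              case True
              then have np: "(x, y) \<in> near_pairs s" using x yp near_pairsI by blast
              \<comment> \<open>Lipschitz bound \<open>L i * (2 * s)\<close> against derivative
                bound \<open>Cb / s\<close>: the scale cancels.\<close>
              have summand: "norm ((a i ?z - a i (\<phi> y)) * ?bd i) \<le> L i * (2 * Cb)" if i: "i \<in> Basis" for i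
              proof -
                have "norm (a i ?z - a i (\<phi> y)) \<le> L i * norm (?z - \<phi> y)" by (rule L(2)[OF i xK yK])
                also have "\<dots> \<le> L i * (2 * s)" using True L(1)[of i] by (intro mult_left_mono) auto
                finally have "norm (a i ?z - a i (\<phi> y)) * norm (?bd i) \<le> (L i * (2 * s)) * (Cb / s)"
                  using Cb(2)[OF s, of "?z - \<phi> y" i] i L(1)[of i] s by (intro mult_mono) auto
                then show ?thesis using s by (simp add: norm_mult)
              qed
              have "norm (\<Sum>i\<in>Basis. (a i ?z - a i (\<phi> y)) * ?bd i) \<le> (\<Sum>i\<in>Basis. L i * (2 * Cb))"
                using summand by (rule sum_norm_le)
              then have 1: "norm (?k * (\<Sum>i\<in>Basis. (a i ?z - a i (\<phi> y)) * ?bd i))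
                  \<le> Ck * (\<Sum>i\<in>Basis. L i * (2 * Cb))"
                unfolding norm_mult using Ck(2)[of y] Ck(1) kX by (intro mult_mono) auto
              have "norm (kap_symbol (\<phi> y)) * \<bar>bump s (?z - \<phi> y)\<bar> \<le> Cq * 1"
                using Cq(2)[OF yK] Cq(1) by (intro mult_mono) (auto simp: bump_bounds abs_of_nonneg)
              then have 2: "norm (cnj (kap_symbol (\<phi> y)) * of_real (bump s (?z - \<phi> y))) \<le> Cq"
                by (simp add: norm_mult)
              have 3: "norm (?k * (\<Sum>i\<in>Basis. (a i ?z - a i (\<phi> y)) * ?bd i)
                - cnj (kap_symbol (\<phi> y)) * of_real (bump s (?z - \<phi> y))) \<le> C3"
                unfolding C3_def using norm_triangle_ineq4 1 2 by (rule order_trans[OF _ add_mono])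
              have "norm (f y) = cmod (u y) * norm (?k * (\<Sum>i\<in>Basis. (a i ?z - a i (\<phi> y)) * ?bd i)
                - cnj (kap_symbol (\<phi> y)) * of_real (bump s (?z - \<phi> y)))"
                unfolding f_eq by (rule norm_mult)
              also have "\<dots> \<le> cmod (u y) * C3" by (rule mult_left_mono[OF 3]) simp
              finally show ?thesis using np by (simp add: mult.commute)
            qed
          qed
        qed
      qed
      ultimately have "ennreal (cmod (S - V))
          \<le> ennreal C3 * (\<integral>\<^sup>+y. indicator (near_pairs s) (x, y) * ennreal (cmod (u y)) \<partial>M)"
        using C3 by (simp add: kernel_bound)
      also have "\<dots> \<le> ennreal C3 * R" by (intro mult_left_mono Ru) simp
      finally show ?thesis .
    qed
    have "cmod (P (mollify s u) x) \<le> Cs * cmod F + (cmod (S - V) + cmod V)"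
    proof -
      have "P (mollify s u) x = cut_symbol ?z * F + of_real (cut ?z) * S"
        using P_mollify[OF uL s xU] by (simp add: F_def S_def)
      then have "cmod (P (mollify s u) x) \<le> cmod (cut_symbol ?z) * cmod F + \<bar>cut ?z\<bar> * cmod S"
        using norm_triangle_ineq[of "cut_symbol ?z * F" "of_real (cut ?z) * S"] by (simp add: norm_mult)
      also have "\<dots> \<le> Cs * cmod F + 1 * cmod S"
        using Cs(2)[OF xK] cut_bounds[of ?z] by (intro add_mono mult_right_mono) auto
      also have "cmod S \<le> cmod (S - V) + cmod V"
        using norm_triangle_ineq[of "S - V" V] by simp
      finally show ?thesis by simp
    qed
    then have "ennreal (cmod (P (mollify s u) x)) \<le> ennreal (Cs * cmod F + (cmod (S - V) + cmod V))"
      by (rule ennreal_leI)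
    also have "\<dots> = ennreal Cs * ennreal (cmod F) + (ennreal (cmod (S - V)) + ennreal (cmod V))"
      using Cs(1) by (simp add: ennreal_plus ennreal_mult)
    also have "\<dots> \<le> ennreal Cs * (ennreal Ck * R) + (ennreal C3 * R + ennreal Ck * R)"
      by (intro add_mono mult_left_mono eF eSV eV) simp
    also have "\<dots> = ennreal C * R"
      using Cs(1) Ck(1) C3 by (simp add: C_def ennreal_plus ennreal_mult distrib_right mult.assoc)
    finally show ?thesis unfolding R_def .
  qed
  with C show thesis by (rule that)
qed

section \<open>Weak convergence of the normalized mollified functions\<close>

lemma mollify_eq: "mollify s u x = of_real (extend_chart U \<phi> cut x) * potential s u (coord x)"
  by (simp add: mollify_def extend_chart_def)

text \<open>In coordinates this is the bump integrated against \<open>q\<close>, the product of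
  density, cutoff and \<open>g\<close>. Being Lipschitz, \<open>q\<close> varies by at most
  \<open>e\<close> on the support of the kernel. The density left in the main term is removed later
  by the weight.\<close>

lemma approximate_identity:
  assumes g: "g \<in> smooth_functions A" and e: "0 < e"
  obtains d where "0 < d" "\<And>s y. 0 < s \<Longrightarrow> s < d \<Longrightarrow> y \<in> U \<Longrightarrow> norm (\<phi> y - y0) < 2 * r \<Longrightarrow>
    norm ((\<integral>x. of_real (extend_chart U \<phi> cut x * bump s (coord x - \<phi> y)) * g x \<partial>M)
      - bump_mass TYPE('e) s *\<^sub>R (of_real (w (\<phi> y)) * g y)) \<le> bump_mass TYPE('e) s * e"
proof -
  define q where "q z = complex_of_real (w z * cut z) * g (inv_into U \<phi> z)" for z
  have q_smooth: "smooth_on (\<phi> ` U) q"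
    unfolding q_def[abs_def]
    by (intro smooth_on_mult smooth_on_of_real image_open w_smooth cut_smooth smooth_functionsD[OF g U])
  obtain L where L: "0 < L" "\<And>x y. x \<in> cball y0 (4 * r) \<Longrightarrow> y \<in> cball y0 (4 * r) \<Longrightarrow>
      norm (q x - q y) \<le> L * norm (x - y)"
    by (rule smooth_on_lipschitz[OF q_smooth]) blast
  obtain C where C: "0 < C" "\<And>z. z \<in> cball y0 (4 * r) \<Longrightarrow> norm (q z) \<le> C"
    by (rule continuous_on_bounded[OF q_smooth]) blast
  define h where "h z = indicator (\<phi> ` U) z *\<^sub>R q z" for z
  have [measurable]: "h \<in> borel_measurable borel"
    unfolding h_def[abs_def]
    by (rule borel_measurable_continuous_on_indicator[OF chart_image_borel[OF U]
          smooth_on_imp_continuous_on[OF q_smooth]])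
  have h_eq: "h z = q z" if "z \<in> cball y0 (4 * r)" for z
    using that ball by (auto simp: h_def)
  have h_bound: "norm (h z) \<le> C" for z
  proof (cases "z \<in> cball y0 (4 * r)")
    case True
    then show ?thesis using C h_eq by simp
  next
    case False
    then show ?thesis using C(1) by (simp add: h_def q_def cut_eq_0)
  qed
  \<comment> \<open>Scales below \<open>r\<close> keep the kernel, of radius \<open>2 * s\<close>
    about a point within \<open>2 * r\<close>, inside the ball of radius \<open>4 * r\<close>;
    scales below \<open>e / (2 * L)\<close> make the variation at most \<open>e\<close>.\<close>
  define d where "d = min r (e / (2 * L))"
  have d: "0 < d" using r e L by (simp add: d_def)
  have "norm ((\<integral>x. of_real (extend_chart U \<phi> cut x * bump s (coord x - \<phi> y)) * g x \<partial>M)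
      - bump_mass TYPE('e) s *\<^sub>R (of_real (w (\<phi> y)) * g y)) \<le> bump_mass TYPE('e) s * e"
    if s: "0 < s" "s < d" and y: "y \<in> U" "norm (\<phi> y - y0) < 2 * r" for s y
  proof -
    let ?t = "\<phi> y"
    define k where "k z = indicator (\<phi> ` U) z *\<^sub>R
      (complex_of_real (cut z * bump s (z - ?t)) * g (inv_into U \<phi> z))" for z
    have k: "k \<in> borel_measurable borel"
      unfolding k_def[abs_def]
      by (rule borel_measurable_continuous_on_indicator[OF chart_image_borel[OF U]
            smooth_on_imp_continuous_on])
         (intro smooth_on_mult smooth_on_of_real image_open cut_smooth smooth_on_bump_shift
           smooth_functionsD[OF g U])
    have "(\<integral>x. of_real (extend_chart U \<phi> cut x * bump s (coord x - ?t)) * g x \<partial>M)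
        = (\<integral>x. indicator U x *\<^sub>R k (\<phi> x) \<partial>M)"
      by (rule Bochner_Integration.integral_cong[OF refl])
         (simp add: k_def extend_chart_def chart(5)[OF U])
    also have "\<dots> = (\<integral>z. (indicator (\<phi> ` U) z * w z) *\<^sub>R k z \<partial>lborel)"
      by (rule chart_integral[OF k])
    also have "\<dots> = (\<integral>z. bump s (z - ?t) *\<^sub>R h z \<partial>lborel)"
      by (rule Bochner_Integration.integral_cong[OF refl])
         (simp add: k_def h_def q_def indicator_def scaleR_conv_of_real)
    finally have lhs: "(\<integral>x. of_real (extend_chart U \<phi> cut x * bump s (coord x - ?t)) * g x \<partial>M)
        = (\<integral>z. bump s (z - ?t) *\<^sub>R h z \<partial>lborel)" .
    have tK: "?t \<in> cball y0 (4 * r)" using y(2) r by (simp add: dist_norm norm_minus_commute)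
    have ht: "h ?t = of_real (w ?t) * g y"
      using h_eq[OF tK] cut_eq_1[of ?t] y by (simp add: q_def chart(5)[OF U])
    have bi: "integrable lborel (\<lambda>z. bump s (z - ?t))" by (rule bump_shift_integrable[OF s(1)])
    have hi: "integrable lborel (\<lambda>z. bump s (z - ?t) *\<^sub>R h z)"
    proof (rule Bochner_Integration.integrable_bound)
      show "integrable lborel (\<lambda>z. bump s (z - ?t) * C)" using bi by simp
      show "AE z in lborel. norm (bump s (z - ?t) *\<^sub>R h z) \<le> norm (bump s (z - ?t) * C)"
        using h_bound C(1) by (auto intro!: AE_I2 mult_left_mono simp: abs_mult)
    qed measurable
    have hti: "integrable lborel (\<lambda>z. bump s (z - ?t) *\<^sub>R h ?t)" using bi by simp
    have "(\<integral>z. bump s (z - ?t) *\<^sub>R h z \<partial>lborel) - bump_mass TYPE('e) s *\<^sub>R h ?t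
        = (\<integral>z. bump s (z - ?t) *\<^sub>R h z \<partial>lborel) - (\<integral>z. bump s (z - ?t) *\<^sub>R h ?t \<partial>lborel)"
      using bi by (simp add: bump_shift_integral)
    also have "\<dots> = (\<integral>z. bump s (z - ?t) *\<^sub>R h z - bump s (z - ?t) *\<^sub>R h ?t \<partial>lborel)"
      by (rule Bochner_Integration.integral_diff[symmetric, OF hi hti])
    also have "norm \<dots> \<le> (\<integral>z. bump s (z - ?t) * e \<partial>lborel)"
    proof (rule norm_integral_le)
      show "norm (bump s (z - ?t) *\<^sub>R h z - bump s (z - ?t) *\<^sub>R h ?t) \<le> bump s (z - ?t) * e" for z
      proof (cases "norm (z - ?t) < 2 * s")
        case True
        have "norm (z - y0) \<le> norm (z - ?t) + norm (?t - y0)"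
          using norm_triangle_ineq[of "z - ?t" "?t - y0"] by simp
        also have "\<dots> \<le> 4 * r" using True s(2) y(2) by (simp add: d_def)
        finally have zK: "z \<in> cball y0 (4 * r)" by (simp add: dist_norm norm_minus_commute)
        have "norm (h z - h ?t) \<le> L * norm (z - ?t)"
          unfolding h_eq[OF zK] h_eq[OF tK] by (rule L(2)[OF zK tK])
        also have "\<dots> \<le> L * (2 * (e / (2 * L)))"
          using True s(2) L(1) by (intro mult_left_mono) (auto simp: d_def)
        also have "\<dots> = e" using L(1) by simp
        finally have "norm (h z - h ?t) \<le> e" .
        moreover have "norm (bump s (z - ?t) *\<^sub>R h z - bump s (z - ?t) *\<^sub>R h ?t)
            = bump s (z - ?t) * norm (h z - h ?t)"
          unfolding scaleR_diff_right[symmetric] norm_scaleR by (simp add: bump_bounds)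
        ultimately show ?thesis by (simp add: mult_left_mono bump_bounds)
      next
        case False
        then show ?thesis using s(1) by (simp add: bump_eq_0)
      qed
    qed (use hi hti bi in auto)
    also have "\<dots> = bump_mass TYPE('e) s * e" by (simp add: bump_shift_integral)
    finally show ?thesis unfolding lhs ht by simp
  qed
  with d show thesis by (rule that)
qed

lemma L2_integrable: "u \<in> L2 M \<Longrightarrow> integrable M u"
  using L2_mult_integrable[OF smooth_L2[OF smooth_const[of 1]], of u] by simp

text \<open>Fubini moves the mollification from \<open>u\<close>, which is merely square-integrable,
  to the smooth \<open>g\<close>. Absolute integrability holds since the kernel and \<open>g\<close>
  are bounded, \<open>u\<close> is integrable and \<open>M\<close> is finite.\<close>

lemma mollify_pairing:
  assumes u: "u \<in> L2 M" and g: "g \<in> smooth_functions A" and s: "0 < s"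
  defines "G \<equiv> (\<lambda>y. \<integral>x. of_real (extend_chart U \<phi> cut x * bump s (coord x - coord y)) * g x \<partial>M)"
  shows "(\<integral>x. mollify s u x * g x \<partial>M) = (\<integral>y. of_real (kapX y) * u y * G y \<partial>M)"
    and "integrable M (\<lambda>y. of_real (kapX y) * u y * G y)"
proof -
  interpret finite_measure M by (rule finite_M)
  interpret pair_sigma_finite M M by unfold_locales
  let ?c = "extend_chart U \<phi> cut"
  define H where "H x y = (of_real (?c x * bump s (coord x - coord y)) * g x) * (of_real (kapX y) * u y)"
    for x y
  have "(\<lambda>x. complex_of_real (?c x)) \<in> smooth_functions A"
  proof -
    have "(\<lambda>x. complex_of_real (?c x)) = extend_chart U \<phi> (\<lambda>y. complex_of_real (cut y))"
      by (auto simp: extend_chart_def)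
    then show ?thesis
      using extend_smooth[OF smooth_on_of_real[OF image_open cut_smooth[OF image_open]]]
      by (simp add: cut_eq_0)
  qed
  from smooth_measurable[OF this] have "(\<lambda>x. Re (complex_of_real (?c x))) \<in> borel_measurable M"
    by measurable
  then have [measurable]: "?c \<in> borel_measurable M" by simp
  from smooth_measurable[OF kapX_smooth] have "(\<lambda>x. Re (complex_of_real (kapX x))) \<in> borel_measurable M"
    by measurable
  then have [measurable]: "kapX \<in> borel_measurable M" by simp
  have [measurable]: "g \<in> borel_measurable M" "u \<in> borel_measurable M"
    using smooth_measurable[OF g] L2_measurable[OF u] by auto
  obtain Ck where Ck: "0 < Ck" "\<And>x. \<bar>kapX x\<bar> \<le> Ck" by (rule kapX_bounded) blast
  obtain Cg where Cg: "\<And>x. cmod (g x) \<le> Cg" using smooth_bounded[OF g] by blast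
  have Cg0: "0 \<le> Cg" using Cg norm_ge_zero order_trans by blast
  have Hm: "case_prod H \<in> borel_measurable (M \<Otimes>\<^sub>M M)"
    unfolding H_def by measurable
  have c1: "\<bar>?c x\<bar> \<le> 1" for x using cut_bounds by (simp add: extend_chart_def)
  have Hb: "cmod (H x y) \<le> Cg * Ck * cmod (u y)" for x y
  proof -
    have "\<bar>?c x\<bar> * \<bar>bump s (coord x - coord y)\<bar> \<le> 1 * 1"
      using c1 by (intro mult_mono) (auto simp: bump_bounds abs_of_nonneg)
    then have 1: "(\<bar>?c x\<bar> * \<bar>bump s (coord x - coord y)\<bar>) * cmod (g x) \<le> 1 * Cg"
      using Cg Cg0 by (intro mult_mono) auto
    have 2: "\<bar>kapX y\<bar> * cmod (u y) \<le> Ck * cmod (u y)"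
      by (intro mult_right_mono Ck) simp
    have "((\<bar>?c x\<bar> * \<bar>bump s (coord x - coord y)\<bar>) * cmod (g x)) * (\<bar>kapX y\<bar> * cmod (u y))
        \<le> (1 * Cg) * (Ck * cmod (u y))"
      by (rule mult_mono[OF 1 2]) (use Cg0 in auto)
    then show ?thesis by (simp add: H_def norm_mult abs_mult mult_ac)
  qed
  have Hint: "integrable (M \<Otimes>\<^sub>M M) (case_prod H)"
  proof (rule integrableI_bounded[OF Hm])
    have "(\<integral>\<^sup>+p. ennreal (norm (case_prod H p)) \<partial>(M \<Otimes>\<^sub>M M)) =
        (\<integral>\<^sup>+x. \<integral>\<^sup>+y. ennreal (norm (H x y)) \<partial>M \<partial>M)"
      using sigma_finite_measure.nn_integral_fst[OF finite_measure.axioms(1)[OF finite_M], of "\<lambda>p. ennreal (norm (case_prod H p))" M] Hm by simp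
    also have "\<dots> \<le> (\<integral>\<^sup>+x. \<integral>\<^sup>+y. ennreal (Cg * Ck * cmod (u y)) \<partial>M \<partial>M)"
      by (intro nn_integral_mono ennreal_leI Hb)
    also have "\<dots> = (\<integral>\<^sup>+y. ennreal (Cg * Ck * cmod (u y)) \<partial>M) * emeasure M UNIV" by simp
    also have "\<dots> < \<infinity>"
    proof -
      have "integrable M (\<lambda>y. Cg * Ck * cmod (u y))" using L2_integrable[OF u] by simp
      then have "(\<integral>\<^sup>+y. ennreal (norm (Cg * Ck * cmod (u y))) \<partial>M) < \<infinity>"
        by (simp only: integrable_iff_bounded)
      then have "(\<integral>\<^sup>+y. ennreal (Cg * Ck * cmod (u y)) \<partial>M) < \<infinity>"
        using Cg0 Ck(1) by (simp add: abs_mult)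
      moreover have "emeasure M UNIV < \<infinity>"
        using finite_measure.emeasure_finite[OF finite_M, of UNIV]
        by (simp add: less_top[symmetric])
      ultimately show ?thesis by (simp add: ennreal_mult_less_top)
    qed
    finally show "(\<integral>\<^sup>+p. ennreal (norm (case_prod H p)) \<partial>(M \<Otimes>\<^sub>M M)) < \<infinity>" .
  qed
  have Hx: "mollify s u x * g x = (\<integral>y. H x y \<partial>M)" for x
  proof -
    have "(\<integral>y. H x y \<partial>M) = (\<integral>y. (of_real (?c x) * g x) *
        (of_real (bump s (coord x - coord y)) * (of_real (kapX y) * u y)) \<partial>M)"
      by (simp add: H_def mult_ac)
    also have "\<dots> = (of_real (?c x) * g x) * potential s u (coord x)"
      unfolding potential_def by simp
    finally show ?thesis by (simp add: mollify_eq mult_ac)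
  qed
  have Hy: "(\<integral>x. H x y \<partial>M) = of_real (kapX y) * u y * G y" for y
    unfolding H_def G_def by (simp add: mult.commute[of "of_real (kapX y) * u y"])
  show "(\<integral>x. mollify s u x * g x \<partial>M) = (\<integral>y. of_real (kapX y) * u y * G y \<partial>M)"
    unfolding Hx Hy[symmetric] integral_fst[OF Hint] integral_snd[OF Hint] ..
  show "integrable M (\<lambda>y. of_real (kapX y) * u y * G y)"
    using integrable_snd[OF Hint] unfolding Hy .
qed

text \<open>After Fubini the averages of \<open>g\<close> converge uniformly on the support of
  \<open>u\<close>. There the cutoff is 1, so weight times density is 1 and the product of
  \<open>u\<close> and \<open>g\<close> remains.\<close>

lemma mollify_weak_limit:
  assumes u: "u \<in> L2 M" and g: "g \<in> smooth_functions A"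
    and supp: "\<And>y. u y \<noteq> 0 \<Longrightarrow> y \<in> U \<and> norm (\<phi> y - y0) < 2 * r"
    and s: "\<And>n::nat. 0 < s n" "s \<longlonglongrightarrow> 0"
  shows "(\<lambda>n. \<integral>x. of_real (1 / bump_mass TYPE('e) (s n)) * mollify (s n) u x * g x \<partial>M)
    \<longlonglongrightarrow> (\<integral>x. u x * g x \<partial>M)"
proof (rule tendstoI)
  fix e :: real assume e: "0 < e"
  obtain Ck where Ck: "0 < Ck" "\<And>x. \<bar>kapX x\<bar> \<le> Ck" by (rule kapX_bounded) blast
  define I where "I = (\<integral>y. cmod (u y) \<partial>M)"
  have I: "0 \<le> I" by (simp add: I_def)
  \<comment> \<open>Keeps the final error \<open>Ck * I * e'\<close> strictly below
    \<open>e\<close>, also when \<open>I = 0\<close>.\<close>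
  define e' where "e' = e / (Ck * (I + 1))"
  have e': "0 < e'" using e Ck I by (simp add: e'_def)
  obtain d where d: "0 < d" "\<And>s y. 0 < s \<Longrightarrow> s < d \<Longrightarrow> y \<in> U \<Longrightarrow> norm (\<phi> y - y0) < 2 * r \<Longrightarrow>
    norm ((\<integral>x. of_real (extend_chart U \<phi> cut x * bump s (coord x - \<phi> y)) * g x \<partial>M)
      - bump_mass TYPE('e) s *\<^sub>R (of_real (w (\<phi> y)) * g y)) \<le> bump_mass TYPE('e) s * e'"
    by (rule approximate_identity[OF g e']) blast
  have "\<forall>\<^sub>F n in sequentially. s n < d" using order_tendstoD(2)[OF s(2) d(1)] .
  then show "\<forall>\<^sub>F n in sequentially. dist (\<integral>x. of_real (1 / bump_mass TYPE('e) (s n)) *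
      mollify (s n) u x * g x \<partial>M) (\<integral>x. u x * g x \<partial>M) < e"
  proof eventually_elim
    case (elim n)
    define N where "N = bump_mass TYPE('e) (s n)"
    have N: "0 < N" unfolding N_def by (rule bump_mass_pos[OF s(1)])
    define G where "G y = (\<integral>x. of_real (extend_chart U \<phi> cut x * bump (s n) (coord x - coord y)) * g x \<partial>M)"
      for y
    note pairing = mollify_pairing[OF u g s(1)[of n], folded G_def]
    have ug: "integrable M (\<lambda>y. u y * g y)" by (rule L2_mult_integrable[OF u smooth_L2[OF g]])
    have "(\<integral>x. of_real (1 / N) * mollify (s n) u x * g x \<partial>M)
        = of_real (1 / N) * (\<integral>x. mollify (s n) u x * g x \<partial>M)"
      by (simp add: mult.assoc)
    also have "\<dots> = (\<integral>y. of_real (1 / N) * (of_real (kapX y) * u y * G y) \<partial>M)"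
      unfolding pairing(1) by simp
    finally have "(\<integral>x. of_real (1 / N) * mollify (s n) u x * g x \<partial>M) - (\<integral>x. u x * g x \<partial>M)
        = (\<integral>y. of_real (1 / N) * (of_real (kapX y) * u y * G y) - u y * g y \<partial>M)"
      using pairing(2) ug by simp
    also have "norm \<dots> \<le> (\<integral>y. Ck * e' * cmod (u y) \<partial>M)"
    proof (rule norm_integral_le)
      fix y
      show "norm (of_real (1 / N) * (of_real (kapX y) * u y * G y) - u y * g y) \<le> Ck * e' * cmod (u y)"
      proof (cases "u y = 0")
        case False
        then have y: "y \<in> U" "norm (\<phi> y - y0) < 2 * r" using supp by auto
        have wy: "0 < w (\<phi> y)" using w_pos y(1) by simp
        have kw: "kapX y * w (\<phi> y) = 1"
          using y wy cut_eq_1[of "\<phi> y"] by (simp add: kapX_def extend_chart_def kap_def)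
        have close: "norm (G y - N *\<^sub>R (of_real (w (\<phi> y)) * g y)) \<le> N * e'"
          using d(2)[OF s(1) elim y] y(1) by (simp add: G_def N_def)
        have eq: "of_real (1 / N) * (of_real (kapX y) * u y * G y) - u y * g y
            = of_real (kapX y / N) * u y * (G y - N *\<^sub>R (of_real (w (\<phi> y)) * g y))"
        proof -
          have "of_real (kapX y / N) * u y * (N *\<^sub>R (of_real (w (\<phi> y)) * g y))
              = of_real (kapX y * w (\<phi> y)) * (u y * g y)"
            using N by (simp add: scaleR_conv_of_real field_simps)
          also have "\<dots> = u y * g y" unfolding kw by simp
          finally show ?thesis unfolding right_diff_distrib by simp
        qed
        have "norm (of_real (1 / N) * (of_real (kapX y) * u y * G y) - u y * g y)
            = (\<bar>kapX y\<bar> / N * cmod (u y)) * norm (G y - N *\<^sub>R (of_real (w (\<phi> y)) * g y))"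
          unfolding eq using N by (simp add: norm_mult norm_divide)
        also have "\<dots> \<le> (Ck / N * cmod (u y)) * (N * e')"
          using N Ck close by (intro mult_mono mult_right_mono divide_right_mono) auto
        finally have "norm (of_real (1 / N) * (of_real (kapX y) * u y * G y) - u y * g y)
            \<le> (Ck / N * cmod (u y)) * (N * e')" .
        then show ?thesis using N by (simp add: mult_ac)
      qed simp
    qed (use pairing(2) ug L2_integrable[OF u] in auto)
    also have "\<dots> = Ck * I * e'" by (simp add: I_def)
    also have "\<dots> < Ck * (I + 1) * e'" using Ck e' by simp
    also have "\<dots> = e" using Ck I by (simp add: e'_def)
    finally show ?case unfolding dist_norm N_def .
  qed
qed

text \<open>Once divided by the mass, the kernels have height a constant over the mass, while slices
  measure a constant times the mass. Schur's test thus bounds \<open>f n\<close> and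
  \<open>P (f n)\<close> independently of \<open>n\<close>.\<close>

lemma localized_adjoint_in_closure:
  assumes uv: "(u, v) \<in> adjoint_graph A M P"
    and supp: "\<And>y. u y \<noteq> 0 \<Longrightarrow> y \<in> U \<and> norm (\<phi> y - y0) < 2 * r"
  shows "(u, v) \<in> L2_closure M (operator_graph A P)"
proof -
  interpret finite_measure M by (rule finite_M)
  have sigma: "sigma_finite_measure M" by unfold_locales
  have uL: "u \<in> L2 M" and vL: "v \<in> L2 M" using uv by (auto simp: adjoint_graph_iff)
  \<comment> \<open>Packs both moduli into one square-integrable function, because the bound for
    \<open>P\<close> of the mollified function involves \<open>u\<close> and \<open>v\<close>
    together.\<close>
  define uv' where "uv' y = complex_of_real (cmod (u y) + cmod (v y))" for y
  have uv'_cmod: "cmod (uv' y) = cmod (u y) + cmod (v y)" for y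
    unfolding uv'_def norm_of_real by simp
  have uv'L: "uv' \<in> L2 M"
  proof -
    have norm_L2: "(\<lambda>y. complex_of_real (cmod (h y))) \<in> L2 M" if "h \<in> L2 M" for h
      by (rule L2_dominated(1)[OF that, where C = 1]) (use L2_measurable[OF that] in auto)
    show ?thesis
      using L2_add[OF norm_L2[OF uL] norm_L2[OF vL]] by (simp add: uv'_def[abs_def])
  qed
  obtain C0 where C0: "0 < C0" "\<And>s x. 0 < s \<Longrightarrow>
    (\<integral>\<^sup>+y. indicator (near_pairs s) (x, y) \<partial>M) \<le> ennreal (C0 * bump_mass TYPE('e) s)"
    by (rule near_pairs_slice) blast
  obtain C1 where C1: "0 < C1" "\<And>s u x. 0 < s \<Longrightarrow> u \<in> L2 M \<Longrightarrow> ennreal (cmod (mollify s u x))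
    \<le> ennreal C1 * (\<integral>\<^sup>+y. indicator (near_pairs s) (x, y) * ennreal (cmod (u y)) \<partial>M)"
    by (rule mollify_bound) blast
  obtain C2 where C2: "0 < C2" "\<And>s u v x. 0 < s \<Longrightarrow> (u, v) \<in> adjoint_graph A M P \<Longrightarrow>
    (\<And>y. u y \<noteq> 0 \<Longrightarrow> y \<in> U \<and> norm (\<phi> y - y0) < 2 * r) \<Longrightarrow>
    ennreal (cmod (P (mollify s u) x)) \<le>
      ennreal C2 * (\<integral>\<^sup>+y. indicator (near_pairs s) (x, y) * ennreal (cmod (u y) + cmod (v y)) \<partial>M)"
    by (rule P_mollify_bound) blast
  \<comment> \<open>Schur's test with height \<open>K / ?N\<close> and slices
    \<open>C0 * ?N\<close>; the mass cancels in the product.\<close>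
  have scaled: "L2_norm M f \<le> K * C0 * L2_norm M h"
    if s: "0 < s" and h: "h \<in> L2 M" and f: "f \<in> borel_measurable M" and K: "0 < K"
      and le: "\<And>x. ennreal (cmod (f x)) \<le> ennreal (1 / bump_mass TYPE('e) s) *
        (ennreal K * (\<integral>\<^sup>+y. indicator (near_pairs s) (x, y) * ennreal (cmod (h y)) \<partial>M))" for s K f h
  proof -
    let ?N = "bump_mass TYPE('e) s"
    have N: "0 < ?N" by (rule bump_mass_pos[OF s])
    have flip: "(\<integral>\<^sup>+x. indicator (near_pairs s) (x, y) \<partial>M) \<le> ennreal (C0 * ?N)" for y
    proof -
      have "(\<integral>\<^sup>+x. indicator (near_pairs s) (x, y) \<partial>M) = (\<integral>\<^sup>+x. indicator (near_pairs s) (y, x) \<partial>M)"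
        using near_pairs_sym by (intro nn_integral_cong) (auto simp: indicator_def)
      then show ?thesis using C0(2)[OF s, of y] by simp
    qed
    have "L2_norm M f \<le> (K / ?N) * (C0 * ?N) * L2_norm M h"
    proof (rule Schur_test(2)[OF sigma near_pairs_measurable C0(2)[OF s] flip h f])
      show "ennreal (cmod (f x)) \<le> ennreal (K / ?N) *
          (\<integral>\<^sup>+y. indicator (near_pairs s) (x, y) * ennreal (cmod (h y)) \<partial>M)" for x
      proof -
        have "ennreal (K / ?N) = ennreal (1 / ?N) * ennreal K"
          using N K by (simp add: ennreal_mult[symmetric])
        then show ?thesis using le[of x] by (simp add: mult.assoc)
      qed
    qed (use N K C0 in auto)
    then show ?thesis using N by simp
  qed
  define s where "s n = r / real (Suc n)" for n
  have s: "0 < s n" for n using r by (simp add: s_def)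
  have s0: "s \<longlonglongrightarrow> 0"
    using LIMSEQ_Suc[OF lim_const_over_n[of r]] by (simp add: s_def[abs_def])
  define f where "f n x = complex_of_real (1 / bump_mass TYPE('e) (s n)) * mollify (s n) u x" for n x
  have f_smooth: "f n \<in> smooth_functions A" for n
    unfolding f_def[abs_def] by (rule smooth_scale[OF mollify_smooth[OF uL s]])
  have cmod_scale: "ennreal (cmod (complex_of_real (1 / bump_mass TYPE('e) (s n)) * z))
      = ennreal (1 / bump_mass TYPE('e) (s n)) * ennreal (cmod z)" for n z
    using bump_mass_pos[OF s[of n], where 'e = 'e] by (simp add: norm_mult norm_divide ennreal_mult[symmetric])
  have bound_f: "L2_norm M (f n) \<le> C1 * C0 * L2_norm M u" for n
  proof (rule scaled[OF s uL smooth_measurable[OF f_smooth] C1(1)])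
    show "ennreal (cmod (f n x)) \<le> ennreal (1 / bump_mass TYPE('e) (s n)) *
        (ennreal C1 * (\<integral>\<^sup>+y. indicator (near_pairs (s n)) (x, y) * ennreal (cmod (u y)) \<partial>M))" for x
      unfolding f_def cmod_scale by (intro mult_left_mono C1(2) s uL) simp
  qed
  have bound_Pf: "L2_norm M (P (f n)) \<le> C2 * C0 * L2_norm M uv'" for n
  proof (rule scaled[OF s uv'L smooth_measurable[OF P_smooth[OF f_smooth]] C2(1)])
    fix x
    have "P (f n) x = complex_of_real (1 / bump_mass TYPE('e) (s n)) * P (mollify (s n) u) x"
      unfolding f_def[abs_def] by (rule P_scale[OF mollify_smooth[OF uL s]])
    then show "ennreal (cmod (P (f n) x)) \<le> ennreal (1 / bump_mass TYPE('e) (s n)) *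
        (ennreal C2 * (\<integral>\<^sup>+y. indicator (near_pairs (s n)) (x, y) * ennreal (cmod (uv' y)) \<partial>M))"
      unfolding uv'_cmod by (simp only: cmod_scale) (intro mult_left_mono C2(2) s uv supp; simp)
  qed
  show ?thesis
  proof (rule adjoint_in_closure_by_bounded_approximation[OF uv f_smooth])
    define C where "C = max (C1 * C0 * L2_norm M u) (C2 * C0 * L2_norm M uv')"
    show "L2_norm M (f n) \<le> C" "L2_norm M (P (f n)) \<le> C" for n
      using bound_f[of n] bound_Pf[of n] by (auto simp: C_def)
    show "(\<lambda>n. \<integral>x. f n x * g x \<partial>M) \<longlonglongrightarrow> (\<integral>x. u x * g x \<partial>M)" if "g \<in> smooth_functions A" for g
      unfolding f_def by (rule mollify_weak_limit[OF uL that supp s s0])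
  qed
qed

end

section \<open>Patching the local results together\<close>

context positive_dim_operator
begin

text \<open>The radii match: \<open>\<psi>\<close> vanishes from coordinate distance
  \<open>2 * r\<close> on, so a localized pair meets the support condition of the mollifier. The
  smaller set on which \<open>\<psi>\<close> is 1 provides the open cover.\<close>

lemma localizing_function:
  obtains V \<psi> where "open V" "x \<in> V" "\<And>y. y \<in> V \<Longrightarrow> \<psi> y = 1" "\<psi> \<in> smooth_functions A"
    "\<And>u v. (u, v) \<in> adjoint_graph A M P \<Longrightarrow>
      (\<lambda>x. \<psi> x * u x, \<lambda>x. \<psi> x * v x - u x * commutator \<psi> x) \<in> L2_closure M (operator_graph A P)"
proof -
  obtain U \<phi> r where cU: "(U, \<phi>) \<in> A" "x \<in> U" and cr: "0 < r" "cball (\<phi> x) (4 * r) \<subseteq> \<phi> ` (U \<inter> UNIV)"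
    by (rule chart_ball[OF open_UNIV UNIV_I[of x]])
  obtain w where w: "smooth_on (\<phi> ` U) w" "\<And>y. y \<in> \<phi> ` U \<Longrightarrow> w y > 0"
    "distr (restrict_space M U) borel \<phi> =
      density (model_measure E) (\<lambda>y. ennreal (indicator (\<phi> ` U) y * w y))"
    "(\<lambda>y. indicator (\<phi> ` U) y * w y) \<in> borel_measurable borel"
    using chart_density[OF cU(1)] by blast
  obtain a :: "'e \<Rightarrow> 'e \<Rightarrow> complex" and b :: "'e \<Rightarrow> complex" where ab:
    "\<And>i. i \<in> Basis \<inter> E \<Longrightarrow> smooth_on (\<phi> ` U) (a i)" "smooth_on (\<phi> ` U) b"
    "\<And>f x. f \<in> smooth_functions A \<Longrightarrow> x \<in> U \<Longrightarrow> P f x =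
      (\<Sum>i\<in>Basis \<inter> E. a i (\<phi> x) *
        frechet_derivative (\<lambda>y. f (inv_into U \<phi> y)) (at (\<phi> x) within \<phi> ` U) i) + b (\<phi> x) * f x"
    by (rule operator_coefficients[OF cU(1)]) blast
  interpret chart_mollifier E A M P U \<phi> "\<phi> x" r w a b
  proof unfold_locales
    show "P f x = (\<Sum>i\<in>Basis. a i (\<phi> x) *
        frechet_derivative (\<lambda>y. f (inv_into U \<phi> y)) (at (\<phi> x)) i) + b (\<phi> x) * f x"
      if "f \<in> smooth_functions A" "x \<in> U" for f x
      using ab(3)[OF that] that(2) at_within_open[OF _ chart_image_open[OF cU(1)], of "\<phi> x"]
      by (simp add: E_UNIV)
  qed (use cU cr w ab in \<open>auto simp: E_UNIV model_measure_def\<close>)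
  define \<psi> where "\<psi> = extend_chart U \<phi> (\<lambda>y. complex_of_real (bump r (y - \<phi> x)))"
  have \<psi>: "\<psi> \<in> smooth_functions A"
    unfolding \<psi>_def
  proof (rule smooth_bump_at[OF cU(1) cr(1)])
    have "cball (\<phi> x) (2 * r) \<subseteq> cball (\<phi> x) (4 * r)" using cr(1) by (intro subset_cball) simp
    then show "cball (\<phi> x) (2 * r) \<subseteq> \<phi> ` U" using cr(2) by blast
  qed
  show thesis
  proof (rule that)
    show "open (U \<inter> \<phi> -` ball (\<phi> x) r)"
      by (rule continuous_open_preimage[OF chart(3)[OF cU(1)] chart(1)[OF cU(1)] open_ball])
    show "x \<in> U \<inter> \<phi> -` ball (\<phi> x) r" using cU cr by simp
    show "\<psi> y = 1" if "y \<in> U \<inter> \<phi> -` ball (\<phi> x) r" for y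
      using that by (simp add: \<psi>_def extend_chart_def bump_eq_1 dist_norm norm_minus_commute)
    show "\<psi> \<in> smooth_functions A" by (rule \<psi>)
    fix u v assume uv: "(u, v) \<in> adjoint_graph A M P"
    show "(\<lambda>x. \<psi> x * u x, \<lambda>x. \<psi> x * v x - u x * commutator \<psi> x) \<in> L2_closure M (operator_graph A P)"
    proof (rule localized_adjoint_in_closure[OF adjoint_localize[OF uv \<psi>]])
      fix y assume "\<psi> y * u y \<noteq> 0"
      then have "\<psi> y \<noteq> 0" by simp
      then show "y \<in> U \<and> norm (\<phi> y - \<phi> x) < 2 * r"
        using bump_eq_0[OF cr(1), of "\<phi> y - \<phi> x"]
        by (auto simp: \<psi>_def extend_chart_def not_less[symmetric] split: if_splits)
    qed
  qed
qed

lemma essentially_self_adjoint_positive_dim: "essentially_self_adjoint A M P"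
proof -
  have "\<exists>q. open (fst q) \<and> x \<in> fst q \<and> (\<forall>y\<in>fst q. snd q y = 1) \<and> snd q \<in> smooth_functions A \<and>
      (\<forall>u v. (u, v) \<in> adjoint_graph A M P \<longrightarrow>
      (\<lambda>x. snd q x * u x, \<lambda>x. snd q x * v x - u x * commutator (snd q) x)
        \<in> L2_closure M (operator_graph A P))" for x
  proof -
    obtain V \<psi> where "open V" "x \<in> V" "\<And>y. y \<in> V \<Longrightarrow> \<psi> y = 1" "\<psi> \<in> smooth_functions A"
      "\<And>u v. (u, v) \<in> adjoint_graph A M P \<Longrightarrow>
        (\<lambda>x. \<psi> x * u x, \<lambda>x. \<psi> x * v x - u x * commutator \<psi> x) \<in> L2_closure M (operator_graph A P)"
      by (rule localizing_function[of x]) blast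
    then show ?thesis by (intro exI[of _ "(V, \<psi>)"]) simp
  qed
  then have "\<forall>x. \<exists>q. open (fst q) \<and> x \<in> fst q \<and> (\<forall>y\<in>fst q. snd q y = 1) \<and> snd q \<in> smooth_functions A \<and>
      (\<forall>u v. (u, v) \<in> adjoint_graph A M P \<longrightarrow>
      (\<lambda>x. snd q x * u x, \<lambda>x. snd q x * v x - u x * commutator (snd q) x)
        \<in> L2_closure M (operator_graph A P))" by blast
  from choice[OF this] obtain q where q: "\<And>x. open (fst (q x))" "\<And>x. x \<in> fst (q x)"
    "\<And>x y. y \<in> fst (q x) \<Longrightarrow> snd (q x) y = 1" "\<And>x. snd (q x) \<in> smooth_functions A"
    "\<And>x u v. (u, v) \<in> adjoint_graph A M P \<Longrightarrow>
      (\<lambda>y. snd (q x) y * u y, \<lambda>y. snd (q x) y * v y - u y * commutator (snd (q x)) y)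
        \<in> L2_closure M (operator_graph A P)"
    by blast
  have cover: "UNIV \<subseteq> (\<Union>x\<in>UNIV. fst (q x))" using q(2) by blast
  obtain D where D: "D \<subseteq> UNIV" "finite D" "UNIV \<subseteq> (\<Union>x\<in>D. fst (q x))"
    by (rule compactE_image[OF compact_manifold q(1) cover])
  obtain xs where xs: "set xs = D" using finite_list[OF D(2)] by blast
  have "(u, v) \<in> L2_closure M (operator_graph A P)" if uv: "(u, v) \<in> adjoint_graph A M P" for u v
  proof (rule adjoint_in_closure_by_localization[OF _ _ uv])
    show "\<psi> \<in> smooth_functions A" if "\<psi> \<in> set (map (\<lambda>x. snd (q x)) xs)" for \<psi>
      using that q(4) by auto
    show "(\<lambda>x. \<psi> x * u x, \<lambda>x. \<psi> x * v x - u x * commutator \<psi> x) \<in> L2_closure M (operator_graph A P)"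
      if "\<psi> \<in> set (map (\<lambda>x. snd (q x)) xs)" "(u, v) \<in> adjoint_graph A M P" for \<psi> u v
      using that q(5) by auto
    \<comment> \<open>Every point lies in some member of the finite cover, where the corresponding
      factor is 0.\<close>
    show "(\<Prod>\<psi>\<leftarrow>map (\<lambda>x. snd (q x)) xs. 1 - \<psi> y) * u y = 0" for y
    proof -
      obtain x where "x \<in> set xs" "y \<in> fst (q x)" using D(3) xs by blast
      then have "\<exists>x\<in>set xs. 1 - snd (q x) y = 0" using q(3) by auto
      then have "(\<Prod>\<psi>\<leftarrow>map (\<lambda>x. snd (q x)) xs. 1 - \<psi> y) = 0"
        by (auto simp: prod_list_zero_iff o_def image_iff)
      then show ?thesis by simp
    qed
  qed
  then show ?thesis
    using closure_subset_adjoint by (auto simp: essentially_self_adjoint_def)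
qed

end

theorem theorem3p1:
  fixes E :: "'e::euclidean_space set"
    and A :: "('a::t2_space, 'e) chart set"
    and M :: "'a measure"
    and P :: "('a \<Rightarrow> complex) \<Rightarrow> 'a \<Rightarrow> complex"
  assumes "closed_manifold E A"
    and "smooth_density E A M"
    and "differential_operator1 E A P"
    and "symmetric_operator A M P"
  shows "essentially_self_adjoint A M P"
proof -
  interpret manifold_operator E A M P
    by unfold_locales (fact assms)+
  show ?thesis
  \<comment> \<open>On the point \<open>{0}\<close> there is nothing to mollify, so dimension 0 is
    settled by smoothness of all functions.\<close>
  proof (cases "E = UNIV")
    case True
    then interpret positive_dim_operator E A M P
      by unfold_locales
    show ?thesis by (rule essentially_self_adjoint_positive_dim)
  next
    case False
    then show ?thesis using E_cases essentially_self_adjoint_zero_dim by blast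
  qed
qed

end
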